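(* Let $n=2$ and let $F$ be the geometric Brownian motion on $\mathbf{SL}(2)$ defined in the context. For any $\tau\ge0$, $$\mathbb{E}\Big[|F_\tau|^2\,I\Big(|F_\tau|^2\ge\tfrac{1}{2\sqrt2}\big(\mathbb{E}|F_\tau|^2\big)^{\frac32}\Big)\Big]\ge\frac14\,\mathbb{E}|F_\tau|^2,$$ where $I(\cdot)$ denotes the indicator function of an event.
   Context: $\mathfrak{sl}(2)$ is the space of trace-free endomorphisms of $\mathbb{R}^2$. $B$ is the Brownian motion on $\mathfrak{sl}(2)$, unique in law, such that the solution $F$ of the Stratonovich equation $dF=F_\tau\circ dB$, $F_{\tau=0}=\mathrm{id}$ satisfies: (i) $OFO^{-1}=_{\mathrm{law}}F$ for all $O\in\mathbf{O}(2)$; (ii) $F_\tau\circ dB=F_\tau dB$, i.e. Itô and Stratonovich products coincide; (iii) $\mathbb{E}F_\tau F_\tau^*=e^\tau\mathrm{id}$. (Equivalently: $OBO^{-1}=_{\mathrm{law}}B$ for all $O\in\mathbf{O}(2)$, $\mathbb{E}B_\tau B_\tau=0$, $\mathbb{E}B_\tau B_\tau^*=\tau\,\mathrm{id}$.) $|F|^2=\mathrm{tr}\,FF^*$ is the Frobenius norm. *)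

theory Defs
  imports "HOL-Probability.Probability"
begin

definition sl2 :: "(real^2^2) set" where
  "sl2 = {A. trace A = 0}"

text \<open>Squared Frobenius norm.\<close>

definition frobenius_sq :: "real^2^2 \<Rightarrow> real" where
  "frobenius_sq A = trace (A ** transpose A)"

text \<open>The centred normal law with variance \<open>v \<ge> 0\<close>. The degenerate case is included because
  a Brownian motion on a linear subspace is constant in the directions orthogonal to it.\<close>

definition centred_normal :: "real \<Rightarrow> real measure" where
  "centred_normal v =
     (if v = 0 then return borel 0
      else density lborel (\<lambda>x. ennreal (normal_density 0 (sqrt v) x)))"

text \<open>The law, on path space with the product \<open>\<sigma>\<close>-algebra, of a process indexed by \<open>[0,\<infinity>)\<close>.\<close>

definition process_law ::
    "'a measure \<Rightarrow> (real \<Rightarrow> 'a \<Rightarrow> 'b::topological_space) \<Rightarrow> (real \<Rightarrow> 'b) measure" where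
  "process_law M X =
     distr M (Pi\<^sub>M {0..} (\<lambda>_. borel)) (\<lambda>\<omega>. \<lambda>t\<in>{0..}. X t \<omega>)"

text \<open>Only the values of \<open>p\<close> on \<open>{..n}\<close> matter:
  \<open>0 = p 0 \<le> p 1 \<le> \<dots> \<le> p n = t\<close>, with mesh smaller than \<open>\<delta>\<close>.\<close>

definition fine_partition :: "real \<Rightarrow> real \<Rightarrow> nat \<Rightarrow> (nat \<Rightarrow> real) \<Rightarrow> bool" where
  "fine_partition \<delta> t n p \<longleftrightarrow>
     p 0 = 0 \<and> p n = t \<and> (\<forall>i<n. p i \<le> p (Suc i) \<and> p (Suc i) - p i < \<delta>)"

definition partition_limit_in_prob ::
    "'a measure \<Rightarrow> real \<Rightarrow> (nat \<Rightarrow> (nat \<Rightarrow> real) \<Rightarrow> 'a \<Rightarrow> 'b::real_normed_vector)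
      \<Rightarrow> ('a \<Rightarrow> 'b) \<Rightarrow> bool" where
  "partition_limit_in_prob M t S I \<longleftrightarrow>
     I \<in> borel_measurable M \<and>
     (\<forall>\<epsilon>>0. \<forall>\<eta>>0. \<exists>\<delta>>0. \<forall>n p. fine_partition \<delta> t n p \<longrightarrow>
        measure M {\<omega> \<in> space M. norm (S n p \<omega> - I \<omega>) > \<epsilon>} < \<eta>)"

text \<open>Stochastic integrals \<open>\<integral>\<^sub>0\<^sup>t X dY\<close> of continuous adapted matrix-valued processes: the sums take
  the integrand at the left endpoint (Ito), respectively averaged over the two endpoints
  (Stratonovich).\<close>

definition has_ito_integral ::
    "'a measure \<Rightarrow> (real \<Rightarrow> 'a \<Rightarrow> real^2^2) \<Rightarrow> (real \<Rightarrow> 'a \<Rightarrow> real^2^2)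
      \<Rightarrow> real \<Rightarrow> ('a \<Rightarrow> real^2^2) \<Rightarrow> bool" where
  "has_ito_integral M X Y t I \<longleftrightarrow>
     partition_limit_in_prob M t
       (\<lambda>n p \<omega>. \<Sum>i<n. X (p i) \<omega> ** (Y (p (Suc i)) \<omega> - Y (p i) \<omega>)) I"

definition has_stratonovich_integral ::
    "'a measure \<Rightarrow> (real \<Rightarrow> 'a \<Rightarrow> real^2^2) \<Rightarrow> (real \<Rightarrow> 'a \<Rightarrow> real^2^2)
      \<Rightarrow> real \<Rightarrow> ('a \<Rightarrow> real^2^2) \<Rightarrow> bool" where
  "has_stratonovich_integral M X Y t I \<longleftrightarrow>
     partition_limit_in_prob M t
       (\<lambda>n p \<omega>. \<Sum>i<n. ((1/2) *\<^sub>R (X (p i) \<omega> + X (p (Suc i)) \<omega>)) **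
                        (Y (p (Suc i)) \<omega> - Y (p i) \<omega>)) I"

text \<open>Brownian motion on \<open>sl2\<close> relative to a filtration, with an arbitrary covariance, given by its
  quadratic form \<open>q\<close> with respect to the Frobenius inner product. The values of the filtration at
  negative times play no role.\<close>

locale brownian_motion_sl2 = prob_space M + filtration "space M" FF
  for M :: "'a measure" and FF :: "real \<Rightarrow> 'a measure" +
  fixes B :: "real \<Rightarrow> 'a \<Rightarrow> real^2^2"
  assumes FF_subalgebra: "\<And>t. t \<ge> 0 \<Longrightarrow> sets (FF t) \<subseteq> sets M"
    and B_sl2: "\<And>t \<omega>. t \<ge> 0 \<Longrightarrow> \<omega> \<in> space M \<Longrightarrow> B t \<omega> \<in> sl2"
    and B_adapted: "\<And>t. t \<ge> 0 \<Longrightarrow> B t \<in> borel_measurable (FF t)"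
    and B_continuous: "AE \<omega> in M. continuous_on {0..} (\<lambda>t. B t \<omega>)"
    and B_start: "AE \<omega> in M. B 0 \<omega> = 0"
    and B_indep_increments: "\<And>s t. 0 \<le> s \<Longrightarrow> s \<le> t \<Longrightarrow>
          indep_set (sets (FF s))
                    (sets (vimage_algebra (space M) (\<lambda>\<omega>. B t \<omega> - B s \<omega>) borel))"
    and B_gaussian_increments: "\<exists>q. \<forall>A. q A \<ge> 0 \<and> (\<forall>s t. 0 \<le> s \<and> s \<le> t \<longrightarrow>
          distr M borel (\<lambda>\<omega>. A \<bullet> (B t \<omega> - B s \<omega>)) = centred_normal ((t - s) * q A))"

text \<open>The geometric Brownian motion \<open>F\<close> on \<open>SL(2)\<close>: the solution of \<open>dF = F \<circ> dB\<close>, \<open>F\<^sub>0 = id\<close>,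
  with the covariance of \<open>B\<close> pinned down by the isotropy of \<open>F\<close>, by the agreement of the Ito and
  Stratonovich products \<open>F dB\<close>, and by the normalization of the second moment of \<open>F\<close>.
  No semimartingale property of \<open>F\<close> is demanded: since the two products agree, \<open>F\<close> solves the
  Ito equation and is therefore a semimartingale.\<close>

locale geometric_brownian_motion_SL2 = brownian_motion_sl2 M FF B
  for M :: "'a measure" and FF :: "real \<Rightarrow> 'a measure" and B :: "real \<Rightarrow> 'a \<Rightarrow> real^2^2" +
  fixes F :: "real \<Rightarrow> 'a \<Rightarrow> real^2^2"
  assumes F_adapted: "\<And>t. t \<ge> 0 \<Longrightarrow> F t \<in> borel_measurable (FF t)"
    and F_continuous: "AE \<omega> in M. continuous_on {0..} (\<lambda>t. F t \<omega>)"
    and F_start: "AE \<omega> in M. F 0 \<omega> = mat 1"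
    and F_stratonovich: "\<And>t. t \<ge> 0 \<Longrightarrow>
          has_stratonovich_integral M F B t (\<lambda>\<omega>. F t \<omega> - F 0 \<omega>)"
    and F_isotropic: "\<And>Q :: real^2^2. orthogonal_matrix Q \<Longrightarrow>
          process_law M (\<lambda>t \<omega>. Q ** F t \<omega> ** matrix_inv Q) = process_law M F"
    and F_ito_eq_stratonovich: "\<And>t I. t \<ge> 0 \<Longrightarrow>
          has_stratonovich_integral M F B t I \<longleftrightarrow> has_ito_integral M F B t I"
    and F_second_moment: "\<And>t. t \<ge> 0 \<Longrightarrow>
          has_bochner_integral M (\<lambda>\<omega>. F t \<omega> ** transpose (F t \<omega>)) (exp t *\<^sub>R mat 1)"

end

theory Submission
  imports Defs
begin

text \<open>A row \<open>x\<close> of \<open>F\<close> solves \<open>dx = x dB\<close>, and \<open>|x|\<^sup>2\<close> is a scalar geometric Brownian motion: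
  \<open>ln |x\<^sub>\<tau>|\<^sup>2\<close> is normal with mean \<open>\<tau>/2\<close> and variance \<open>\<tau>\<close>. Weighting with \<open>|x\<^sub>\<tau>|\<^sup>2 / e\<^sup>\<tau>\<close> shifts the mean
  to \<open>3\<tau>/2\<close>, so \<open>|x\<^sub>\<tau>|\<^sup>2 \<ge> e\<^bsup>3\<tau>/2\<^esup>\<close> holds with weighted probability one half. As \<open>|F|\<^sup>2 \<ge> |x|\<^sup>2\<close>,
  \<open>E |F|\<^sup>2 = 2 e\<^sup>\<tau>\<close> and the threshold is \<open>e\<^bsup>3\<tau>/2\<^esup>\<close>, this gives the claim.

  Instead of Ito's formula one computes \<open>E |x\<^sub>\<tau>|\<^sup>2\<^sup>a\<close> with \<open>a = 1 + i\<xi>\<close>, the characteristic function under the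
  weight. The Euler step \<open>F\<^sub>t = F\<^sub>s (1 + B\<^sub>t - B\<^sub>s) + r\<close> has a remainder of second moment \<open>O((t - s)\<^sup>2)\<close>
  that is orthogonal to the past. Together with a Taylor expansion of \<open>|x|\<^sup>2\<^sup>a\<close>, homogeneous in \<open>x\<close>, this shows
  that \<open>E |x\<^sub>t|\<^sup>2\<^sup>a\<close> satisfies a linear differential equation in \<open>t\<close>. The covariance of \<open>B\<close> enters through its
  isotropy and its normalization, both read off from \<open>F\<^sub>t - 1\<close> for small \<open>t\<close>, and through \<open>E B B = 0\<close>, which
  is the equality of the Ito and Stratonovich integrals.\<close>

subsection \<open>Two by two matrices and limits in probability\<close>

text \<open>Only second moments of \<open>F\<close> are assumed, and the integrals are known only as
  limits in probability of partition sums. This shapes the argument. The exponent \<open>a\<close>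
  has real part one, so \<open>|x|^(2a)\<close> is bounded by \<open>|x|^2\<close>; increments of
  \<open>B\<close> may be raised to high powers, but \<open>F\<close> and its remainders enter at
  most quadratically. Time steps are written as h^2, and products of factors of different order are
  split by Young's inequality with weight h. A step then has an error of order h^3, which suffices:
  T / h^2 steps accumulate an error of order h. The covariance is computed in the basis
  \<open>S1\<close>, \<open>S2\<close>, \<open>J\<close>. Reflections make it diagonal, a rotation
  by 45 degrees makes the first two entries equal, say s, and with j for the third, normalization
  gives 2s + j = 1 and the equality of the integrals gives 2s - j = 0. These values produce the rate
  a (a + 1) / 2 of the differential equation.\<close>

lemma norm_sq_22: "(norm (A::real^2^2))\<^sup>2 = (A$1$1)\<^sup>2 + (A$1$2)\<^sup>2 + (A$2$1)\<^sup>2 + (A$2$2)\<^sup>2"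
  unfolding power2_norm_eq_inner by (simp add: inner_vec_def sum_2 power2_eq_square)

lemma norm_sq_2: "(norm (x::real^2))\<^sup>2 = (x$1)\<^sup>2 + (x$2)\<^sup>2"
  unfolding power2_norm_eq_inner by (simp add: inner_vec_def sum_2 power2_eq_square)

lemma inner_22: "(A::real^2^2) \<bullet> B = A$1$1 * B$1$1 + A$1$2 * B$1$2 + A$2$1 * B$2$1 + A$2$2 * B$2$2"
  by (simp add: inner_vec_def sum_2)

lemma inner_2: "(x::real^2) \<bullet> y = x$1 * y$1 + x$2 * y$2"
  by (simp add: inner_vec_def sum_2)

lemma matrix_mult_22: "((A::real^2^2) ** (B::real^2^2)) $ i $ j = A$i$1 * B$1$j + A$i$2 * B$2$j"
  by (simp add: matrix_matrix_mult_def sum_2)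

lemma vector_matrix_mult_2: "((x::real^2) v* (B::real^2^2)) $ j = x$1 * B$1$j + x$2 * B$2$j"
  by (simp add: vector_matrix_mult_def sum_2 mult.commute)

lemma cauchy_schwarz_2: "(a * c + b * d)\<^sup>2 \<le> (a\<^sup>2 + b\<^sup>2) * (c\<^sup>2 + d\<^sup>2)" for a b c d :: real
proof -
  have "(a\<^sup>2 + b\<^sup>2) * (c\<^sup>2 + d\<^sup>2) - (a * c + b * d)\<^sup>2 = (a * d - b * c)\<^sup>2"
    by (simp add: power2_eq_square algebra_simps)
  then show ?thesis by (smt (verit) zero_le_power2)
qed

text \<open>On \<open>real^2^2\<close> the Euclidean norm is the Frobenius norm, so this is
  Cauchy-Schwarz for each of the four entries.\<close>

lemma norm_matrix_mult_22: "norm ((A::real^2^2) ** (B::real^2^2)) \<le> norm A * norm B"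
proof (rule power2_le_imp_le)
  show "(norm (A ** B))\<^sup>2 \<le> (norm A * norm B)\<^sup>2"
    unfolding power_mult_distrib norm_sq_22 matrix_mult_22
    using cauchy_schwarz_2[of "A$1$1" "B$1$1" "A$1$2" "B$2$1"]
      cauchy_schwarz_2[of "A$1$1" "B$1$2" "A$1$2" "B$2$2"]
      cauchy_schwarz_2[of "A$2$1" "B$1$1" "A$2$2" "B$2$1"]
      cauchy_schwarz_2[of "A$2$1" "B$1$2" "A$2$2" "B$2$2"]
    by (simp add: algebra_simps)
qed simp

lemma norm_vector_matrix_mult_2: "norm ((x::real^2) v* (B::real^2^2)) \<le> norm x * norm B"
proof (rule power2_le_imp_le)
  show "(norm (x v* B))\<^sup>2 \<le> (norm x * norm B)\<^sup>2"
    unfolding power_mult_distrib norm_sq_22 norm_sq_2 vector_matrix_mult_2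
    using cauchy_schwarz_2[of "x$1" "B$1$1" "x$2" "B$2$1"]
      cauchy_schwarz_2[of "x$1" "B$1$2" "x$2" "B$2$2"]
    by (simp add: algebra_simps)
qed simp

lemma row_matrix_mult_22: "((A::real^2^2) ** (B::real^2^2)) $ i = (A $ i) v* B"
  by (simp add: vec_eq_iff matrix_mult_22 vector_matrix_mult_2)

lemma matrix_mult_diff: "(A::real^2^2) ** (B - C) = A ** B - A ** C" "(B - C) ** (A::real^2^2) = B ** A - C ** A"
  by (simp_all add: vec_eq_iff matrix_mult_22 algebra_simps)

lemma frobenius_sq_eq_norm: "frobenius_sq A = (norm A)\<^sup>2"
  unfolding norm_sq_22 by (simp add: frobenius_sq_def trace_def sum_2 matrix_mult_22 transpose_def power2_eq_square)

lemma borel_measurable_nth_22 [measurable (raw)]: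
  "f \<in> borel_measurable M \<Longrightarrow> (\<lambda>x. (f x :: real^2^2) $ i $ j) \<in> borel_measurable M"
  by (rule borel_measurable_continuous_on) (intro continuous_intros)

lemma borel_measurable_nth_2 [measurable (raw)]:
  "f \<in> borel_measurable M \<Longrightarrow> (\<lambda>x. (f x :: real^2^2) $ i) \<in> borel_measurable M"
  by (rule borel_measurable_continuous_on) (intro continuous_intros)

lemma borel_measurable_nth_1 [measurable (raw)]:
  "f \<in> borel_measurable M \<Longrightarrow> (\<lambda>x. (f x :: real^2) $ i) \<in> borel_measurable M"
  by (rule borel_measurable_continuous_on) (intro continuous_intros)

lemma borel_measurable_matrix_mult_22 [measurable (raw)]:
  assumes [measurable]: "f \<in> borel_measurable M" "g \<in> borel_measurable M"
  shows "(\<lambda>x. (f x :: real^2^2) ** (g x :: real^2^2)) \<in> borel_measurable M"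
proof -
  have "continuous_on UNIV (\<lambda>p::(real^2^2) \<times> (real^2^2). fst p ** snd p)"
    unfolding matrix_matrix_mult_def by (intro continuous_intros)
  then have "(\<lambda>p::(real^2^2) \<times> (real^2^2). fst p ** snd p) \<in> borel_measurable borel"
    by (rule borel_measurable_continuous_onI)
  then have "(\<lambda>p::(real^2^2) \<times> (real^2^2). fst p ** snd p) \<in> borel \<Otimes>\<^sub>M borel \<rightarrow>\<^sub>M borel"
    by (simp add: borel_prod)
  from measurable_compose[OF _ this, of "\<lambda>x. (f x, g x)" M] show ?thesis by simp
qed

lemmas integrable_dominated = Bochner_Integration.integrable_bound

text \<open>Where \<open>Z\<close> is large, \<open>norm Y\<close> is at most
  \<open>c * (norm Y)\<^sup>2 + 1 / c\<close>; elsewhere the domination by \<open>Z\<close> and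
  \<open>W\<close> is used. With \<open>c\<close> small against the second moment, and then the
  probability small against \<open>c\<close>, a limit in probability becomes a limit in
  mean.\<close>

lemma (in prob_space) expectation_near:
  fixes Y :: "'a \<Rightarrow> 'b::{banach,second_countable_topology}" and Z :: "'a \<Rightarrow> 'c::{banach,second_countable_topology}"
  assumes [measurable]: "Y \<in> borel_measurable M" "Z \<in> borel_measurable M" "W \<in> borel_measurable M"
    and Y2: "integrable M (\<lambda>\<omega>. (norm (Y \<omega>))\<^sup>2)"
    and W: "integrable M W" "\<And>\<omega>. \<omega> \<in> space M \<Longrightarrow> norm (Y \<omega>) \<le> norm (Z \<omega>) + W \<omega>" "\<And>\<omega>. W \<omega> \<ge> 0"
    and c: "c > 0" "\<epsilon> > 0"
  shows "expectation (\<lambda>\<omega>. norm (Y \<omega>)) \<le> \<epsilon> + expectation W + c * expectation (\<lambda>\<omega>. (norm (Y \<omega>))\<^sup>2)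
           + prob {\<omega>\<in>space M. norm (Z \<omega>) > \<epsilon>} / c"
proof -
  let ?A = "{\<omega>\<in>space M. norm (Z \<omega>) > \<epsilon>}"
  have le: "norm (Y \<omega>) \<le> \<epsilon> + W \<omega> + c * (norm (Y \<omega>))\<^sup>2 + indicator ?A \<omega> / c" if "\<omega> \<in> space M" for \<omega>
  proof (cases "\<omega> \<in> ?A")
    case False
    then have "0 \<le> c * (norm (Y \<omega>))\<^sup>2" using c by simp
    with False show ?thesis using W(2)[OF that] that by auto
  next
    case True
    have "0 \<le> (sqrt c * norm (Y \<omega>) - 1 / sqrt c)\<^sup>2" by simp
    also have "\<dots> = c * (norm (Y \<omega>))\<^sup>2 + 1 / c - 2 * norm (Y \<omega>)"
      using c by (simp add: power2_diff power_mult_distrib power_divide)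
    finally have *: "2 * norm (Y \<omega>) \<le> c * (norm (Y \<omega>))\<^sup>2 + 1 / c" by simp
    have "indicator ?A \<omega> / c = 1 / c" using True by simp
    then show ?thesis using W(3)[of \<omega>] c norm_ge_zero[of "Y \<omega>"] * by linarith
  qed
  have int: "integrable M (indicator ?A :: 'a \<Rightarrow> real)" by (intro integrable_real_indicator) (auto simp: emeasure_eq_measure)
  have "expectation (\<lambda>\<omega>. norm (Y \<omega>)) \<le> expectation (\<lambda>\<omega>. \<epsilon> + W \<omega> + c * (norm (Y \<omega>))\<^sup>2 + indicator ?A \<omega> / c)"
  proof (rule integral_mono')
    show "integrable M (\<lambda>\<omega>. \<epsilon> + W \<omega> + c * (norm (Y \<omega>))\<^sup>2 + indicator ?A \<omega> / c)"
      using Y2 W(1) int by auto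
  qed (use le in \<open>auto intro: order_trans[OF norm_ge_zero]\<close>)
  also have "\<dots> = \<epsilon> + expectation W + c * expectation (\<lambda>\<omega>. (norm (Y \<omega>))\<^sup>2) + prob ?A / c"
    using Y2 W(1) int by (simp add: prob_space)
  finally show ?thesis .
qed

text \<open>A Fatou inequality for limits in probability; the factor 2 saves passing to a subsequence.\<close>

lemma (in prob_space) second_moment_limit_in_prob:
  fixes X :: "'a \<Rightarrow> 'b::{banach,second_countable_topology}"
  assumes [measurable]: "X \<in> borel_measurable M" "\<And>n. Z n \<in> borel_measurable M"
    and X2: "integrable M (\<lambda>\<omega>. (norm (X \<omega>))\<^sup>2)"
    and Z2: "\<And>n. integrable M (\<lambda>\<omega>. (norm (Z n \<omega>))\<^sup>2)" "\<And>n. n \<ge> 1 \<Longrightarrow> expectation (\<lambda>\<omega>. (norm (Z n \<omega>))\<^sup>2) \<le> C"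
    and lim: "\<And>\<epsilon> \<eta>. \<epsilon> > 0 \<Longrightarrow> \<eta> > 0 \<Longrightarrow> \<exists>n\<ge>1. prob {\<omega>\<in>space M. norm (Z n \<omega> - X \<omega>) > \<epsilon>} < \<eta>"
  shows "expectation (\<lambda>\<omega>. (norm (X \<omega>))\<^sup>2) \<le> 2 * C"
proof -
  \<comment> \<open>Truncated at \<open>K\<close>, the exceptional event contributes at most
    \<open>K\<close> times its probability. \<open>\<epsilon>\<close> and \<open>\<eta>\<close> are
    chosen so that this and \<open>2 * \<epsilon>\<^sup>2\<close> are at most \<open>e / 2\<close>
    each.\<close>
  have bound: "expectation (\<lambda>\<omega>. min ((norm (X \<omega>))\<^sup>2) (real K)) \<le> 2 * C" for K
  proof (rule field_le_epsilon)
    fix e :: real assume e: "e > 0"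
    define \<epsilon> where "\<epsilon> = sqrt (e / 4)"
    have \<epsilon>: "\<epsilon> > 0" "\<epsilon>\<^sup>2 = e / 4" using e by (auto simp: \<epsilon>_def)
    define \<eta> where "\<eta> = e / (2 * (real K + 1))"
    have \<eta>: "\<eta> > 0" using e by (simp add: \<eta>_def)
    obtain n where n: "n \<ge> 1" "prob {\<omega>\<in>space M. norm (Z n \<omega> - X \<omega>) > \<epsilon>} < \<eta>" using lim[OF \<epsilon>(1) \<eta>] by auto
    let ?A = "{\<omega>\<in>space M. norm (Z n \<omega> - X \<omega>) > \<epsilon>}"
    have le: "min ((norm (X \<omega>))\<^sup>2) (real K) \<le> 2 * (norm (Z n \<omega>))\<^sup>2 + 2 * \<epsilon>\<^sup>2 + real K * indicat_real ?A \<omega>"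
      if "\<omega> \<in> space M" for \<omega>
    proof (cases "\<omega> \<in> ?A")
      case True then show ?thesis by (simp add: min.coboundedI2)
    next
      case False
      with that have "norm (X \<omega>) \<le> norm (Z n \<omega>) + \<epsilon>"
        using norm_triangle_ineq2[of "X \<omega>" "Z n \<omega>"] by (simp add: norm_minus_commute)
      then have "(norm (X \<omega>))\<^sup>2 \<le> (norm (Z n \<omega>) + \<epsilon>)\<^sup>2" by (intro power_mono) auto
      also have "\<dots> \<le> 2 * (norm (Z n \<omega>))\<^sup>2 + 2 * \<epsilon>\<^sup>2"
        using sum_squares_bound[of "norm (Z n \<omega>)" \<epsilon>] by (simp add: power2_sum)
      finally show ?thesis using False by simp
    qed
    have int: "integrable M (indicator ?A :: 'a \<Rightarrow> real)" by (intro integrable_real_indicator) (auto simp: emeasure_eq_measure)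
    have "expectation (\<lambda>\<omega>. min ((norm (X \<omega>))\<^sup>2) (real K)) \<le>
        expectation (\<lambda>\<omega>. 2 * (norm (Z n \<omega>))\<^sup>2 + 2 * \<epsilon>\<^sup>2 + real K * indicat_real ?A \<omega>)"
      by (rule integral_mono') (use Z2 int le in auto)
    also have "\<dots> = 2 * expectation (\<lambda>\<omega>. (norm (Z n \<omega>))\<^sup>2) + 2 * \<epsilon>\<^sup>2 + K * prob ?A"
      using Z2 int by (simp add: prob_space)
    also have "\<dots> \<le> 2 * C + e / 2 + K * \<eta>"
      using Z2(2)[OF n(1)] n(2) \<epsilon> by (intro add_mono mult_left_mono) auto
    also have "K * \<eta> \<le> e / 2" using e by (simp add: \<eta>_def field_simps)
    finally show "expectation (\<lambda>\<omega>. min ((norm (X \<omega>))\<^sup>2) (real K)) \<le> 2 * C + e" by simp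
  qed
  have "(\<lambda>K. expectation (\<lambda>\<omega>. min ((norm (X \<omega>))\<^sup>2) (real K))) \<longlonglongrightarrow> expectation (\<lambda>\<omega>. (norm (X \<omega>))\<^sup>2)"
  proof (rule integral_dominated_convergence[where w="\<lambda>\<omega>. (norm (X \<omega>))\<^sup>2"])
    show "AE \<omega> in M. (\<lambda>K. min ((norm (X \<omega>))\<^sup>2) (real K)) \<longlonglongrightarrow> (norm (X \<omega>))\<^sup>2"
    proof (intro AE_I2 tendsto_eventually)
      fix \<omega>
      show "\<forall>\<^sub>F K in sequentially. min ((norm (X \<omega>))\<^sup>2) (real K) = (norm (X \<omega>))\<^sup>2"
        using eventually_ge_at_top[of "nat \<lceil>(norm (X \<omega>))\<^sup>2\<rceil>"]
        by eventually_elim (simp add: min_def nat_ceiling_le_eq)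
    qed
  qed (use X2 in auto)
  then show ?thesis by (rule LIMSEQ_le_const2) (use bound in auto)
qed

text \<open>The quotient of factorials is the double factorial (2k - 1)!!. The point mass is treated
  apart, where \<open>k = 0\<close> leaves \<open>0 ^ 0 = 1\<close>.\<close>

lemma centred_normal_even_moment:
  assumes "v \<ge> 0"
  shows "integrable (centred_normal v) (\<lambda>x. x ^ (2 * k))"
    "integral\<^sup>L (centred_normal v) (\<lambda>x. x ^ (2 * k)) = v ^ k * (fact (2 * k) / (2 ^ k * fact k))"
proof -
  have "integrable (centred_normal v) (\<lambda>x. x ^ (2 * k)) \<and>
    integral\<^sup>L (centred_normal v) (\<lambda>x. x ^ (2 * k)) = v ^ k * (fact (2 * k) / (2 ^ k * fact k))"
  proof (cases "v = 0")
    case True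
    interpret prob_space "return borel (0::real)" by (rule prob_space_return) simp
    have "integrable (return borel (0::real)) (\<lambda>x. x ^ (2 * k))"
      by (rule integrable_const_bound[where B="0 ^ (2 * k)"]) (auto simp: AE_return)
    with True show ?thesis using prob_space by (cases k) (auto simp: centred_normal_def integral_return)
  next
    case False
    with assms have v: "sqrt v > 0" "(sqrt v)\<^sup>2 = v" "v > 0" by auto
    have "has_bochner_integral lborel (\<lambda>x. normal_density 0 (sqrt v) x * x ^ (2 * k))
        (fact (2 * k) / ((2 / v) ^ k * fact k))"
      using normal_moment_even[OF v(1), of 0 k] v by simp
    moreover have "fact (2 * k) / ((2 / v) ^ k * fact k) = v ^ k * (fact (2 * k) / (2 ^ k * fact k))"
      using v by (simp add: power_divide)
    ultimately have "has_bochner_integral (density lborel (\<lambda>x. ennreal (normal_density 0 (sqrt v) x)))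
        (\<lambda>x. x ^ (2 * k)) (v ^ k * (fact (2 * k) / (2 ^ k * fact k)))"
      by (intro has_bochner_integral_density) auto
    then show ?thesis using False by (auto simp: centred_normal_def has_bochner_integral_iff)
  qed
  then show "integrable (centred_normal v) (\<lambda>x. x ^ (2 * k))"
    "integral\<^sup>L (centred_normal v) (\<lambda>x. x ^ (2 * k)) = v ^ k * (fact (2 * k) / (2 ^ k * fact k))" by auto
qed

lemma centred_normal_mean:
  assumes "v \<ge> 0"
  shows "integral\<^sup>L (centred_normal v) (\<lambda>x. x) = 0"
proof (cases "v = 0")
  case True
  then show ?thesis by (auto simp: centred_normal_def integral_return)
next
  case False
  with assms have v: "sqrt v > 0" by auto
  have "has_bochner_integral (density lborel (\<lambda>x. ennreal (normal_density 0 (sqrt v) x))) (\<lambda>x. x) 0"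
    using normal_moment_nz_1[OF v, of 0] by (intro has_bochner_integral_density) auto
  then show ?thesis using False by (auto simp: centred_normal_def has_bochner_integral_iff)
qed

text \<open>Applied with \<open>\<eta>\<close> the square root of a time step: a factor with second
  moment of order \<open>\<eta> ^ 4\<close> is balanced against one of order
  \<open>\<eta> ^ 2\<close>, and both resulting terms are of order
  \<open>\<eta> ^ 3\<close>.\<close>

lemma young: "2 * (u * v) \<le> u\<^sup>2 / \<eta> + \<eta> * v\<^sup>2" if "\<eta> > 0" for u v \<eta> :: real
proof -
  have "0 \<le> (u - \<eta> * v)\<^sup>2 / \<eta>" using that by simp
  also have "\<dots> = u\<^sup>2 / \<eta> + \<eta> * v\<^sup>2 - 2 * (u * v)"
    using that by (simp add: power2_eq_square field_simps)
  finally show ?thesis by simp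
qed

lemma power_sum4_le:
  fixes a b c d :: real
  assumes "a \<ge> 0" "b \<ge> 0" "c \<ge> 0" "d \<ge> 0"
  shows "(a + b + c + d) ^ k \<le> 4 ^ k * (a ^ k + b ^ k + c ^ k + d ^ k)"
proof -
  define m where "m = max (max a b) (max c d)"
  have "(a + b + c + d) ^ k \<le> (4 * m) ^ k" using assms by (intro power_mono) (auto simp: m_def)
  also have "\<dots> = 4 ^ k * m ^ k" by (simp add: power_mult_distrib)
  also have "m = a \<or> m = b \<or> m = c \<or> m = d" by (auto simp: m_def max_def)
  then have "m ^ k \<le> a ^ k + b ^ k + c ^ k + d ^ k"
    using assms by (auto simp: add_nonneg_nonneg)
  finally show ?thesis by simp
qed

section \<open>Moments of Brownian increments and their independence of the past\<close>

context brownian_motion_sl2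
begin

lemma FF_M_measurable: "s \<ge> 0 \<Longrightarrow> G \<in> borel_measurable (FF s) \<Longrightarrow> G \<in> borel_measurable M"
  using FF_subalgebra[of s] space_F[of s] by (auto simp: measurable_def)

lemma FF_mono_measurable: "s \<le> t \<Longrightarrow> G \<in> borel_measurable (FF s) \<Longrightarrow> G \<in> borel_measurable (FF t)"
  using sets_F_mono[of s t] space_F[of s] space_F[of t] by (auto simp: measurable_def)

lemma B_measurable [measurable]: "t \<ge> 0 \<Longrightarrow> B t \<in> borel_measurable M"
  using B_adapted FF_M_measurable by blast

text \<open>The sigma-algebras generated by \<open>G\<close> and by \<open>\<psi>\<close> of the
  increment are contained in the two that are assumed independent. \<open>G\<close> takes values in
  a general field so that real entries of \<open>F\<close> and complex phases are both
  covered.\<close>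

lemma indep_increment:
  fixes G :: "'a \<Rightarrow> 'c::{real_normed_field,banach,second_countable_topology}" and \<psi> :: "real^2^2 \<Rightarrow> real"
  assumes st: "0 \<le> s" "s \<le> t" and G: "G \<in> borel_measurable (FF s)" "integrable M G"
    and \<psi>: "\<psi> \<in> borel_measurable borel" "integrable M (\<lambda>\<omega>. \<psi> (B t \<omega> - B s \<omega>))"
  shows "integrable M (\<lambda>\<omega>. G \<omega> * of_real (\<psi> (B t \<omega> - B s \<omega>)))"
    "expectation (\<lambda>\<omega>. G \<omega> * of_real (\<psi> (B t \<omega> - B s \<omega>))) =
       expectation G * of_real (expectation (\<lambda>\<omega>. \<psi> (B t \<omega> - B s \<omega>)))"
proof -
  have [measurable]: "(\<lambda>x. of_real (\<psi> x) :: 'c) \<in> borel_measurable borel" using \<psi>(1) by measurable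
  have GM [measurable]: "G \<in> borel_measurable M" using FF_M_measurable[OF st(1) G(1)] .
  have [measurable]: "B t \<in> borel_measurable M" "B s \<in> borel_measurable M" using st by auto
  have "indep_var borel G borel (\<lambda>\<omega>. of_real (\<psi> (B t \<omega> - B s \<omega>)) :: 'c)"
    unfolding indep_var_eq
  proof (intro conjI)
    show "G \<in> borel_measurable M" by fact
    show "(\<lambda>\<omega>. of_real (\<psi> (B t \<omega> - B s \<omega>)) :: 'c) \<in> borel_measurable M" by measurable
    have 1: "sigma_sets (space M) {G -` A \<inter> space M |A. A \<in> sets borel} \<subseteq> sets (FF s)"
    proof -
      have "{G -` A \<inter> space M |A. A \<in> sets borel} \<subseteq> sets (FF s)"
        using measurable_sets[OF G(1)] by (auto simp: space_F)
      then have "sigma_sets (space (FF s)) {G -` A \<inter> space M |A. A \<in> sets borel} \<subseteq> sets (FF s)"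
        by (rule sets.sigma_sets_subset)
      then show ?thesis by (simp add: space_F)
    qed
    let ?V = "vimage_algebra (space M) (\<lambda>\<omega>. B t \<omega> - B s \<omega>) borel"
    have 2: "sigma_sets (space M) {(\<lambda>\<omega>. of_real (\<psi> (B t \<omega> - B s \<omega>)) :: 'c) -` A \<inter> space M |A. A \<in> sets borel} \<subseteq> sets ?V"
    proof -
      have d: "(\<lambda>\<omega>. B t \<omega> - B s \<omega>) \<in> ?V \<rightarrow>\<^sub>M borel"
        by (rule measurable_vimage_algebra1) simp
      have "(\<lambda>\<omega>. of_real (\<psi> (B t \<omega> - B s \<omega>)) :: 'c) \<in> ?V \<rightarrow>\<^sub>M borel"
        by (rule measurable_compose[OF d]) measurable
      from measurable_sets[OF this]
      have "{(\<lambda>\<omega>. of_real (\<psi> (B t \<omega> - B s \<omega>)) :: 'c) -` A \<inter> space M |A. A \<in> sets borel} \<subseteq> sets ?V"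
        by auto
      then have "sigma_sets (space ?V) {(\<lambda>\<omega>. of_real (\<psi> (B t \<omega> - B s \<omega>)) :: 'c) -` A \<inter> space M |A. A \<in> sets borel} \<subseteq> sets ?V"
        by (rule sets.sigma_sets_subset)
      then show ?thesis by simp
    qed
    show "indep_set (sigma_sets (space M) {G -` A \<inter> space M |A. A \<in> sets borel})
      (sigma_sets (space M) {(\<lambda>\<omega>. of_real (\<psi> (B t \<omega> - B s \<omega>)) :: 'c) -` A \<inter> space M |A. A \<in> sets borel})"
      using B_indep_increments[OF st] 1 2 unfolding indep_sets2_eq by blast
  qed
  moreover have "integrable M (\<lambda>\<omega>. of_real (\<psi> (B t \<omega> - B s \<omega>)) :: 'c)" using \<psi>(2) by simp
  moreover have "expectation (\<lambda>\<omega>. of_real (\<psi> (B t \<omega> - B s \<omega>)) :: 'c) = of_real (expectation (\<lambda>\<omega>. \<psi> (B t \<omega> - B s \<omega>)))"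
    by (rule integral_bounded_linear[OF bounded_linear_of_real \<psi>(2)])
  ultimately show "integrable M (\<lambda>\<omega>. G \<omega> * of_real (\<psi> (B t \<omega> - B s \<omega>)))"
    "expectation (\<lambda>\<omega>. G \<omega> * of_real (\<psi> (B t \<omega> - B s \<omega>))) =
       expectation G * of_real (expectation (\<lambda>\<omega>. \<psi> (B t \<omega> - B s \<omega>)))"
    using indep_var_integrable[of G "\<lambda>\<omega>. of_real (\<psi> (B t \<omega> - B s \<omega>))"]
      indep_var_lebesgue_integral[of G "\<lambda>\<omega>. of_real (\<psi> (B t \<omega> - B s \<omega>))"] G(2) by auto
qed

text \<open>The quadratic form of the Gaussian assumption is only known to exist; the increment over
  the unit interval recovers it together with its polarization.\<close>

definition cov :: "real^2^2 \<Rightarrow> real^2^2 \<Rightarrow> real" where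
  "cov A A' = expectation (\<lambda>\<omega>. (A \<bullet> (B 1 \<omega> - B 0 \<omega>)) * (A' \<bullet> (B 1 \<omega> - B 0 \<omega>)))"

text \<open>The variance is left arbitrary because the case \<open>k = 1\<close> is what identifies
  the quadratic form with \<open>cov\<close> in \<open>increment_distr\<close>.\<close>

lemma increment_even_moment':
  fixes A :: "real^2^2"
  assumes st: "0 \<le> s" "s \<le> t" "0 \<le> v" and d: "distr M borel (\<lambda>\<omega>. A \<bullet> (B t \<omega> - B s \<omega>)) = centred_normal v"
  shows "integrable M (\<lambda>\<omega>. (A \<bullet> (B t \<omega> - B s \<omega>)) ^ (2 * k))"
    "expectation (\<lambda>\<omega>. (A \<bullet> (B t \<omega> - B s \<omega>)) ^ (2 * k)) = v ^ k * (fact (2 * k) / (2 ^ k * fact k))"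
    "expectation (\<lambda>\<omega>. A \<bullet> (B t \<omega> - B s \<omega>)) = 0"
proof -
  have [measurable]: "B t \<in> borel_measurable M" "B s \<in> borel_measurable M" using st by auto
  have m: "(\<lambda>\<omega>. A \<bullet> (B t \<omega> - B s \<omega>)) \<in> borel_measurable M" by measurable
  show "integrable M (\<lambda>\<omega>. (A \<bullet> (B t \<omega> - B s \<omega>)) ^ (2 * k))"
    using centred_normal_even_moment(1)[OF st(3), of k] unfolding d[symmetric] by (subst (asm) integrable_distr_eq[OF m]) auto
  show "expectation (\<lambda>\<omega>. (A \<bullet> (B t \<omega> - B s \<omega>)) ^ (2 * k)) = v ^ k * (fact (2 * k) / (2 ^ k * fact k))"
    using centred_normal_even_moment(2)[OF st(3), of k] unfolding d[symmetric] by (subst (asm) integral_distr[OF m]) auto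
  show "expectation (\<lambda>\<omega>. A \<bullet> (B t \<omega> - B s \<omega>)) = 0"
    using centred_normal_mean[OF st(3)] unfolding d[symmetric] by (subst (asm) integral_distr[OF m]) auto
qed

lemma cov_nonneg: "cov A A \<ge> 0"
  unfolding cov_def by (rule integral_nonneg_AE) auto

lemma increment_distr:
  assumes st: "0 \<le> s" "s \<le> t"
  shows "distr M borel (\<lambda>\<omega>. A \<bullet> (B t \<omega> - B s \<omega>)) = centred_normal ((t - s) * cov A A)"
proof -
  obtain q where q: "\<And>A. q A \<ge> 0"
    "\<And>A s t. 0 \<le> s \<Longrightarrow> s \<le> t \<Longrightarrow> distr M borel (\<lambda>\<omega>. A \<bullet> (B t \<omega> - B s \<omega>)) = centred_normal ((t - s) * q A)"
    using B_gaussian_increments by (metis (full_types))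
  have "cov A A = q A"
    using increment_even_moment'(2)[OF _ _ _ q(2)[of 0 1 A], of 1] q(1)[of A]
    by (simp add: cov_def power2_eq_square)
  with q st show ?thesis by auto
qed

lemma increment_even_moment:
  assumes st: "0 \<le> s" "s \<le> t"
  shows "integrable M (\<lambda>\<omega>. (A \<bullet> (B t \<omega> - B s \<omega>)) ^ (2 * k))"
    "expectation (\<lambda>\<omega>. (A \<bullet> (B t \<omega> - B s \<omega>)) ^ (2 * k)) = (t - s) ^ k * (cov A A ^ k * (fact (2 * k) / (2 ^ k * fact k)))"
    "expectation (\<lambda>\<omega>. A \<bullet> (B t \<omega> - B s \<omega>)) = 0"
  using increment_even_moment'[OF st _ increment_distr[OF st, of A]] cov_nonneg[of A] st
  by (auto simp: power_mult_distrib)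

text \<open>Each entry is the inner product with a matrix unit, hence a one-dimensional Gaussian;
  \<open>power_sum4_le\<close> passes from the norm to the four entries.\<close>

lemma increment_norm_moment:
  assumes st: "0 \<le> s" "s \<le> t"
  shows "integrable M (\<lambda>\<omega>. norm (B t \<omega> - B s \<omega>) ^ (2 * k))"
    "expectation (\<lambda>\<omega>. norm (B t \<omega> - B s \<omega>) ^ (2 * k)) \<le> (t - s) ^ k *
      (4 ^ k * (fact (2 * k) / (2 ^ k * fact k)) * (\<Sum>i\<in>UNIV. \<Sum>j\<in>UNIV. cov (axis i (axis j 1)) (axis i (axis j 1)) ^ k))"
proof -
  have [measurable]: "B t \<in> borel_measurable M" "B s \<in> borel_measurable M" using st by auto
  let ?E = "\<lambda>i j. axis i (axis j 1) :: real^2^2"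
  have c: "?E i j \<bullet> A = A $ i $ j" for i j and A :: "real^2^2" by (simp add: inner_axis')
  have i: "integrable M (\<lambda>\<omega>. 4 ^ k * (\<Sum>i\<in>UNIV. \<Sum>j\<in>UNIV. (?E i j \<bullet> (B t \<omega> - B s \<omega>)) ^ (2 * k)))"
    using increment_even_moment(1)[OF st] by (intro integrable_mult_right integrable_sum) auto
  have le: "norm (norm (B t \<omega> - B s \<omega>) ^ (2 * k)) \<le> 4 ^ k * (\<Sum>i\<in>UNIV. \<Sum>j\<in>UNIV. (?E i j \<bullet> (B t \<omega> - B s \<omega>)) ^ (2 * k))" for \<omega>
    unfolding c norm_power power_mult norm_sq_22 sum_2
    by (subst real_norm_def, subst abs_of_nonneg, simp, rule order_trans[OF power_sum4_le]) (auto simp: algebra_simps)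
  show 1: "integrable M (\<lambda>\<omega>. norm (B t \<omega> - B s \<omega>) ^ (2 * k))"
    by (rule integrable_dominated[OF i]) (auto intro!: AE_I2 order_trans[OF le abs_ge_self, simplified])
  have "expectation (\<lambda>\<omega>. norm (B t \<omega> - B s \<omega>) ^ (2 * k)) \<le>
      expectation (\<lambda>\<omega>. 4 ^ k * (\<Sum>i\<in>UNIV. \<Sum>j\<in>UNIV. (?E i j \<bullet> (B t \<omega> - B s \<omega>)) ^ (2 * k)))"
    by (intro integral_mono 1 i) (use le in auto)
  also have "\<dots> = 4 ^ k * (\<Sum>i\<in>UNIV. \<Sum>j\<in>UNIV. (t - s) ^ k * (cov (?E i j) (?E i j) ^ k * (fact (2 * k) / (2 ^ k * fact k))))"
    using increment_even_moment[OF st] by (simp add: Bochner_Integration.integral_sum Bochner_Integration.integrable_sum)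
  finally show "expectation (\<lambda>\<omega>. norm (B t \<omega> - B s \<omega>) ^ (2 * k)) \<le> (t - s) ^ k *
      (4 ^ k * (fact (2 * k) / (2 ^ k * fact k)) * (\<Sum>i\<in>UNIV. \<Sum>j\<in>UNIV. cov (?E i j) (?E i j) ^ k))"
    by (simp add: sum_2 algebra_simps)
qed

definition K_moment :: "nat \<Rightarrow> real" where
  "K_moment k = 4 ^ k * (fact (2 * k) / (2 ^ k * fact k)) *
     (\<Sum>i\<in>UNIV. \<Sum>j\<in>UNIV. cov (axis i (axis j 1)) (axis i (axis j 1)) ^ k)"

lemma K_moment_nonneg: "K_moment k \<ge> 0"
  unfolding K_moment_def by (intro mult_nonneg_nonneg sum_nonneg zero_le_power cov_nonneg) auto

text \<open>One constant for all moments that occur: the second in Ito sums, the fourth for the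
  squared increment, the fourth and sixth in the Taylor remainder. The summand 1 keeps it
  positive.\<close>

definition K :: real where
  "K = 1 + K_moment 1 + K_moment 2 + K_moment 3"

lemma K_ge_1: "K \<ge> 1"
  unfolding K_def using K_moment_nonneg[of 1] K_moment_nonneg[of 2] K_moment_nonneg[of 3] by linarith

lemma increment_norm_moment_le:
  assumes st: "0 \<le> s" "s \<le> t" and k: "k \<in> {1,2,3}"
  shows "expectation (\<lambda>\<omega>. norm (B t \<omega> - B s \<omega>) ^ (2 * k)) \<le> K * (t - s) ^ k"
proof -
  have "K_moment k \<le> K"
    unfolding K_def using k K_moment_nonneg[of 1] K_moment_nonneg[of 2] K_moment_nonneg[of 3] by auto
  then have "(t - s) ^ k * K_moment k \<le> (t - s) ^ k * K" using st by (intro mult_left_mono) auto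
  with increment_norm_moment(2)[OF st, of k] show ?thesis by (simp add: mult.commute K_moment_def)
qed

end

lemma sum_lessThan_add: "(\<Sum>i<n + m. f i) = (\<Sum>i<n. f i) + (\<Sum>i<m. f (n + i :: nat))"
  for f :: "nat \<Rightarrow> 'a::comm_monoid_add"
  by (induction m) (simp_all add: add.assoc)

text \<open>In \<open>ito_sum\<close> this collects everything known at the left endpoint on one
  side of the inner product, so that \<open>inner_increment\<close> applies.\<close>

lemma transpose_mult_inner: "(S::real^2^2) \<bullet> ((G::real^2^2) ** (A::real^2^2)) = (transpose G ** S) \<bullet> A"
  by (simp add: inner_22 matrix_mult_22 transpose_def algebra_simps)

lemma abs_nth_22_le: "\<bar>(A::real^2^2) $ i $ j\<bar> \<le> norm A"
  using component_le_norm_cart[of "A $ i" j] Finite_Cartesian_Product.norm_nth_le[of A i] by linarith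

lemma borel_measurable_transpose_22 [measurable (raw)]:
  assumes [measurable]: "f \<in> borel_measurable M"
  shows "(\<lambda>x. transpose (f x :: real^2^2)) \<in> borel_measurable M"
proof -
  have "continuous_on UNIV (\<lambda>p::real^2^2. transpose p)"
    unfolding transpose_def by (intro continuous_intros)
  then have "(\<lambda>p::real^2^2. transpose p) \<in> borel_measurable borel"
    by (rule borel_measurable_continuous_onI)
  from measurable_compose[OF assms this] show ?thesis by simp
qed

lemma norm_transpose_22: "norm (transpose (A::real^2^2)) = norm A"
  by (rule power2_eq_imp_eq) (simp_all only: norm_sq_22, simp_all add: transpose_def)

lemma (in prob_space) integrable_of_square:
  fixes X :: "'a \<Rightarrow> 'b::{banach,second_countable_topology}"
  assumes [measurable]: "X \<in> borel_measurable M" and "integrable M (\<lambda>\<omega>. (norm (X \<omega>))\<^sup>2)"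
  shows "integrable M X"
proof (rule integrable_dominated[of M "\<lambda>\<omega>. 1 + (norm (X \<omega>))\<^sup>2"])
  have "norm (X \<omega>) \<le> 1 + (norm (X \<omega>))\<^sup>2" for \<omega>
    using sum_squares_bound[of 1 "norm (X \<omega>)"] norm_ge_zero[of "X \<omega>"]
    unfolding power_one by linarith
  then show "AE \<omega> in M. norm (X \<omega>) \<le> norm (1 + (norm (X \<omega>))\<^sup>2)" by (auto intro!: AE_I2 order_trans[OF _ abs_ge_self])
qed (use assms in auto)

lemma (in prob_space) integrable_prod_of_squares:
  fixes X :: "'a \<Rightarrow> 'b::{banach,second_countable_topology}" and Y :: "'a \<Rightarrow> 'c::{banach,second_countable_topology}"
    and Z :: "'a \<Rightarrow> 'd::{banach,second_countable_topology}"
  assumes [measurable]: "Z \<in> borel_measurable M"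
    and "integrable M (\<lambda>\<omega>. (norm (X \<omega>))\<^sup>2)" "integrable M (\<lambda>\<omega>. (norm (Y \<omega>))\<^sup>2)"
    and le: "\<And>\<omega>. norm (Z \<omega>) \<le> C * (norm (X \<omega>) * norm (Y \<omega>))" and C: "C \<ge> 0"
  shows "integrable M Z"
proof (rule integrable_dominated[of M "\<lambda>\<omega>. C * ((norm (X \<omega>))\<^sup>2 + (norm (Y \<omega>))\<^sup>2)"])
  show "AE \<omega> in M. norm (Z \<omega>) \<le> norm (C * ((norm (X \<omega>))\<^sup>2 + (norm (Y \<omega>))\<^sup>2))"
  proof (intro AE_I2 order_trans[OF le])
    fix \<omega>
    have "norm (X \<omega>) * norm (Y \<omega>) \<le> (norm (X \<omega>))\<^sup>2 + (norm (Y \<omega>))\<^sup>2"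
      using sum_squares_bound[of "norm (X \<omega>)" "norm (Y \<omega>)"] mult_nonneg_nonneg[OF norm_ge_zero norm_ge_zero, of "X \<omega>" "Y \<omega>"]
      unfolding mult.assoc by linarith
    then show "C * (norm (X \<omega>) * norm (Y \<omega>)) \<le> norm (C * ((norm (X \<omega>))\<^sup>2 + (norm (Y \<omega>))\<^sup>2))"
      using C by (simp add: mult_left_mono)
  qed
qed (use assms in auto)

lemma (in prob_space) integrable_square_add:
  fixes X Y :: "'a \<Rightarrow> 'b::{banach,second_countable_topology}"
  assumes [measurable]: "X \<in> borel_measurable M" "Y \<in> borel_measurable M"
    and "integrable M (\<lambda>\<omega>. (norm (X \<omega>))\<^sup>2)" "integrable M (\<lambda>\<omega>. (norm (Y \<omega>))\<^sup>2)"
  shows "integrable M (\<lambda>\<omega>. (norm (X \<omega> + Y \<omega>))\<^sup>2)" "integrable M (\<lambda>\<omega>. (norm (X \<omega> - Y \<omega>))\<^sup>2)"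
proof -
  have bd: "(norm (a + b))\<^sup>2 \<le> 2 * (norm a)\<^sup>2 + 2 * (norm b)\<^sup>2" "(norm (a - b))\<^sup>2 \<le> 2 * (norm a)\<^sup>2 + 2 * (norm b)\<^sup>2" for a b :: 'b
  proof -
    have *: "(norm a + norm b)\<^sup>2 \<le> 2 * (norm a)\<^sup>2 + 2 * (norm b)\<^sup>2"
      using sum_squares_bound[of "norm a" "norm b"] by (simp add: power2_sum)
    show "(norm (a + b))\<^sup>2 \<le> 2 * (norm a)\<^sup>2 + 2 * (norm b)\<^sup>2"
      by (rule order_trans[OF power_mono[OF norm_triangle_ineq] *]) simp
    show "(norm (a - b))\<^sup>2 \<le> 2 * (norm a)\<^sup>2 + 2 * (norm b)\<^sup>2"
      by (rule order_trans[OF power_mono[OF norm_triangle_ineq4] *]) simp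
  qed
  have i: "integrable M (\<lambda>\<omega>. 2 * (norm (X \<omega>))\<^sup>2 + 2 * (norm (Y \<omega>))\<^sup>2)" using assms by auto
  show "integrable M (\<lambda>\<omega>. (norm (X \<omega> + Y \<omega>))\<^sup>2)" "integrable M (\<lambda>\<omega>. (norm (X \<omega> - Y \<omega>))\<^sup>2)"
    by (rule integrable_dominated[OF i]; use bd in \<open>auto intro!: AE_I2\<close>)+
qed

section \<open>Second moments of Ito sums\<close>

context brownian_motion_sl2
begin

lemma norm_increment_integrable:
  assumes "0 \<le> s" "s \<le> t"
  shows "integrable M (\<lambda>\<omega>. (norm (B t \<omega> - B s \<omega>))\<^sup>2)"
  using increment_norm_moment(1)[OF assms, of 1] by simp

lemma mult_increment:
  fixes G :: "'a \<Rightarrow> real^2^2"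
  assumes st: "0 \<le> s" "s \<le> t" and G: "G \<in> borel_measurable (FF s)" "integrable M (\<lambda>\<omega>. (norm (G \<omega>))\<^sup>2)"
  shows "integrable M (\<lambda>\<omega>. (norm (G \<omega> ** (B t \<omega> - B s \<omega>)))\<^sup>2)"
    "expectation (\<lambda>\<omega>. (norm (G \<omega> ** (B t \<omega> - B s \<omega>)))\<^sup>2) \<le> K * (t - s) * expectation (\<lambda>\<omega>. (norm (G \<omega>))\<^sup>2)"
proof -
  have [measurable]: "B t \<in> borel_measurable M" "B s \<in> borel_measurable M" using st by auto
  have GM [measurable]: "G \<in> borel_measurable M" using FF_M_measurable[OF st(1) G(1)] .
  have [measurable]: "(\<lambda>\<omega>. (norm (G \<omega>))\<^sup>2) \<in> borel_measurable (FF s)" using G(1) by measurable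
  note ind = indep_increment[OF st, of "\<lambda>\<omega>. (norm (G \<omega>))\<^sup>2" "\<lambda>A. (norm A)\<^sup>2", OF _ G(2) _ norm_increment_integrable[OF st]]
  have i: "integrable M (\<lambda>\<omega>. (norm (G \<omega>))\<^sup>2 * (norm (B t \<omega> - B s \<omega>))\<^sup>2)"
    using ind(1) by simp
  have e: "expectation (\<lambda>\<omega>. (norm (G \<omega>))\<^sup>2 * (norm (B t \<omega> - B s \<omega>))\<^sup>2) =
      expectation (\<lambda>\<omega>. (norm (G \<omega>))\<^sup>2) * expectation (\<lambda>\<omega>. (norm (B t \<omega> - B s \<omega>))\<^sup>2)"
    using ind(2) by simp
  have le: "(norm (G \<omega> ** (B t \<omega> - B s \<omega>)))\<^sup>2 \<le> (norm (G \<omega>))\<^sup>2 * (norm (B t \<omega> - B s \<omega>))\<^sup>2" for \<omega>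
    using power_mono[OF norm_matrix_mult_22[of "G \<omega>" "B t \<omega> - B s \<omega>"], of 2] by (simp add: power_mult_distrib)
  show *: "integrable M (\<lambda>\<omega>. (norm (G \<omega> ** (B t \<omega> - B s \<omega>)))\<^sup>2)"
    by (rule integrable_dominated[OF i]) (use le in auto)
  have "expectation (\<lambda>\<omega>. (norm (G \<omega> ** (B t \<omega> - B s \<omega>)))\<^sup>2) \<le>
      expectation (\<lambda>\<omega>. (norm (G \<omega>))\<^sup>2 * (norm (B t \<omega> - B s \<omega>))\<^sup>2)"
    by (rule integral_mono[OF * i le])
  also have "\<dots> \<le> expectation (\<lambda>\<omega>. (norm (G \<omega>))\<^sup>2) * (K * (t - s))"
    unfolding e using increment_norm_moment_le[OF st, of 1] by (intro mult_left_mono) auto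
  finally show "expectation (\<lambda>\<omega>. (norm (G \<omega> ** (B t \<omega> - B s \<omega>)))\<^sup>2) \<le> K * (t - s) * expectation (\<lambda>\<omega>. (norm (G \<omega>))\<^sup>2)"
    by (simp add: mult.commute)
qed

lemma increment_nth_integrable:
  assumes "0 \<le> s" "s \<le> t"
  shows "integrable M (\<lambda>\<omega>. (B t \<omega> - B s \<omega>) $ i $ j)" "expectation (\<lambda>\<omega>. (B t \<omega> - B s \<omega>) $ i $ j) = 0"
proof -
  have [measurable]: "B t \<in> borel_measurable M" "B s \<in> borel_measurable M" using assms by auto
  have i: "integrable M (\<lambda>\<omega>. B t \<omega> - B s \<omega>)"
    by (rule integrable_of_square[OF _ norm_increment_integrable[OF assms]]) measurable
  show "integrable M (\<lambda>\<omega>. (B t \<omega> - B s \<omega>) $ i $ j)"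
    by (rule integrable_dominated[OF i])
      (auto intro!: AE_I2 abs_nth_22_le simp del: vector_minus_component)
  show "expectation (\<lambda>\<omega>. (B t \<omega> - B s \<omega>) $ i $ j) = 0"
    using increment_even_moment(3)[OF assms, of "axis i (axis j 1)"] by (simp add: inner_axis')
qed

lemma indep_increment_nth:
  fixes g :: "'a \<Rightarrow> 'c::{real_normed_field,banach,second_countable_topology}"
  assumes st: "0 \<le> s" "s \<le> t" and g: "g \<in> borel_measurable (FF s)" "integrable M g"
  shows "integrable M (\<lambda>\<omega>. g \<omega> * of_real ((B t \<omega> - B s \<omega>) $ i $ j))"
    "expectation (\<lambda>\<omega>. g \<omega> * of_real ((B t \<omega> - B s \<omega>) $ i $ j)) = 0"
  using indep_increment[OF st g, of "\<lambda>A. A $ i $ j"] increment_nth_integrable[OF st, of i j]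
  by (simp_all del: vector_minus_component)

lemma inner_increment:
  fixes H :: "'a \<Rightarrow> real^2^2"
  assumes st: "0 \<le> s" "s \<le> t" and H: "H \<in> borel_measurable (FF s)" "integrable M H"
  shows "integrable M (\<lambda>\<omega>. H \<omega> \<bullet> (B t \<omega> - B s \<omega>))" "expectation (\<lambda>\<omega>. H \<omega> \<bullet> (B t \<omega> - B s \<omega>)) = 0"
proof -
  have [measurable]: "(\<lambda>\<omega>. H \<omega> $ i $ j) \<in> borel_measurable (FF s)" for i j using H(1) by measurable
  have "integrable M (\<lambda>\<omega>. H \<omega> $ i $ j)" for i j
    by (rule integrable_dominated[OF H(2)])
      (use FF_M_measurable[OF st(1) H(1)] in \<open>auto intro!: AE_I2 abs_nth_22_le\<close>)
  then have "integrable M (\<lambda>\<omega>. H \<omega> $ i $ j * (B t \<omega> - B s \<omega>) $ i $ j)"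
    "expectation (\<lambda>\<omega>. H \<omega> $ i $ j * (B t \<omega> - B s \<omega>) $ i $ j) = 0" for i j
    using indep_increment_nth[OF st, of "\<lambda>\<omega>. H \<omega> $ i $ j" i j] by simp_all
  then show "integrable M (\<lambda>\<omega>. H \<omega> \<bullet> (B t \<omega> - B s \<omega>))" "expectation (\<lambda>\<omega>. H \<omega> \<bullet> (B t \<omega> - B s \<omega>)) = 0"
    unfolding inner_22 by (simp_all del: vector_minus_component)
qed

text \<open>The upper half of the Ito isometry, up to the factor \<open>K\<close>. When a summand is
  added, the mixed term of the square is the inner product of the new increment with
  \<open>H\<close>, which is known at its left endpoint, and has mean zero.\<close>

lemma ito_sum:
  fixes G :: "nat \<Rightarrow> 'a \<Rightarrow> real^2^2"
  assumes u: "0 \<le> u 0" "\<And>i. u i \<le> u (Suc i)"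
    and G: "\<And>i. G i \<in> borel_measurable (FF (u i))" "\<And>i. integrable M (\<lambda>\<omega>. (norm (G i \<omega>))\<^sup>2)"
  defines "S \<equiv> \<lambda>n \<omega>. \<Sum>i<n. G i \<omega> ** (B (u (Suc i)) \<omega> - B (u i) \<omega>)"
  shows "S n \<in> borel_measurable (FF (u n))" "integrable M (\<lambda>\<omega>. (norm (S n \<omega>))\<^sup>2)"
    "expectation (\<lambda>\<omega>. (norm (S n \<omega>))\<^sup>2) \<le> (\<Sum>i<n. K * (u (Suc i) - u i) * expectation (\<lambda>\<omega>. (norm (G i \<omega>))\<^sup>2))"
proof -
  have u0: "0 \<le> u i" for i by (induction i) (use u order_trans in auto)
  have "S n \<in> borel_measurable (FF (u n)) \<and> integrable M (\<lambda>\<omega>. (norm (S n \<omega>))\<^sup>2) \<and>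
    expectation (\<lambda>\<omega>. (norm (S n \<omega>))\<^sup>2) \<le> (\<Sum>i<n. K * (u (Suc i) - u i) * expectation (\<lambda>\<omega>. (norm (G i \<omega>))\<^sup>2))"
  proof (induction n)
    case 0
    show ?case by (simp add: S_def)
  next
    case (Suc n)
    define T where "T = (\<lambda>\<omega>. G n \<omega> ** (B (u (Suc n)) \<omega> - B (u n) \<omega>))"
    have S: "S (Suc n) = (\<lambda>\<omega>. S n \<omega> + T \<omega>)" by (simp add: S_def T_def fun_eq_iff)
    have meas: "S n \<in> borel_measurable (FF (u (Suc n)))" "G n \<in> borel_measurable (FF (u (Suc n)))"
      "B (u (Suc n)) \<in> borel_measurable (FF (u (Suc n)))" "B (u n) \<in> borel_measurable (FF (u (Suc n)))"
      using Suc.IH G(1) B_adapted u0 FF_mono_measurable[OF u(2)] by blast+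
    have mT: "T \<in> borel_measurable (FF (u (Suc n)))"
      unfolding T_def using meas(2-4) by measurable
    have mS': "S (Suc n) \<in> borel_measurable (FF (u (Suc n)))"
      unfolding S using meas(1) mT by measurable
    note [measurable] = FF_M_measurable[OF u0 meas(1)] FF_M_measurable[OF u0 mT]
    have T2: "integrable M (\<lambda>\<omega>. (norm (T \<omega>))\<^sup>2)"
      "expectation (\<lambda>\<omega>. (norm (T \<omega>))\<^sup>2) \<le> K * (u (Suc n) - u n) * expectation (\<lambda>\<omega>. (norm (G n \<omega>))\<^sup>2)"
      unfolding T_def by (rule mult_increment[OF u0 u(2) G(1) G(2)])+
    have S2: "integrable M (\<lambda>\<omega>. (norm (S n \<omega>))\<^sup>2)" using Suc.IH by blast
    define H where "H = (\<lambda>\<omega>. transpose (G n \<omega>) ** S n \<omega>)"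
    have mH: "H \<in> borel_measurable (FF (u n))"
      unfolding H_def
      by (rule borel_measurable_matrix_mult_22[OF borel_measurable_transpose_22[OF G(1)] conjunct1[OF Suc.IH]])
    have iH: "integrable M H"
      by (rule integrable_prod_of_squares[OF FF_M_measurable[OF u0 mH] G(2)[of n] S2, of 1])
        (simp_all add: H_def order_trans[OF norm_matrix_mult_22] norm_transpose_22)
    have ST: "S n \<omega> \<bullet> T \<omega> = H \<omega> \<bullet> (B (u (Suc n)) \<omega> - B (u n) \<omega>)" for \<omega>
      unfolding T_def H_def by (rule transpose_mult_inner)
    have iST: "integrable M (\<lambda>\<omega>. S n \<omega> \<bullet> T \<omega>)" "expectation (\<lambda>\<omega>. S n \<omega> \<bullet> T \<omega>) = 0"
      unfolding ST using inner_increment[OF u0 u(2) mH iH] by auto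
    have sq: "(norm (S (Suc n) \<omega>))\<^sup>2 = (norm (S n \<omega>))\<^sup>2 + 2 * (S n \<omega> \<bullet> T \<omega>) + (norm (T \<omega>))\<^sup>2" for \<omega>
      unfolding S power2_norm_eq_inner by (simp add: inner_add_left inner_add_right inner_commute)
    have "integrable M (\<lambda>\<omega>. (norm (S (Suc n) \<omega>))\<^sup>2)"
      unfolding sq using S2 iST T2 by auto
    moreover have "expectation (\<lambda>\<omega>. (norm (S (Suc n) \<omega>))\<^sup>2) \<le>
        (\<Sum>i<Suc n. K * (u (Suc i) - u i) * expectation (\<lambda>\<omega>. (norm (G i \<omega>))\<^sup>2))"
      unfolding sq using S2 iST T2 Suc.IH by simp
    ultimately show ?case using mS' by blast
  qed
  then show "S n \<in> borel_measurable (FF (u n))" "integrable M (\<lambda>\<omega>. (norm (S n \<omega>))\<^sup>2)"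
    "expectation (\<lambda>\<omega>. (norm (S n \<omega>))\<^sup>2) \<le> (\<Sum>i<n. K * (u (Suc i) - u i) * expectation (\<lambda>\<omega>. (norm (G i \<omega>))\<^sup>2))"
    by auto
qed

end

subsection \<open>Euler steps and their remainders\<close>

lemma has_bochner_integral_nth_22:
  assumes "has_bochner_integral M f (x::real^2^2)"
  shows "has_bochner_integral M (\<lambda>\<omega>. f \<omega> $ i $ j) (x $ i $ j)"
proof -
  have "bounded_linear (\<lambda>A::real^2^2. A $ i $ j)"
    using bounded_linear_compose[OF bounded_linear_vec_nth bounded_linear_vec_nth] .
  from has_bochner_integral_bounded_linear[OF this assms] show ?thesis .
qed

text \<open>The equidistant points continue beyond \<open>t\<close> for indices above
  \<open>n\<close>, so monotonicity holds for every index, as \<open>ito_sum\<close> demands. For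
  \<open>n = 0\<close> division by zero makes the mesh constant.\<close>

definition mesh :: "real \<Rightarrow> real \<Rightarrow> nat \<Rightarrow> nat \<Rightarrow> real" where
  "mesh s t n i = s + real i * ((t - s) / real n)"

lemma mesh_0 [simp]: "mesh s t n 0 = s" by (simp add: mesh_def)

lemma mesh_n: "n \<ge> 1 \<Longrightarrow> mesh s t n n = t" by (simp add: mesh_def)

lemma mesh_Suc: "mesh s t n (Suc i) - mesh s t n i = (t - s) / real n"
  by (simp add: mesh_def algebra_simps add_divide_distrib[symmetric])

lemma mesh_mono: "s \<le> t \<Longrightarrow> mesh s t n i \<le> mesh s t n (Suc i)"
  using mesh_Suc[of s t n i] by (smt (verit) divide_nonneg_nonneg of_nat_0_le_iff)

lemma mesh_ge: "s \<le> t \<Longrightarrow> s \<le> mesh s t n i"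
  by (simp add: mesh_def)

lemma mesh_le: "s \<le> t \<Longrightarrow> i \<le> n \<Longrightarrow> mesh s t n i \<le> t"
proof (cases "n = 0")
  case False
  assume "s \<le> t" "i \<le> n"
  then have "real i * ((t - s) / real n) \<le> real n * ((t - s) / real n)" by (intro mult_right_mono) auto
  with False show ?thesis by (simp add: mesh_def)
qed (simp add: mesh_def)

context geometric_brownian_motion_SL2
begin

lemma F_measurable [measurable]: "t \<ge> 0 \<Longrightarrow> F t \<in> borel_measurable M"
  using F_adapted FF_M_measurable by blast

text \<open>The squared length of a row is a diagonal entry of \<open>F ** transpose F\<close>,
  whose mean is prescribed.\<close>

lemma F_row_moment:
  assumes "t \<ge> 0"
  shows "integrable M (\<lambda>\<omega>. (norm (F t \<omega> $ i))\<^sup>2)" "expectation (\<lambda>\<omega>. (norm (F t \<omega> $ i))\<^sup>2) = exp t"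
proof -
  have eq: "(norm (F t \<omega> $ i))\<^sup>2 = (F t \<omega> ** transpose (F t \<omega>)) $ i $ i" for \<omega>
    unfolding norm_sq_2 by (simp add: matrix_mult_22 transpose_def power2_eq_square)
  have "has_bochner_integral M (\<lambda>\<omega>. (norm (F t \<omega> $ i))\<^sup>2) ((exp t *\<^sub>R mat 1 :: real^2^2) $ i $ i)"
    unfolding eq by (intro has_bochner_integral_nth_22 F_second_moment assms)
  then show "integrable M (\<lambda>\<omega>. (norm (F t \<omega> $ i))\<^sup>2)" "expectation (\<lambda>\<omega>. (norm (F t \<omega> $ i))\<^sup>2) = exp t"
    by (auto simp: has_bochner_integral_iff mat_def)
qed

lemma F_norm_moment:
  assumes "t \<ge> 0"
  shows "integrable M (\<lambda>\<omega>. (norm (F t \<omega>))\<^sup>2)" "expectation (\<lambda>\<omega>. (norm (F t \<omega>))\<^sup>2) = 2 * exp t"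
proof -
  have eq: "(norm (F t \<omega>))\<^sup>2 = (norm (F t \<omega> $ 1))\<^sup>2 + (norm (F t \<omega> $ 2))\<^sup>2" for \<omega>
    unfolding norm_sq_22 norm_sq_2 by simp
  show "integrable M (\<lambda>\<omega>. (norm (F t \<omega>))\<^sup>2)" "expectation (\<lambda>\<omega>. (norm (F t \<omega>))\<^sup>2) = 2 * exp t"
    unfolding eq using F_row_moment[OF assms] by simp_all
qed

lemma F_ito: "t \<ge> 0 \<Longrightarrow> has_ito_integral M F B t (\<lambda>\<omega>. F t \<omega> - F 0 \<omega>)"
  using F_stratonovich F_ito_eq_stratonovich by blast

definition ito_mesh :: "real \<Rightarrow> real \<Rightarrow> nat \<Rightarrow> 'a \<Rightarrow> real^2^2" where
  "ito_mesh s t n \<omega> = (\<Sum>i<n. F (mesh s t n i) \<omega> ** (B (mesh s t n (Suc i)) \<omega> - B (mesh s t n i) \<omega>))"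

text \<open>The integrals are given over intervals that start at 0. The one over
  \<open>[s, t]\<close> is a difference of two of them, and its sums are differences of sums along a
  partition of \<open>[0, t]\<close> that passes through \<open>s\<close>.\<close>

lemma ito_increment_limit:
  assumes st: "0 \<le> s" "s \<le> t" and e: "\<epsilon> > 0" "\<eta> > 0"
  obtains N where "N \<ge> 1" "\<And>n. n \<ge> N \<Longrightarrow> prob {\<omega>\<in>space M.
      norm (ito_mesh s t n \<omega> - (F t \<omega> - F s \<omega>)) > \<epsilon>} < \<eta>"
proof -
  define S where "S = (\<lambda>n p \<omega>. \<Sum>i<n. F (p i) \<omega> ** (B (p (Suc i)) \<omega> - B (p i) \<omega>))"
  have lim: "\<exists>\<delta>>0. \<forall>n p. fine_partition \<delta> u n p \<longrightarrow>
        measure M {\<omega> \<in> space M. norm (S n p \<omega> - (F u \<omega> - F 0 \<omega>)) > \<epsilon> / 2} < \<eta> / 2" if "u \<ge> 0" for u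
    using F_ito[OF that] e unfolding has_ito_integral_def partition_limit_in_prob_def S_def
    by (meson half_gt_zero)
  obtain d1 where d1: "d1 > 0" "\<And>n p. fine_partition d1 s n p \<Longrightarrow>
      measure M {\<omega> \<in> space M. norm (S n p \<omega> - (F s \<omega> - F 0 \<omega>)) > \<epsilon> / 2} < \<eta> / 2" using lim[OF st(1)] by blast
  obtain d2 where d2: "d2 > 0" "\<And>n p. fine_partition d2 t n p \<Longrightarrow>
      measure M {\<omega> \<in> space M. norm (S n p \<omega> - (F t \<omega> - F 0 \<omega>)) > \<epsilon> / 2} < \<eta> / 2"
    using lim[of t] st by auto
  define d where "d = min d1 d2"
  have d: "d > 0" using d1 d2 by (simp add: d_def)
  obtain N0 :: nat where N0: "t / d < real N0" using reals_Archimedean2 by blast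
  define N where "N = max 1 N0"
  show thesis
  proof (rule that)
    show "N \<ge> 1" by (simp add: N_def)
    fix n assume n: "n \<ge> N"
    then have n1: "n \<ge> 1" "real n > t / d" using N0 by (auto simp: N_def)
    have fine: "a / real n < d" if "a \<le> t" for a
    proof -
      have "a < d * real n" using n1(2) d that by (simp add: field_simps)
      then show ?thesis using n1(1) by (simp add: field_simps)
    qed
    \<comment> \<open>The meshes of \<open>[0, s]\<close> and \<open>[s, t]\<close> are glued at
      index \<open>n\<close>, where both take the value \<open>s\<close>; ending at \<open>n\<close>
      or at \<open>n + n\<close> yields the two partitions.\<close>
    define p where "p = (\<lambda>i. if i \<le> n then mesh 0 s n i else mesh s t n (i - n))"
    have pl: "p i = mesh 0 s n i" if "i \<le> n" for i using that by (simp add: p_def)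
    have ph: "p (n + i) = mesh s t n i" for i
      using n1 by (cases "i = 0") (auto simp: p_def mesh_n)
    have ps: "p i \<le> p (Suc i) \<and> p (Suc i) - p i < d" for i
    proof (cases "i < n")
      case True
      then show ?thesis using mesh_mono[of 0 s n i] mesh_Suc[of 0 s n i] fine[of s] st by (simp add: pl)
    next
      case False
      then obtain k where k: "i = n + k" using le_Suc_ex by (metis not_less)
      have "p i = mesh s t n k" "p (Suc i) = mesh s t n (Suc k)" using ph[of k] ph[of "Suc k"] k by auto
      then show ?thesis using mesh_mono[of s t n k] mesh_Suc[of s t n k] fine[of "t - s"] st by simp
    qed
    have f1: "fine_partition d1 s n p"
      unfolding fine_partition_def using ps d_def n1 pl[of 0] pl[of n] by (simp add: mesh_n)
    have f2: "fine_partition d2 t (n + n) p"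
      unfolding fine_partition_def using ps d_def n1 pl[of 0] ph[of n] by (simp add: mesh_n)
    let ?D = "ito_mesh s t n"
    have split: "S (n + n) p \<omega> = S n p \<omega> + ?D \<omega>" for \<omega>
      unfolding S_def ito_mesh_def sum_lessThan_add ph using ph[of "Suc _"] by simp
    have p0: "p i \<ge> 0" for i by (induction i) (use ps pl[of 0] order_trans in \<open>auto\<close>)
    have [measurable]: "S k p \<in> borel_measurable M" for k unfolding S_def using p0 by measurable
    have [measurable]: "F t \<in> borel_measurable M" "F s \<in> borel_measurable M" "F 0 \<in> borel_measurable M" using st by auto
    let ?A1 = "{\<omega> \<in> space M. norm (S n p \<omega> - (F s \<omega> - F 0 \<omega>)) > \<epsilon> / 2}"
    let ?A2 = "{\<omega> \<in> space M. norm (S (n + n) p \<omega> - (F t \<omega> - F 0 \<omega>)) > \<epsilon> / 2}"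
    have "{\<omega>\<in>space M. norm (?D \<omega> - (F t \<omega> - F s \<omega>)) > \<epsilon>} \<subseteq> ?A1 \<union> ?A2"
    proof safe
      fix \<omega> assume *: "\<omega> \<in> space M" "\<epsilon> < norm (?D \<omega> - (F t \<omega> - F s \<omega>))" "\<not> \<epsilon> / 2 < norm (S (n + n) p \<omega> - (F t \<omega> - F 0 \<omega>))"
      have "?D \<omega> - (F t \<omega> - F s \<omega>) = (S (n + n) p \<omega> - (F t \<omega> - F 0 \<omega>)) - (S n p \<omega> - (F s \<omega> - F 0 \<omega>))"
        unfolding split by simp
      with * show "\<epsilon> / 2 < norm (S n p \<omega> - (F s \<omega> - F 0 \<omega>))"
        using norm_triangle_ineq4[of "S (n + n) p \<omega> - (F t \<omega> - F 0 \<omega>)" "S n p \<omega> - (F s \<omega> - F 0 \<omega>)"] by simp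
    qed
    then have "prob {\<omega>\<in>space M. norm (?D \<omega> - (F t \<omega> - F s \<omega>)) > \<epsilon>} \<le> prob (?A1 \<union> ?A2)"
      by (intro finite_measure_mono) measurable
    also have "\<dots> \<le> prob ?A1 + prob ?A2" by (rule measure_Un_le) measurable
    also have "\<dots> < \<eta>" using d1(2)[OF f1] d2(2)[OF f2] by simp
    finally show "prob {\<omega>\<in>space M. norm (?D \<omega> - (F t \<omega> - F s \<omega>)) > \<epsilon>} < \<eta>" .
  qed
qed

text \<open>The Ito sums of \<open>F - C\<close> bound the deviation of \<open>F t - F s\<close> from \<open>C (B t - B s)\<close>; the cases of
  interest are \<open>C = 0\<close> and \<open>C = F s\<close>.\<close>

lemma ito_increment_bound:
  assumes st: "0 \<le> s" "s \<le> t" and C: "C \<in> borel_measurable (FF s)" "integrable M (\<lambda>\<omega>. (norm (C \<omega>))\<^sup>2)"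
    and c: "\<And>u. s \<le> u \<Longrightarrow> u \<le> t \<Longrightarrow> expectation (\<lambda>\<omega>. (norm (F u \<omega> - C \<omega>))\<^sup>2) \<le> c"
  shows "integrable M (\<lambda>\<omega>. (norm (F t \<omega> - F s \<omega> - C \<omega> ** (B t \<omega> - B s \<omega>)))\<^sup>2)"
    "expectation (\<lambda>\<omega>. (norm (F t \<omega> - F s \<omega> - C \<omega> ** (B t \<omega> - B s \<omega>)))\<^sup>2) \<le> 2 * (K * (t - s) * c)"
proof -
  have [measurable]: "F t \<in> borel_measurable M" "F s \<in> borel_measurable M" "C \<in> borel_measurable M"
     "B t \<in> borel_measurable M" "B s \<in> borel_measurable M"
    using st FF_M_measurable[OF _ C(1)] by auto
  let ?u = "mesh s t"
  define G where "G = (\<lambda>n i \<omega>. F (?u n i) \<omega> - C \<omega>)"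
  have u: "0 \<le> ?u n 0" "?u n i \<le> ?u n (Suc i)" "0 \<le> ?u n i" "s \<le> ?u n i" for n i
    using st mesh_mono[of s t n i] mesh_ge[of s t n i] by auto
  have G: "G n i \<in> borel_measurable (FF (?u n i))" for n i
    unfolding G_def using F_adapted[OF u(3)[of n i]] FF_mono_measurable[OF u(4)[of n i] C(1)] by measurable
  have G2: "integrable M (\<lambda>\<omega>. (norm (G n i \<omega>))\<^sup>2)" for n i
    unfolding G_def using F_norm_moment(1)[OF u(3)[of n i]] F_measurable[OF u(3)[of n i]] C(2)
    by (intro integrable_square_add) auto
  define S where "S = (\<lambda>n \<omega>. \<Sum>i<n. G n i \<omega> ** (B (?u n (Suc i)) \<omega> - B (?u n i) \<omega>))"
  have sum: "S n \<in> borel_measurable (FF (?u n n))" "integrable M (\<lambda>\<omega>. (norm (S n \<omega>))\<^sup>2)"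
    "expectation (\<lambda>\<omega>. (norm (S n \<omega>))\<^sup>2) \<le> (\<Sum>i<n. K * (?u n (Suc i) - ?u n i) * expectation (\<lambda>\<omega>. (norm (G n i \<omega>))\<^sup>2))" for n
    using ito_sum[where u="?u n" and G="G n" and n=n, OF u(1) u(2) G G2] unfolding S_def by blast+
  have [measurable]: "S n \<in> borel_measurable M" for n
    using FF_M_measurable[OF u(3) sum(1)] .
  \<comment> \<open>The part of the sum with the fixed left factor \<open>C\<close> telescopes to
    \<open>C ** (B t - B s)\<close>.\<close>
  have S_eq: "S n \<omega> = ito_mesh s t n \<omega> - C \<omega> ** (B t \<omega> - B s \<omega>)"
    if "n \<ge> 1" for n \<omega>
  proof -
    have "(\<Sum>i<n. C \<omega> ** (B (?u n (Suc i)) \<omega> - B (?u n i) \<omega>)) = C \<omega> ** (B (?u n n) \<omega> - B (?u n 0) \<omega>)"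
      unfolding matrix_mult_diff by (rule sum_lessThan_telescope)
    then show ?thesis using that
      unfolding S_def G_def ito_mesh_def matrix_mult_diff(2) by (simp add: sum_subtractf mesh_n)
  qed
  have "integrable M (\<lambda>\<omega>. (norm (F t \<omega> - F s \<omega>))\<^sup>2)"
    using st F_norm_moment(1) by (intro integrable_square_add) auto
  then show 1: "integrable M (\<lambda>\<omega>. (norm (F t \<omega> - F s \<omega> - C \<omega> ** (B t \<omega> - B s \<omega>)))\<^sup>2)"
    by (intro integrable_square_add(2)[OF _ _ _ mult_increment(1)[OF st C]]) auto
  show "expectation (\<lambda>\<omega>. (norm (F t \<omega> - F s \<omega> - C \<omega> ** (B t \<omega> - B s \<omega>)))\<^sup>2) \<le> 2 * (K * (t - s) * c)"
  proof (rule second_moment_limit_in_prob[where Z=S, OF _ _ 1])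
    fix n :: nat assume n: "n \<ge> 1"
    have "expectation (\<lambda>\<omega>. (norm (S n \<omega>))\<^sup>2) \<le> (\<Sum>i<n. K * (?u n (Suc i) - ?u n i) * expectation (\<lambda>\<omega>. (norm (G n i \<omega>))\<^sup>2))"
      by (rule sum(3))
    also have "\<dots> \<le> (\<Sum>i<n. K * ((t - s) / n) * c)"
      unfolding mesh_Suc using K_ge_1 st u(4) mesh_le[OF st(2)]
      by (intro sum_mono mult_left_mono) (auto simp: G_def intro!: c)
    also have "\<dots> = K * (t - s) * c" using n by simp
    finally show "expectation (\<lambda>\<omega>. (norm (S n \<omega>))\<^sup>2) \<le> K * (t - s) * c" .
  next
    fix \<epsilon> \<eta> :: real assume e: "\<epsilon> > 0" "\<eta> > 0"
    obtain n where n: "n \<ge> 1" "prob {\<omega>\<in>space M.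
      norm (ito_mesh s t n \<omega> - (F t \<omega> - F s \<omega>)) > \<epsilon>} < \<eta>"
      using ito_increment_limit[OF st e] by blast
    then show "\<exists>n\<ge>1. prob {\<omega> \<in> space M. \<epsilon> < norm (S n \<omega> - (F t \<omega> - F s \<omega> - C \<omega> ** (B t \<omega> - B s \<omega>)))} < \<eta>"
      by (intro exI[of _ n]) (simp add: S_eq algebra_simps)
  qed (use sum(2) in auto)
qed

text \<open>The case \<open>C = 0\<close>: a first estimate of order \<open>t - s\<close>, which
  \<open>remainder_bound\<close> feeds back into the same lemma.\<close>

lemma F_increment_bound:
  assumes st: "0 \<le> s" "s \<le> t"
  shows "integrable M (\<lambda>\<omega>. (norm (F t \<omega> - F s \<omega>))\<^sup>2)"
    "expectation (\<lambda>\<omega>. (norm (F t \<omega> - F s \<omega>))\<^sup>2) \<le> 4 * K * exp t * (t - s)"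
proof -
  have "expectation (\<lambda>\<omega>. (norm (F u \<omega> - 0))\<^sup>2) \<le> 2 * exp t" if "s \<le> u" "u \<le> t" for u
    using F_norm_moment(2)[of u] that st by simp
  from ito_increment_bound[OF st _ _ this]
  show "integrable M (\<lambda>\<omega>. (norm (F t \<omega> - F s \<omega>))\<^sup>2)"
    "expectation (\<lambda>\<omega>. (norm (F t \<omega> - F s \<omega>))\<^sup>2) \<le> 4 * K * exp t * (t - s)"
    by (simp_all add: algebra_simps)
qed

definition remainder :: "real \<Rightarrow> real \<Rightarrow> 'a \<Rightarrow> real^2^2" where
  "remainder s t \<omega> = F t \<omega> - F s \<omega> - F s \<omega> ** (B t \<omega> - B s \<omega>)"

lemma remainder_measurable [measurable]: "0 \<le> s \<Longrightarrow> s \<le> t \<Longrightarrow> remainder s t \<in> borel_measurable M"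
  unfolding remainder_def by measurable

text \<open>The case \<open>C = F s\<close>. The integrand \<open>F u - F s\<close> already has
  second moment of order \<open>t - s\<close> by \<open>F_increment_bound\<close>, and integration
  gains a second factor \<open>t - s\<close>.\<close>

lemma remainder_bound:
  assumes st: "0 \<le> s" "s \<le> t"
  shows "integrable M (\<lambda>\<omega>. (norm (remainder s t \<omega>))\<^sup>2)"
    "expectation (\<lambda>\<omega>. (norm (remainder s t \<omega>))\<^sup>2) \<le> 8 * K\<^sup>2 * exp t * (t - s)\<^sup>2"
proof -
  have c: "expectation (\<lambda>\<omega>. (norm (F u \<omega> - F s \<omega>))\<^sup>2) \<le> 4 * K * exp t * (t - s)" if "s \<le> u" "u \<le> t" for u
  proof -
    have "4 * K * exp u * (u - s) \<le> 4 * K * exp t * (t - s)"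
      using K_ge_1 that st by (intro mult_mono) auto
    with F_increment_bound(2)[OF st(1) that(1)] show ?thesis by linarith
  qed
  from ito_increment_bound[OF st F_adapted[OF st(1)] F_norm_moment(1)[OF st(1)] c]
  show "integrable M (\<lambda>\<omega>. (norm (remainder s t \<omega>))\<^sup>2)"
    "expectation (\<lambda>\<omega>. (norm (remainder s t \<omega>))\<^sup>2) \<le> 8 * K\<^sup>2 * exp t * (t - s)\<^sup>2"
    unfolding remainder_def by (simp_all add: algebra_simps power2_eq_square)
qed

text \<open>Convergence in probability with a uniform second moment bound gives convergence in mean.
  This form lets vanishing expectations pass from Ito sums to \<open>F\<close>.\<close>

lemma ito_increment_L1_limit:
  assumes st: "0 \<le> s" "s \<le> t" and e: "e > 0"
  obtains n where "n \<ge> 1" "integrable M (\<lambda>\<omega>. ito_mesh s t n \<omega> - (F t \<omega> - F s \<omega>))"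
    "expectation (\<lambda>\<omega>. norm (ito_mesh s t n \<omega> - (F t \<omega> - F s \<omega>))) < e"
proof -
  let ?u = "mesh s t"
  \<comment> \<open>\<open>C\<close> bounds the second moment of the difference for every
    \<open>n\<close>; the final 1 keeps it positive when \<open>s = t\<close>. With
    \<open>c * C = e / 4\<close>, three contributions of at most \<open>e / 4\<close>
    remain.\<close>
  define C where "C = 2 * (K * (t - s) * (2 * exp t)) + 2 * (4 * K * exp t * (t - s)) + 1"
  have C: "C > 0" using K_ge_1 st by (simp add: C_def add_nonneg_pos)
  define c where "c = e / (4 * C)"
  have c: "c > 0" using C e by (simp add: c_def)
  have ce: "e / 4 > 0" "c * (e / 4) > 0" using e c by auto
  obtain n where n: "n \<ge> 1" "prob {\<omega>\<in>space M. norm (ito_mesh s t n \<omega> - (F t \<omega> - F s \<omega>)) > e / 4} < c * (e / 4)"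
    by (rule ito_increment_limit[OF st ce]) blast
  have u: "0 \<le> ?u n 0" "?u n i \<le> ?u n (Suc i)" "0 \<le> ?u n i" for i
    using st mesh_mono[of s t n i] mesh_ge[of s t n i] by auto
  have sum: "ito_mesh s t n \<in> borel_measurable (FF (?u n n))" "integrable M (\<lambda>\<omega>. (norm (ito_mesh s t n \<omega>))\<^sup>2)"
    "expectation (\<lambda>\<omega>. (norm (ito_mesh s t n \<omega>))\<^sup>2) \<le> (\<Sum>i<n. K * (?u n (Suc i) - ?u n i) * expectation (\<lambda>\<omega>. (norm (F (?u n i) \<omega>))\<^sup>2))"
    using ito_sum[where u="?u n" and G="\<lambda>i. F (?u n i)" and n=n, OF u(1) u(2) F_adapted[OF u(3)] F_norm_moment(1)[OF u(3)]]
    unfolding ito_mesh_def[abs_def] by blast+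
  have [measurable]: "ito_mesh s t n \<in> borel_measurable M" "F t \<in> borel_measurable M" "F s \<in> borel_measurable M"
    using FF_M_measurable[OF u(3) sum(1)] st by auto
  have "(\<Sum>i<n. K * (?u n (Suc i) - ?u n i) * expectation (\<lambda>\<omega>. (norm (F (?u n i) \<omega>))\<^sup>2)) \<le> (\<Sum>i<n. K * ((t - s) / n) * (2 * exp t))"
    unfolding mesh_Suc F_norm_moment(2)[OF u(3)] using K_ge_1 st mesh_le[OF st(2)]
    by (intro sum_mono mult_left_mono) auto
  also have "\<dots> = K * (t - s) * (2 * exp t)" using n by simp
  finally have S2: "expectation (\<lambda>\<omega>. (norm (ito_mesh s t n \<omega>))\<^sup>2) \<le> K * (t - s) * (2 * exp t)" using sum(3) by linarith
  define Z where "Z = (\<lambda>\<omega>. ito_mesh s t n \<omega> - (F t \<omega> - F s \<omega>))"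
  have [measurable]: "Z \<in> borel_measurable M" unfolding Z_def by measurable
  have Z2i: "integrable M (\<lambda>\<omega>. (norm (Z \<omega>))\<^sup>2)"
    unfolding Z_def by (intro integrable_square_add(2)[OF _ _ sum(2) F_increment_bound(1)[OF st]]) auto
  have "expectation (\<lambda>\<omega>. (norm (Z \<omega>))\<^sup>2) \<le> expectation (\<lambda>\<omega>. 2 * (norm (ito_mesh s t n \<omega>))\<^sup>2 + 2 * (norm (F t \<omega> - F s \<omega>))\<^sup>2)"
  proof (rule integral_mono[OF Z2i])
    fix \<omega>
    have "(norm (Z \<omega>))\<^sup>2 \<le> (norm (ito_mesh s t n \<omega>) + norm (F t \<omega> - F s \<omega>))\<^sup>2"
      unfolding Z_def by (intro power_mono norm_triangle_ineq4) auto
    also have "\<dots> \<le> 2 * (norm (ito_mesh s t n \<omega>))\<^sup>2 + 2 * (norm (F t \<omega> - F s \<omega>))\<^sup>2"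
      using sum_squares_bound[of "norm (ito_mesh s t n \<omega>)" "norm (F t \<omega> - F s \<omega>)"] by (simp add: power2_sum)
    finally show "(norm (Z \<omega>))\<^sup>2 \<le> 2 * (norm (ito_mesh s t n \<omega>))\<^sup>2 + 2 * (norm (F t \<omega> - F s \<omega>))\<^sup>2" .
  qed (use sum(2) F_increment_bound(1)[OF st] in auto)
  also have "\<dots> = 2 * expectation (\<lambda>\<omega>. (norm (ito_mesh s t n \<omega>))\<^sup>2) + 2 * expectation (\<lambda>\<omega>. (norm (F t \<omega> - F s \<omega>))\<^sup>2)"
    using sum(2) F_increment_bound(1)[OF st] by simp
  also have "\<dots> \<le> C"
    using F_increment_bound(2)[OF st] S2 unfolding C_def by linarith
  finally have Z2: "expectation (\<lambda>\<omega>. (norm (Z \<omega>))\<^sup>2) \<le> C" .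
  have "expectation (\<lambda>\<omega>. norm (Z \<omega>)) \<le> e / 4 + expectation (\<lambda>_. 0) + c * expectation (\<lambda>\<omega>. (norm (Z \<omega>))\<^sup>2)
           + prob {\<omega>\<in>space M. norm (Z \<omega>) > e / 4} / c"
    by (rule expectation_near) (use Z2i c e in auto)
  also have "\<dots> \<le> e / 4 + 0 + c * C + (c * (e / 4)) / c"
    using Z2 n c by (intro add_mono mult_left_mono divide_right_mono) (auto simp: Z_def)
  also have "\<dots> < e" using c C e by (simp add: c_def)
  finally have 1: "expectation (\<lambda>\<omega>. norm (Z \<omega>)) < e" .
  have 2: "integrable M Z" by (rule integrable_of_square[OF _ Z2i]) measurable
  show thesis
    by (rule that[OF n(1) 2[unfolded Z_def] 1[unfolded Z_def]])
qed

text \<open>Against an Ito sum \<open>g\<close> averages to zero term by term, since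
  \<open>g\<close> and the integrand are known at the left endpoint of each increment. For bounded
  \<open>g\<close>, replacing the sum by its limit costs at most \<open>b\<close> times their
  distance in mean.\<close>

lemma F_martingale_bounded:
  fixes g :: "'a \<Rightarrow> complex"
  assumes st: "0 \<le> s" "s \<le> t" and g: "g \<in> borel_measurable (FF s)" "\<And>\<omega>. norm (g \<omega>) \<le> b"
  shows "expectation (\<lambda>\<omega>. g \<omega> * of_real ((F t \<omega> - F s \<omega>) $ i $ j)) = 0"
proof -
  have [measurable]: "F t \<in> borel_measurable M" "F s \<in> borel_measurable M" "g \<in> borel_measurable M"
    using FF_M_measurable[OF st(1) g(1)] st by auto
  have b: "b \<ge> 0" using g(2) norm_ge_zero order_trans by blast
  have ii: "integrable M (\<lambda>\<omega>. g \<omega> * of_real (X \<omega> $ i $ j))" "norm (expectation (\<lambda>\<omega>. g \<omega> * of_real (X \<omega> $ i $ j))) \<le> b * expectation (\<lambda>\<omega>. norm (X \<omega>))"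
    if X: "integrable M X" for X :: "'a \<Rightarrow> real^2^2"
  proof -
    have [measurable]: "X \<in> borel_measurable M" using X by auto
    have le: "norm (g \<omega> * of_real (X \<omega> $ i $ j)) \<le> b * norm (X \<omega>)" for \<omega>
      using g(2)[of \<omega>] abs_nth_22_le[of "X \<omega>" i j] b by (simp add: norm_mult mult_mono)
    show 1: "integrable M (\<lambda>\<omega>. g \<omega> * of_real (X \<omega> $ i $ j))"
      by (rule integrable_dominated[of M "\<lambda>\<omega>. b * norm (X \<omega>)"])
        (use X le in \<open>auto intro!: AE_I2 intro: order_trans[OF _ abs_ge_self]\<close>)
    have "norm (expectation (\<lambda>\<omega>. g \<omega> * of_real (X \<omega> $ i $ j))) \<le> expectation (\<lambda>\<omega>. norm (g \<omega> * of_real (X \<omega> $ i $ j)))"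
      by (rule integral_norm_bound)
    also have "\<dots> \<le> expectation (\<lambda>\<omega>. b * norm (X \<omega>))"
      by (rule integral_mono) (use X 1 le in auto)
    finally have "norm (expectation (\<lambda>\<omega>. g \<omega> * of_real (X \<omega> $ i $ j))) \<le> expectation (\<lambda>\<omega>. b * norm (X \<omega>))" .
    then show "norm (expectation (\<lambda>\<omega>. g \<omega> * of_real (X \<omega> $ i $ j))) \<le> b * expectation (\<lambda>\<omega>. norm (X \<omega>))" by simp
  qed
  have Fi: "integrable M (\<lambda>\<omega>. F t \<omega> - F s \<omega>)"
    by (rule integrable_of_square[OF _ F_increment_bound(1)[OF st]]) measurable
  have "norm (expectation (\<lambda>\<omega>. g \<omega> * of_real ((F t \<omega> - F s \<omega>) $ i $ j))) \<le> 0"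
  proof (rule field_le_epsilon)
    fix e :: real assume e: "e > 0"
    \<comment> \<open>The \<open>+ 1\<close> keeps the quotient positive when
      \<open>b = 0\<close>.\<close>
    have eb: "e / (b + 1) > 0" using e b by simp
    let ?D = "ito_mesh s t"
    obtain n where n: "n \<ge> 1" "integrable M (\<lambda>\<omega>. ?D n \<omega> - (F t \<omega> - F s \<omega>))"
      "expectation (\<lambda>\<omega>. norm (?D n \<omega> - (F t \<omega> - F s \<omega>))) < e / (b + 1)"
      by (rule ito_increment_L1_limit[OF st eb])
    let ?u = "mesh s t n"
    have u: "?u k \<le> ?u (Suc k)" "0 \<le> ?u k" "s \<le> ?u k" for k
      using st mesh_mono[of s t n k] mesh_ge[of s t n k] by auto
    have summand: "integrable M (\<lambda>\<omega>. g \<omega> * of_real (F (?u k) \<omega> $ i $ l) * of_real ((B (?u (Suc k)) \<omega> - B (?u k) \<omega>) $ l $ j))"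
      "expectation (\<lambda>\<omega>. g \<omega> * of_real (F (?u k) \<omega> $ i $ l) * of_real ((B (?u (Suc k)) \<omega> - B (?u k) \<omega>) $ l $ j)) = 0" for k l
    proof -
      have [measurable]: "g \<in> borel_measurable (FF (?u k))" "F (?u k) \<in> borel_measurable (FF (?u k))"
        using FF_mono_measurable[OF u(3) g(1)] F_adapted[OF u(2)] by auto
      have m: "(\<lambda>\<omega>. g \<omega> * of_real (F (?u k) \<omega> $ i $ l)) \<in> borel_measurable (FF (?u k))" by measurable
      have le: "norm (g \<omega> * of_real (F (?u k) \<omega> $ i $ l)) \<le> b * norm (F (?u k) \<omega>)" for \<omega>
        using g(2)[of \<omega>] abs_nth_22_le[of "F (?u k) \<omega>" i l] b by (simp add: norm_mult mult_mono)
      have iF: "integrable M (F (?u k))"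
        by (rule integrable_of_square[OF F_measurable[OF u(2)] F_norm_moment(1)[OF u(2)]])
      have "integrable M (\<lambda>\<omega>. g \<omega> * of_real (F (?u k) \<omega> $ i $ l))"
        by (rule integrable_dominated[of M "\<lambda>\<omega>. b * norm (F (?u k) \<omega>)"])
          (use iF FF_M_measurable[OF u(2) m] le in \<open>auto intro!: AE_I2 intro: order_trans[OF _ abs_ge_self]\<close>)
      from indep_increment_nth[OF u(2) u(1) m this]
      show "integrable M (\<lambda>\<omega>. g \<omega> * of_real (F (?u k) \<omega> $ i $ l) * of_real ((B (?u (Suc k)) \<omega> - B (?u k) \<omega>) $ l $ j))"
      "expectation (\<lambda>\<omega>. g \<omega> * of_real (F (?u k) \<omega> $ i $ l) * of_real ((B (?u (Suc k)) \<omega> - B (?u k) \<omega>) $ l $ j)) = 0" by auto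
    qed
    have D: "g \<omega> * of_real (?D n \<omega> $ i $ j) = (\<Sum>k<n. g \<omega> * of_real (F (?u k) \<omega> $ i $ 1) * of_real ((B (?u (Suc k)) \<omega> - B (?u k) \<omega>) $ 1 $ j)
        + g \<omega> * of_real (F (?u k) \<omega> $ i $ 2) * of_real ((B (?u (Suc k)) \<omega> - B (?u k) \<omega>) $ 2 $ j))" for \<omega>
      by (simp add: ito_mesh_def sum_component matrix_mult_22 sum_distrib_left ring_distribs mult.assoc)
    have ED: "expectation (\<lambda>\<omega>. g \<omega> * of_real (?D n \<omega> $ i $ j)) = 0"
      unfolding D
      by (subst Bochner_Integration.integral_sum, intro Bochner_Integration.integrable_add summand)
        (subst Bochner_Integration.integral_add[OF summand(1) summand(1)], simp only: summand(2) add_0 sum.neutral_const)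
    have iD: "integrable M (\<lambda>\<omega>. g \<omega> * of_real (?D n \<omega> $ i $ j))"
      unfolding D by (intro Bochner_Integration.integrable_sum Bochner_Integration.integrable_add summand(1))
    have "g \<omega> * of_real ((F t \<omega> - F s \<omega>) $ i $ j) = g \<omega> * of_real (?D n \<omega> $ i $ j) - g \<omega> * of_real ((?D n \<omega> - (F t \<omega> - F s \<omega>)) $ i $ j)" for \<omega>
      by (simp add: algebra_simps)
    then have "norm (expectation (\<lambda>\<omega>. g \<omega> * of_real ((F t \<omega> - F s \<omega>) $ i $ j))) =
        norm (expectation (\<lambda>\<omega>. g \<omega> * of_real ((?D n \<omega> - (F t \<omega> - F s \<omega>)) $ i $ j)))"
      using iD ED ii(1)[OF n(2)] by (simp del: vector_minus_component)
    also have "\<dots> \<le> b * (e / (b + 1))"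
      using ii(2)[OF n(2)] mult_left_mono[OF less_imp_le[OF n(3)] b] by linarith
    also have "\<dots> \<le> e" using e b by (simp add: field_simps)
    finally show "norm (expectation (\<lambda>\<omega>. g \<omega> * of_real ((F t \<omega> - F s \<omega>) $ i $ j))) \<le> 0 + e" by simp
  qed
  then show ?thesis by simp
qed

text \<open>\<open>g\<close> is set to zero where its modulus exceeds \<open>k\<close>, which keeps
  it measurable with respect to the past; dominated convergence removes the cut-off.\<close>

lemma F_martingale:
  fixes g :: "'a \<Rightarrow> complex"
  assumes st: "0 \<le> s" "s \<le> t" and g: "g \<in> borel_measurable (FF s)" "integrable M (\<lambda>\<omega>. (norm (g \<omega>))\<^sup>2)"
  shows "integrable M (\<lambda>\<omega>. g \<omega> * of_real ((F t \<omega> - F s \<omega>) $ i $ j))"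
    "expectation (\<lambda>\<omega>. g \<omega> * of_real ((F t \<omega> - F s \<omega>) $ i $ j)) = 0"
proof -
  have [measurable]: "F t \<in> borel_measurable M" "F s \<in> borel_measurable M" "g \<in> borel_measurable M"
    using FF_M_measurable[OF st(1) g(1)] st by auto
  show i: "integrable M (\<lambda>\<omega>. g \<omega> * of_real ((F t \<omega> - F s \<omega>) $ i $ j))"
    by (rule integrable_prod_of_squares[OF _ g(2) F_increment_bound(1)[OF st], where C=1])
      (auto simp: norm_mult simp del: vector_minus_component intro!: mult_left_mono abs_nth_22_le)
  define gk where "gk = (\<lambda>k \<omega>. if norm (g \<omega>) \<le> real k then g \<omega> else 0)"
  have m: "gk k \<in> borel_measurable (FF s)" for k unfolding gk_def using g(1) by measurable
  have [measurable]: "gk k \<in> borel_measurable M" for k using FF_M_measurable[OF st(1) m] .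
  have "(\<lambda>k. expectation (\<lambda>\<omega>. gk k \<omega> * of_real ((F t \<omega> - F s \<omega>) $ i $ j))) \<longlonglongrightarrow>
      expectation (\<lambda>\<omega>. g \<omega> * of_real ((F t \<omega> - F s \<omega>) $ i $ j))"
  proof (rule integral_dominated_convergence)
    show "integrable M (\<lambda>\<omega>. norm (g \<omega> * of_real ((F t \<omega> - F s \<omega>) $ i $ j)))" using i by simp
    show "AE \<omega> in M. (\<lambda>k. gk k \<omega> * of_real ((F t \<omega> - F s \<omega>) $ i $ j)) \<longlonglongrightarrow> g \<omega> * of_real ((F t \<omega> - F s \<omega>) $ i $ j)"
    proof (intro AE_I2 tendsto_eventually)
      fix \<omega>
      show "\<forall>\<^sub>F k in sequentially. gk k \<omega> * of_real ((F t \<omega> - F s \<omega>) $ i $ j) = g \<omega> * of_real ((F t \<omega> - F s \<omega>) $ i $ j)"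
        using eventually_ge_at_top[of "nat \<lceil>norm (g \<omega>)\<rceil>"]
        by eventually_elim (simp add: gk_def nat_ceiling_le_eq)
    qed
  qed (auto simp: gk_def)
  moreover have "expectation (\<lambda>\<omega>. gk k \<omega> * of_real ((F t \<omega> - F s \<omega>) $ i $ j)) = 0" for k
    by (rule F_martingale_bounded[OF st m, of _ "real k"]) (simp add: gk_def)
  ultimately show "expectation (\<lambda>\<omega>. g \<omega> * of_real ((F t \<omega> - F s \<omega>) $ i $ j)) = 0"
    by (simp add: LIMSEQ_const_iff)
qed

text \<open>Both \<open>F t - F s\<close> and its Euler approximation average to zero against the
  past. Size alone would not suffice: the root mean square of the remainder is only bounded by a
  multiple of \<open>t - s\<close>, and such errors need not become small when summed over all
  steps.\<close>

lemma remainder_orthogonal: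
  fixes g :: "'a \<Rightarrow> complex"
  assumes st: "0 \<le> s" "s \<le> t" and g: "g \<in> borel_measurable (FF s)" "integrable M (\<lambda>\<omega>. (norm (g \<omega>))\<^sup>2)"
  shows "integrable M (\<lambda>\<omega>. g \<omega> * of_real (remainder s t \<omega> $ i $ j))"
    "expectation (\<lambda>\<omega>. g \<omega> * of_real (remainder s t \<omega> $ i $ j)) = 0"
proof -
  have m: "(\<lambda>\<omega>. g \<omega> * of_real (F s \<omega> $ i $ l)) \<in> borel_measurable (FF s)" for l
    using g(1) F_adapted[OF st(1)] by measurable
  have "integrable M (\<lambda>\<omega>. g \<omega> * of_real (F s \<omega> $ i $ l))" for l
    by (rule integrable_prod_of_squares[OF FF_M_measurable[OF st(1) m] g(2) F_norm_moment(1)[OF st(1)], where C=1])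
      (auto simp: norm_mult intro!: mult_left_mono abs_nth_22_le)
  note t = indep_increment_nth[OF st m this, of _ _ j]
  have eq: "g \<omega> * of_real (remainder s t \<omega> $ i $ j) = g \<omega> * of_real ((F t \<omega> - F s \<omega>) $ i $ j) -
      (g \<omega> * of_real (F s \<omega> $ i $ 1) * of_real ((B t \<omega> - B s \<omega>) $ 1 $ j) +
       g \<omega> * of_real (F s \<omega> $ i $ 2) * of_real ((B t \<omega> - B s \<omega>) $ 2 $ j))" for \<omega>
    by (simp add: remainder_def matrix_mult_22 algebra_simps)
  show "integrable M (\<lambda>\<omega>. g \<omega> * of_real (remainder s t \<omega> $ i $ j))"
    "expectation (\<lambda>\<omega>. g \<omega> * of_real (remainder s t \<omega> $ i $ j)) = 0"
    unfolding eq using t F_martingale[OF st g, of i j] by (simp_all del: vector_minus_component)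
qed

end

subsection \<open>The covariance of the driving Brownian motion\<close>

text \<open>Inner products with these are the coordinates \<open>x, y, w\<close> of the trace-free matrix
  with rows \<open>(x, y + w)\<close>, \<open>(y - w, - x)\<close>.\<close>

definition S1 :: "real^2^2" where "S1 = vector [vector [1/2, 0], vector [0, -1/2]]"
definition S2 :: "real^2^2" where "S2 = vector [vector [0, 1/2], vector [1/2, 0]]"
definition J :: "real^2^2" where "J = vector [vector [0, 1/2], vector [-1/2, 0]]"

lemma inner_S1: "S1 \<bullet> A = (A$1$1 - A$2$2) / 2"
  and inner_S2: "S2 \<bullet> A = (A$1$2 + A$2$1) / 2"
  and inner_J: "J \<bullet> A = (A$1$2 - A$2$1) / 2"
  and inner_mat_1: "mat 1 \<bullet> A = A$1$1 + A$2$2"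
  by (simp_all add: inner_22 S1_def S2_def J_def mat_def field_simps)

lemma norm_sq_S1_S2_J: "(norm A)\<^sup>2 = 2 * (S1 \<bullet> A)\<^sup>2 + 2 * (S2 \<bullet> A)\<^sup>2 + 2 * (J \<bullet> A)\<^sup>2 + (mat 1 \<bullet> A)\<^sup>2 / 2"
  unfolding norm_sq_22 inner_S1 inner_S2 inner_J inner_mat_1 by (simp add: power2_eq_square field_simps)

lemma mat_eq_iff_22: "(A::real^2^2) = C \<longleftrightarrow> A$1$1 = C$1$1 \<and> A$1$2 = C$1$2 \<and> A$2$1 = C$2$1 \<and> A$2$2 = C$2$2"
  by (auto simp: vec_eq_iff forall_2)

lemma orthogonal_matrix_inv:
  assumes "orthogonal_matrix (Q::real^2^2)"
  shows "matrix_inv Q = transpose Q"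
proof -
  have Q: "Q ** transpose Q = mat 1" "transpose Q ** Q = mat 1" using assms by (auto simp: orthogonal_matrix_def)
  have "Q ** matrix_inv Q = mat 1 \<and> matrix_inv Q ** Q = mat 1"
    unfolding matrix_inv_def by (rule someI[of _ "transpose Q"]) (use Q in auto)
  then have "matrix_inv Q = matrix_inv Q ** (Q ** transpose Q)" "matrix_inv Q ** Q = mat 1" by (simp_all add: Q)
  then show ?thesis by (simp add: matrix_mul_assoc)
qed

lemma inner_conj: "(A::real^2^2) \<bullet> (Q ** X ** transpose Q) = (transpose Q ** A ** Q) \<bullet> (X::real^2^2)"
  for Q :: "real^2^2"
  by (simp add: inner_22 matrix_mult_22 transpose_def algebra_simps)

text \<open>The limit \<open>h\<close> to 0 in a form suited to the small-time comparison of
  \<open>F\<close> with \<open>B\<close>, whose relative error is a multiple of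
  \<open>h\<close>.\<close>

lemma le_small_multiples_eq_0:
  fixes a c :: real
  assumes "\<And>h. 0 < h \<Longrightarrow> h \<le> 1 \<Longrightarrow> \<bar>a\<bar> \<le> c * h"
  shows "a = 0"
proof (rule ccontr)
  assume a: "a \<noteq> 0"
  then have c: "c > 0" using assms[of 1] by simp
  define h where "h = min 1 (\<bar>a\<bar> / (2 * c))"
  have h: "0 < h" "h \<le> 1" "h \<le> \<bar>a\<bar> / (2 * c)" using a c by (auto simp: h_def)
  have "\<bar>a\<bar> \<le> c * h" by (rule assms[OF h(1,2)])
  also have "\<dots> \<le> c * (\<bar>a\<bar> / (2 * c))" using h(3) c by (intro mult_left_mono) auto
  also have "\<dots> = \<bar>a\<bar> / 2" using c by simp
  finally show False using a by simp
qed

context brownian_motion_sl2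
begin

lemma inner_increment_prod_integrable:
  assumes st: "0 \<le> s" "s \<le> t"
  shows "integrable M (\<lambda>\<omega>. (A \<bullet> (B t \<omega> - B s \<omega>)) * (A' \<bullet> (B t \<omega> - B s \<omega>)))"
proof -
  have [measurable]: "B t \<in> borel_measurable M" "B s \<in> borel_measurable M" using st by auto
  have "integrable M (\<lambda>\<omega>. (norm (A \<bullet> (B t \<omega> - B s \<omega>)))\<^sup>2)" for A
    using increment_even_moment(1)[OF st, of A 1] by simp
  note integrable_prod_of_squares[OF _ this[of A] this[of A'], where C=1]
  from this[of "\<lambda>\<omega>. (A \<bullet> (B t \<omega> - B s \<omega>)) * (A' \<bullet> (B t \<omega> - B s \<omega>))"]
  show ?thesis by (simp add: abs_mult)
qed

text \<open>The Gaussian assumption gives variances only. Polarization over \<open>[s, t]\<close>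
  and over the unit interval expresses both mixed moments by the same variances.\<close>

lemma increment_cov:
  assumes st: "0 \<le> s" "s \<le> t"
  shows "expectation (\<lambda>\<omega>. (A \<bullet> (B t \<omega> - B s \<omega>)) * (A' \<bullet> (B t \<omega> - B s \<omega>))) = (t - s) * cov A A'"
proof -
  have sq: "expectation (\<lambda>\<omega>. (A \<bullet> (B t \<omega> - B s \<omega>)) * (A \<bullet> (B t \<omega> - B s \<omega>))) = (t - s) * cov A A"
    if "0 \<le> s" "s \<le> t" for s t A
    using increment_even_moment(2)[OF that, of A 1] by (simp add: power2_eq_square)
  have polar: "4 * expectation (\<lambda>\<omega>. (A \<bullet> (B t \<omega> - B s \<omega>)) * (A' \<bullet> (B t \<omega> - B s \<omega>))) =
      (t - s) * (cov (A + A') (A + A') - cov (A - A') (A - A'))" if st: "0 \<le> s" "s \<le> t" for s t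
  proof -
    have "4 * ((A \<bullet> X) * (A' \<bullet> X)) = ((A + A') \<bullet> X) * ((A + A') \<bullet> X) - ((A - A') \<bullet> X) * ((A - A') \<bullet> X)" for X
      by (simp add: inner_add_left inner_diff_left algebra_simps)
    then have "4 * expectation (\<lambda>\<omega>. (A \<bullet> (B t \<omega> - B s \<omega>)) * (A' \<bullet> (B t \<omega> - B s \<omega>))) =
        expectation (\<lambda>\<omega>. ((A + A') \<bullet> (B t \<omega> - B s \<omega>)) * ((A + A') \<bullet> (B t \<omega> - B s \<omega>))
          - ((A - A') \<bullet> (B t \<omega> - B s \<omega>)) * ((A - A') \<bullet> (B t \<omega> - B s \<omega>)))"
      by (subst integral_mult_right_zero[symmetric]) simp
    also have "\<dots> = (t - s) * cov (A + A') (A + A') - (t - s) * cov (A - A') (A - A')"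
      by (subst Bochner_Integration.integral_diff[OF inner_increment_prod_integrable[OF st] inner_increment_prod_integrable[OF st]])
        (simp only: sq[OF st])
    finally show ?thesis by (simp add: algebra_simps)
  qed
  have "4 * expectation (\<lambda>\<omega>. (A \<bullet> (B t \<omega> - B s \<omega>)) * (A' \<bullet> (B t \<omega> - B s \<omega>))) = (t - s) * (4 * cov A A')"
    using polar[OF st] polar[of 0 1] by (simp add: cov_def[of A A'])
  then show ?thesis by simp
qed

lemma cov_add_diff:
  "cov (A + A') (A + A') = cov A A + 2 * cov A A' + cov A' A'"
  "cov (A - A') (A - A') = cov A A - 2 * cov A A' + cov A' A'"
proof -
  have i: "integrable M (\<lambda>\<omega>. (A \<bullet> (B 1 \<omega> - B 0 \<omega>)) * (A' \<bullet> (B 1 \<omega> - B 0 \<omega>)))" for A A'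
    by (rule inner_increment_prod_integrable) auto
  have "cov (A + A') (A + A') = expectation (\<lambda>\<omega>. (A \<bullet> (B 1 \<omega> - B 0 \<omega>)) * (A \<bullet> (B 1 \<omega> - B 0 \<omega>))
      + 2 * ((A \<bullet> (B 1 \<omega> - B 0 \<omega>)) * (A' \<bullet> (B 1 \<omega> - B 0 \<omega>))) + (A' \<bullet> (B 1 \<omega> - B 0 \<omega>)) * (A' \<bullet> (B 1 \<omega> - B 0 \<omega>)))"
    unfolding cov_def by (rule Bochner_Integration.integral_cong) (simp_all only: inner_add_left, simp add: algebra_simps)
  then show "cov (A + A') (A + A') = cov A A + 2 * cov A A' + cov A' A'"
    unfolding cov_def using i by simp
  have "cov (A - A') (A - A') = expectation (\<lambda>\<omega>. (A \<bullet> (B 1 \<omega> - B 0 \<omega>)) * (A \<bullet> (B 1 \<omega> - B 0 \<omega>))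
      - 2 * ((A \<bullet> (B 1 \<omega> - B 0 \<omega>)) * (A' \<bullet> (B 1 \<omega> - B 0 \<omega>))) + (A' \<bullet> (B 1 \<omega> - B 0 \<omega>)) * (A' \<bullet> (B 1 \<omega> - B 0 \<omega>)))"
    unfolding cov_def by (rule Bochner_Integration.integral_cong) (simp_all only: inner_diff_left, simp add: algebra_simps)
  then show "cov (A - A') (A - A') = cov A A - 2 * cov A A' + cov A' A'"
    unfolding cov_def using i by simp
qed

lemma cov_uminus: "cov (- A) (- A) = cov A A"
  by (simp add: cov_def)

lemma increment_trace:
  assumes "0 \<le> s" "s \<le> t" "\<omega> \<in> space M"
  shows "(B t \<omega> - B s \<omega>) $ 2 $ 2 = - ((B t \<omega> - B s \<omega>) $ 1 $ 1)"
  using B_sl2[of t \<omega>] B_sl2[of s \<omega>] assms by (simp add: sl2_def trace_def sum_2)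

lemma cov_mat_1: "cov (mat 1) (mat 1) = 0"
proof -
  have "cov (mat 1) (mat 1) = expectation (\<lambda>\<omega>. 0)"
    unfolding cov_def inner_mat_1 by (rule Bochner_Integration.integral_cong) (simp_all add: increment_trace del: vector_minus_component)
  then show ?thesis by simp
qed

end

context geometric_brownian_motion_SL2
begin

lemma E_F: "t \<ge> 0 \<Longrightarrow> integrable M (\<lambda>\<omega>. F t \<omega> $ i $ j)" "t \<ge> 0 \<Longrightarrow> expectation (\<lambda>\<omega>. F t \<omega> $ i $ j) = (mat 1 :: real^2^2) $ i $ j"
proof -
  assume t: "t \<ge> 0"
  have i: "integrable M (F u)" if "u \<ge> 0" for u
    by (rule integrable_of_square[OF F_measurable[OF that] F_norm_moment(1)[OF that]])
  have ij: "integrable M (\<lambda>\<omega>. F u \<omega> $ i $ j)" if "u \<ge> 0" for u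
    by (rule integrable_dominated[OF i[OF that]]) (use F_measurable[OF that] in \<open>auto intro!: AE_I2 abs_nth_22_le\<close>)
  show "integrable M (\<lambda>\<omega>. F t \<omega> $ i $ j)" by (rule ij[OF t])
  have "expectation (\<lambda>\<omega>. of_real ((F t \<omega> - F 0 \<omega>) $ i $ j) :: complex) = 0"
    using F_martingale(2)[of 0 t "\<lambda>_. 1" i j] t by simp
  then have "expectation (\<lambda>\<omega>. (F t \<omega> - F 0 \<omega>) $ i $ j) = 0"
    by (simp only: integral_complex_of_real of_real_eq_0_iff)
  then have "expectation (\<lambda>\<omega>. F t \<omega> $ i $ j) = expectation (\<lambda>\<omega>. F 0 \<omega> $ i $ j)"
    using ij[OF t] ij[of 0] by simp
  also have "\<dots> = expectation (\<lambda>\<omega>. (mat 1 :: real^2^2) $ i $ j)"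
    by (rule integral_cong_AE) (use F_start in \<open>auto simp: F_measurable\<close>)
  finally show "expectation (\<lambda>\<omega>. F t \<omega> $ i $ j) = (mat 1 :: real^2^2) $ i $ j" by (simp add: prob_space)
qed

text \<open>Collects the constants of \<open>F_small_time\<close>:
  \<open>8 * K\<^sup>2 * exp 1\<close> once for the squared remainder and once for its quotient by
  \<open>h\<close>, and \<open>K\<close> for the increment.\<close>

definition K' :: real where "K' = 16 * K\<^sup>2 * exp 1 + K"

text \<open>Isotropy and normalization are assumed for \<open>F\<close>; this transfers them to
  \<open>B\<close>. Up to the remainder, \<open>F - 1\<close> at time \<open>h\<^sup>2\<close> is
  the increment of \<open>B\<close>, and the mixed product is split by \<open>young\<close> with
  weight \<open>h\<close>.\<close>

lemma F_small_time:
  assumes h: "0 < h" "h \<le> 1"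
  shows "\<bar>expectation (\<lambda>\<omega>. (A \<bullet> (F (h\<^sup>2) \<omega> - mat 1))\<^sup>2) - h\<^sup>2 * cov A A\<bar> \<le> (norm A)\<^sup>2 * K' * h^3"
    "integrable M (\<lambda>\<omega>. (A \<bullet> (F (h\<^sup>2) \<omega> - mat 1))\<^sup>2)"
proof -
  define t where "t = h\<^sup>2"
  have t: "0 \<le> (0::real)" "0 \<le> t" "t \<le> 1" using h by (auto simp: t_def power_le_one)
  have [measurable]: "F t \<in> borel_measurable M" "B t \<in> borel_measurable M" "F 0 \<in> borel_measurable M" "B 0 \<in> borel_measurable M" using t by auto
  define X where "X = (\<lambda>\<omega>. A \<bullet> (F t \<omega> - mat 1))"
  define Y where "Y = (\<lambda>\<omega>. A \<bullet> (B t \<omega> - B 0 \<omega>))"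
  define R where "R = (\<lambda>\<omega>. norm (remainder 0 t \<omega>))"
  define b where "b = (\<lambda>\<omega>. norm (B t \<omega> - B 0 \<omega>))"
  have [measurable]: "X \<in> borel_measurable M" "Y \<in> borel_measurable M" unfolding X_def Y_def by measurable
  have bd: "AE \<omega> in M. \<bar>(X \<omega>)\<^sup>2 - (Y \<omega>)\<^sup>2\<bar> \<le> (norm A)\<^sup>2 * ((R \<omega>)\<^sup>2 + (R \<omega>)\<^sup>2 / h + h * (b \<omega>)\<^sup>2)"
    using F_start
  proof eventually_elim
    case (elim \<omega>)
    have X: "X \<omega> = Y \<omega> + A \<bullet> remainder 0 t \<omega>"
      using elim by (simp add: X_def Y_def remainder_def inner_diff_right)
    have "\<bar>(X \<omega>)\<^sup>2 - (Y \<omega>)\<^sup>2\<bar> = \<bar>A \<bullet> remainder 0 t \<omega>\<bar> * \<bar>A \<bullet> remainder 0 t \<omega> + 2 * Y \<omega>\<bar>"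
      unfolding X abs_mult[symmetric] by (simp add: power2_eq_square algebra_simps)
    also have "\<dots> \<le> (norm A * R \<omega>) * (norm A * R \<omega> + 2 * (norm A * b \<omega>))"
    proof (rule mult_mono)
      show 1: "\<bar>A \<bullet> remainder 0 t \<omega>\<bar> \<le> norm A * R \<omega>" unfolding R_def by (rule Cauchy_Schwarz_ineq2)
      have "\<bar>Y \<omega>\<bar> \<le> norm A * b \<omega>" unfolding Y_def b_def by (rule Cauchy_Schwarz_ineq2)
      with 1 show "\<bar>A \<bullet> remainder 0 t \<omega> + 2 * Y \<omega>\<bar> \<le> norm A * R \<omega> + 2 * (norm A * b \<omega>)" by linarith
    qed (auto simp: R_def)
    also have "\<dots> = (norm A)\<^sup>2 * ((R \<omega>)\<^sup>2 + 2 * (R \<omega> * b \<omega>))" by (simp add: power2_eq_square algebra_simps)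
    also have "\<dots> \<le> (norm A)\<^sup>2 * ((R \<omega>)\<^sup>2 + ((R \<omega>)\<^sup>2 / h + h * (b \<omega>)\<^sup>2))"
      by (intro mult_left_mono add_left_mono young[OF h(1)]) auto
    finally show ?case by (simp add: add.assoc)
  qed
  have iR: "integrable M (\<lambda>\<omega>. (R \<omega>)\<^sup>2)" "expectation (\<lambda>\<omega>. (R \<omega>)\<^sup>2) \<le> 8 * K\<^sup>2 * exp 1 * h^4"
  proof -
    show "integrable M (\<lambda>\<omega>. (R \<omega>)\<^sup>2)" unfolding R_def by (rule remainder_bound(1)[OF t(1,2)])
    have "8 * K\<^sup>2 * exp t * (t - 0)\<^sup>2 \<le> 8 * K\<^sup>2 * exp 1 * h^4"
      unfolding t_def using t by (simp add: t_def mult_left_mono mult_right_mono power_mult[symmetric])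
    with remainder_bound(2)[OF t(1,2)] show "expectation (\<lambda>\<omega>. (R \<omega>)\<^sup>2) \<le> 8 * K\<^sup>2 * exp 1 * h^4"
      unfolding R_def by linarith
  qed
  have ib: "integrable M (\<lambda>\<omega>. (b \<omega>)\<^sup>2)" "expectation (\<lambda>\<omega>. (b \<omega>)\<^sup>2) \<le> K * h\<^sup>2"
    unfolding b_def using norm_increment_integrable[OF t(1,2)] increment_norm_moment_le[OF t(1,2), of 1] by (auto simp: t_def)
  have iY: "integrable M (\<lambda>\<omega>. (Y \<omega>)\<^sup>2)" "expectation (\<lambda>\<omega>. (Y \<omega>)\<^sup>2) = h\<^sup>2 * cov A A"
    unfolding Y_def using increment_even_moment(1,2)[OF t(1,2), of A 1] by (auto simp: t_def)
  have iW: "integrable M (\<lambda>\<omega>. (norm A)\<^sup>2 * ((R \<omega>)\<^sup>2 + (R \<omega>)\<^sup>2 / h + h * (b \<omega>)\<^sup>2))"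
    using iR ib by auto
  have iD: "integrable M (\<lambda>\<omega>. (X \<omega>)\<^sup>2 - (Y \<omega>)\<^sup>2)"
    by (rule integrable_dominated[OF iW]) (use bd in auto)
  have "integrable M (\<lambda>\<omega>. ((X \<omega>)\<^sup>2 - (Y \<omega>)\<^sup>2) + (Y \<omega>)\<^sup>2)"
    by (rule Bochner_Integration.integrable_add[OF iD iY(1)])
  then have iX: "integrable M (\<lambda>\<omega>. (X \<omega>)\<^sup>2)" by simp
  then show "integrable M (\<lambda>\<omega>. (A \<bullet> (F (h\<^sup>2) \<omega> - mat 1))\<^sup>2)" by (simp add: X_def t_def)
  have "\<bar>expectation (\<lambda>\<omega>. (X \<omega>)\<^sup>2) - h\<^sup>2 * cov A A\<bar> = norm (expectation (\<lambda>\<omega>. (X \<omega>)\<^sup>2 - (Y \<omega>)\<^sup>2))"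
    using iX iY by simp
  also have "\<dots> \<le> expectation (\<lambda>\<omega>. norm ((X \<omega>)\<^sup>2 - (Y \<omega>)\<^sup>2))" by (rule integral_norm_bound)
  also have "\<dots> \<le> expectation (\<lambda>\<omega>. (norm A)\<^sup>2 * ((R \<omega>)\<^sup>2 + (R \<omega>)\<^sup>2 / h + h * (b \<omega>)\<^sup>2))"
    by (rule integral_mono_AE) (use iD iW bd in auto)
  also have "\<dots> = (norm A)\<^sup>2 * (expectation (\<lambda>\<omega>. (R \<omega>)\<^sup>2) + expectation (\<lambda>\<omega>. (R \<omega>)\<^sup>2) / h + h * expectation (\<lambda>\<omega>. (b \<omega>)\<^sup>2))"
    using iR ib by simp
  also have "\<dots> \<le> (norm A)\<^sup>2 * (8 * K\<^sup>2 * exp 1 * h^4 + 8 * K\<^sup>2 * exp 1 * h^4 / h + h * (K * h\<^sup>2))"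
    using iR(2) ib(2) h by (intro mult_left_mono add_mono divide_right_mono) auto
  also have "\<dots> \<le> (norm A)\<^sup>2 * (8 * K\<^sup>2 * exp 1 * h^3 + 8 * K\<^sup>2 * exp 1 * h^3 + K * h^3)"
    using h power_decreasing[of 3 4 h] by (intro mult_left_mono add_mono) (auto simp: power_numeral_reduce)
  also have "\<dots> = (norm A)\<^sup>2 * K' * h^3" by (simp add: K'_def algebra_simps)
  finally show "\<bar>expectation (\<lambda>\<omega>. (A \<bullet> (F (h\<^sup>2) \<omega> - mat 1))\<^sup>2) - h\<^sup>2 * cov A A\<bar> \<le> (norm A)\<^sup>2 * K' * h^3"
    by (simp add: X_def t_def)
qed

text \<open>The two laws agree on path space; evaluation at time \<open>t\<close> turns this into an
  equality of one-time laws.\<close>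

lemma F_isotropic_expectation:
  fixes g :: "real^2^2 \<Rightarrow> real"
  assumes Q: "orthogonal_matrix Q" and t: "t \<ge> 0" and g: "g \<in> borel_measurable borel"
  shows "expectation (\<lambda>\<omega>. g (Q ** F t \<omega> ** transpose Q)) = expectation (\<lambda>\<omega>. g (F t \<omega>))"
proof -
  have eq: "expectation (\<lambda>\<omega>. g (X t \<omega>)) = integral\<^sup>L (process_law M X) (\<lambda>p. g (p t))"
    if X: "\<And>u. u \<ge> 0 \<Longrightarrow> X u \<in> borel_measurable M" for X :: "real \<Rightarrow> 'a \<Rightarrow> real^2^2"
  proof -
    have "(\<lambda>\<omega>. \<lambda>u\<in>{0..}. X u \<omega>) \<in> M \<rightarrow>\<^sub>M Pi\<^sub>M {0..} (\<lambda>_. borel)"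
      by (rule measurable_restrict) (use X in auto)
    moreover have "(\<lambda>p. g (p t)) \<in> borel_measurable (Pi\<^sub>M {0..} (\<lambda>_. borel))"
      by (rule measurable_compose[OF _ g], rule measurable_component_singleton) (use t in auto)
    ultimately show ?thesis unfolding process_law_def using t by (subst integral_distr) auto
  qed
  have 1: "(\<lambda>\<omega>. Q ** F u \<omega> ** transpose Q) \<in> borel_measurable M" if "u \<ge> 0" for u
    using F_measurable[OF that] by measurable
  show ?thesis
    using eq[of "\<lambda>t \<omega>. Q ** F t \<omega> ** transpose Q", OF 1] eq[of F] F_isotropic[OF Q] orthogonal_matrix_inv[OF Q]
    by simp
qed

text \<open>Conjugation fixes the identity and moves from \<open>F\<close> to \<open>A\<close> by
  \<open>inner_conj\<close>. The second moments in the directions \<open>A\<close> and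
  \<open>?A\<close> therefore coincide, and so do their leading terms in small time.\<close>

lemma cov_isotropic:
  assumes Q: "orthogonal_matrix Q"
  shows "cov (transpose Q ** A ** Q) (transpose Q ** A ** Q) = cov A A"
proof -
  let ?A = "transpose Q ** A ** Q"
  have "cov ?A ?A - cov A A = 0"
  proof (rule le_small_multiples_eq_0)
    fix h :: real assume h: "0 < h" "h \<le> 1"
    have QQ: "Q ** transpose Q = mat 1" using Q by (simp add: orthogonal_matrix_def)
    have "expectation (\<lambda>\<omega>. (A \<bullet> (F (h\<^sup>2) \<omega> - mat 1))\<^sup>2) = expectation (\<lambda>\<omega>. (A \<bullet> (Q ** F (h\<^sup>2) \<omega> ** transpose Q - mat 1))\<^sup>2)"
      by (rule F_isotropic_expectation[OF Q, symmetric]) auto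
    also have "(\<lambda>\<omega>. A \<bullet> (Q ** F (h\<^sup>2) \<omega> ** transpose Q - mat 1)) = (\<lambda>\<omega>. ?A \<bullet> (F (h\<^sup>2) \<omega> - mat 1))"
      unfolding inner_conj[symmetric] matrix_mult_diff by (simp add: QQ)
    finally have eq: "expectation (\<lambda>\<omega>. (?A \<bullet> (F (h\<^sup>2) \<omega> - mat 1))\<^sup>2) = expectation (\<lambda>\<omega>. (A \<bullet> (F (h\<^sup>2) \<omega> - mat 1))\<^sup>2)" ..
    have "\<bar>h\<^sup>2 * (cov ?A ?A - cov A A)\<bar> \<le> (norm ?A)\<^sup>2 * K' * h^3 + (norm A)\<^sup>2 * K' * h^3"
      using F_small_time(1)[OF h, of ?A] F_small_time(1)[OF h, of A] unfolding eq right_diff_distrib by linarith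
    also have "\<dots> = h\<^sup>2 * (((norm ?A)\<^sup>2 * K' + (norm A)\<^sup>2 * K') * h)"
      by (simp add: power_numeral_reduce algebra_simps)
    finally show "\<bar>cov ?A ?A - cov A A\<bar> \<le> ((norm ?A)\<^sup>2 * K' + (norm A)\<^sup>2 * K') * h"
      using h by (simp add: abs_mult)
  qed
  then show ?thesis by simp
qed

text \<open>Conjugation with the reflection \<open>P\<close> fixes \<open>S1\<close> and reverses
  \<open>S2\<close> and \<open>J\<close>; the swap \<open>P'\<close> fixes \<open>S2\<close> and
  reverses \<open>J\<close>; the rotation \<open>Q\<close> by 45 degrees takes \<open>S1\<close> to
  \<open>- S2\<close>.\<close>

lemma cov_cross: "cov S1 S2 = 0" "cov S1 J = 0" "cov S2 J = 0" "cov S2 S2 = cov S1 S1"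
proof -
  define P :: "real^2^2" where "P = vector [vector [1, 0], vector [0, -1]]"
  define P' :: "real^2^2" where "P' = vector [vector [0, 1], vector [1, 0]]"
  define c where "c = sqrt (1/2)"
  have c: "c * c = 1/2" by (simp add: c_def)
  define Q :: "real^2^2" where "Q = vector [vector [c, -c], vector [c, c]]"
  note defs = P_def P'_def Q_def S1_def S2_def J_def
  have o: "orthogonal_matrix P" "orthogonal_matrix P'" "orthogonal_matrix Q"
    unfolding orthogonal_matrix_def mat_eq_iff_22 matrix_mult_22 transpose_def by (simp_all add: defs mat_def c)
  have c': "c * (c * x) = x / 2" for x using c by (simp add: mult.assoc[symmetric])
  have "transpose P ** (S1 + S2) ** P = S1 - S2" "transpose P ** (S1 + J) ** P = S1 - J"
    "transpose P' ** (S2 + J) ** P' = S2 - J" "transpose Q ** S1 ** Q = - S2"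
    unfolding mat_eq_iff_22 matrix_mult_22 transpose_def by (simp_all add: defs c c')
  note iso = cov_isotropic[OF o(1), of "S1 + S2", unfolded this] cov_isotropic[OF o(1), of "S1 + J", unfolded this]
    cov_isotropic[OF o(2), of "S2 + J", unfolded this] cov_isotropic[OF o(3), of S1, unfolded this]
  show "cov S1 S2 = 0" "cov S1 J = 0" "cov S2 J = 0" "cov S2 S2 = cov S1 S1"
    using iso unfolding cov_add_diff cov_uminus by auto
qed

text \<open>Compares the terms of order \<open>h\<^sup>2\<close> in the second moment
  \<open>2 * exp (h\<^sup>2)\<close> of \<open>F\<close> with the total variance of \<open>B\<close>
  over the four orthogonal directions.\<close>

lemma cov_normalized: "2 * cov S1 S1 + cov J J = 1"
proof -
  have "4 * cov S1 S1 + 2 * cov J J - 2 = 0"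
  proof (rule le_small_multiples_eq_0)
    fix h :: real assume h: "0 < h" "h \<le> 1"
    let ?E = "\<lambda>A. expectation (\<lambda>\<omega>. (A \<bullet> (F (h\<^sup>2) \<omega> - mat 1))\<^sup>2)"
    \<comment> \<open>Expansion of the squared norm about the identity. The linear term is the trace
      of \<open>X - mat 1\<close>, which has mean zero for \<open>X = F\<close> by
      \<open>E_F\<close>.\<close>
    have n: "(norm X)\<^sup>2 = 2 + 2 * ((X - mat 1) $ 1 $ 1 + (X - mat 1) $ 2 $ 2) + (2 * (S1 \<bullet> (X - mat 1))\<^sup>2 + 2 * (S2 \<bullet> (X - mat 1))\<^sup>2
        + 2 * (J \<bullet> (X - mat 1))\<^sup>2 + (mat 1 \<bullet> (X - mat 1))\<^sup>2 / 2)" for X :: "real^2^2"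
      unfolding norm_sq_S1_S2_J[symmetric] norm_sq_22 by (simp add: mat_def power2_eq_square algebra_simps)
    have "2 * exp (h\<^sup>2) = expectation (\<lambda>\<omega>. (norm (F (h\<^sup>2) \<omega>))\<^sup>2)" by (simp add: F_norm_moment)
    also have "\<dots> = 2 + (2 * ?E S1 + 2 * ?E S2 + 2 * ?E J + ?E (mat 1) / 2)"
      unfolding n using F_small_time(2)[OF h] E_F by (simp add: prob_space)
    finally have e: "2 * exp (h\<^sup>2) - 2 = 2 * ?E S1 + 2 * ?E S2 + 2 * ?E J + ?E (mat 1) / 2" by simp
    have "h\<^sup>2 \<le> 1" using h by (simp add: power_le_one)
    then have x: "\<bar>exp (h\<^sup>2) - 1 - h\<^sup>2\<bar> \<le> (h\<^sup>2)\<^sup>2"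
      using exp_bound[of "h\<^sup>2"] exp_ge_add_one_self[of "h\<^sup>2"] zero_le_power2[of h] unfolding abs_le_iff by linarith
    have x4: "(h\<^sup>2)\<^sup>2 \<le> h^3" using power_decreasing[of 3 4 h] h by (simp add: power_mult[symmetric])
    have "h\<^sup>2 * (4 * cov S1 S1 + 2 * cov J J - 2) = 2 * (h\<^sup>2 * cov S1 S1) + 2 * (h\<^sup>2 * cov S2 S2) + 2 * (h\<^sup>2 * cov J J) + h\<^sup>2 * cov (mat 1) (mat 1) / 2 - 2 * h\<^sup>2"
      by (simp add: cov_cross cov_mat_1 algebra_simps)
    then have "\<bar>h\<^sup>2 * (4 * cov S1 S1 + 2 * cov J J - 2)\<bar> \<le> 2 * ((norm S1)\<^sup>2 * K' * h^3) + 2 * ((norm S2)\<^sup>2 * K' * h^3)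
        + 2 * ((norm J)\<^sup>2 * K' * h^3) + (norm (mat 1 :: real^2^2))\<^sup>2 * K' * h^3 / 2 + 2 * h^3"
      using F_small_time(1)[OF h, of S1] F_small_time(1)[OF h, of S2] F_small_time(1)[OF h, of J] F_small_time(1)[OF h, of "mat 1"] e x x4
      by linarith
    also have "\<dots> = h\<^sup>2 * ((2 * (norm S1)\<^sup>2 * K' + 2 * (norm S2)\<^sup>2 * K' + 2 * (norm J)\<^sup>2 * K' + (norm (mat 1 :: real^2^2))\<^sup>2 * K' / 2 + 2) * h)"
      by (simp add: power_numeral_reduce algebra_simps)
    finally show "\<bar>4 * cov S1 S1 + 2 * cov J J - 2\<bar> \<le> (2 * (norm S1)\<^sup>2 * K' + 2 * (norm S2)\<^sup>2 * K' + 2 * (norm J)\<^sup>2 * K' + (norm (mat 1 :: real^2^2))\<^sup>2 * K' / 2 + 2) * h"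
      using h by (simp add: abs_mult)
  qed
  then show ?thesis by simp
qed

end

text \<open>For trace-free \<open>A\<close> this is minus the determinant, and \<open>A ** A\<close>
  is this multiple of the identity by Cayley-Hamilton.\<close>

definition sq_coeff :: "real^2^2 \<Rightarrow> real" where
  "sq_coeff A = A$1$1 * A$1$1 + A$1$2 * A$2$1"

lemma sq_coeff_le: "\<bar>sq_coeff A\<bar> \<le> (norm A)\<^sup>2"
proof -
  have "2 * \<bar>A$1$2 * A$2$1\<bar> \<le> (A$1$2)\<^sup>2 + (A$2$1)\<^sup>2"
    using sum_squares_bound[of "\<bar>A$1$2\<bar>" "\<bar>A$2$1\<bar>"] by (simp add: abs_mult)
  moreover have "\<bar>sq_coeff A\<bar> \<le> (A$1$1)\<^sup>2 + \<bar>A$1$2 * A$2$1\<bar>"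
    unfolding sq_coeff_def by (smt (verit) power2_eq_square zero_le_square)
  ultimately show ?thesis unfolding norm_sq_22 using zero_le_power2[of "A$2$2"] zero_le_power2[of "A$1$2"] zero_le_power2[of "A$2$1"] by linarith
qed

lemma sq_coeff_measurable [measurable]: "sq_coeff \<in> borel_measurable borel"
  unfolding sq_coeff_def by measurable

lemma sum_square_le: "(\<Sum>i<n. f i)\<^sup>2 \<le> real n * (\<Sum>i<n. (f i)\<^sup>2)" for f :: "nat \<Rightarrow> real"
  using Cauchy_Schwarz_ineq_sum[of "\<lambda>_. 1" f "{..<n}"] by simp

section \<open>The vanishing Ito correction\<close>

context geometric_brownian_motion_SL2
begin

text \<open>The sum of \<open>dF dB\<close> is twice the difference of the Stratonovich sum and the
  Ito sum, and both converge to \<open>F 1 - F 0\<close>. The factor two explains the tolerance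
  \<open>\<epsilon> / 4\<close>.\<close>

lemma quadratic_variation_limit:
  assumes e: "\<epsilon> > 0" "\<eta> > 0"
  obtains N where "\<And>n. n \<ge> N \<Longrightarrow> prob {\<omega>\<in>space M.
      norm (\<Sum>i<n. (F (mesh 0 1 n (Suc i)) \<omega> - F (mesh 0 1 n i) \<omega>) **
        (B (mesh 0 1 n (Suc i)) \<omega> - B (mesh 0 1 n i) \<omega>)) > \<epsilon>} < \<eta>"
proof -
  define S where "S = (\<lambda>n p \<omega>. \<Sum>i<n. F (p i) \<omega> ** (B (p (Suc i)) \<omega> - B (p i) \<omega>))"
  define S' where "S' = (\<lambda>n p \<omega>. \<Sum>i<n. ((1/2) *\<^sub>R (F (p i) \<omega> + F (p (Suc i)) \<omega>)) ** (B (p (Suc i)) \<omega> - B (p i) \<omega>))"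
  have e4: "\<epsilon> / 4 > 0" "\<eta> / 2 > 0" using e by auto
  obtain d1 where d1: "d1 > 0" "\<And>n p. fine_partition d1 1 n p \<Longrightarrow>
      measure M {\<omega> \<in> space M. norm (S n p \<omega> - (F 1 \<omega> - F 0 \<omega>)) > \<epsilon> / 4} < \<eta> / 2"
    using F_ito[of 1] e4 unfolding has_ito_integral_def partition_limit_in_prob_def S_def
    by (meson zero_le_one)
  obtain d2 where d2: "d2 > 0" "\<And>n p. fine_partition d2 1 n p \<Longrightarrow>
      measure M {\<omega> \<in> space M. norm (S' n p \<omega> - (F 1 \<omega> - F 0 \<omega>)) > \<epsilon> / 4} < \<eta> / 2"
    using F_stratonovich[of 1] e4 unfolding has_stratonovich_integral_def partition_limit_in_prob_def S'_def
    by (meson zero_le_one)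
  obtain N0 :: nat where N0: "1 / min d1 d2 < real N0" using reals_Archimedean2 by blast
  show thesis
  proof (rule that)
    fix n assume "n \<ge> max 1 N0"
    then have n: "n \<ge> 1" "1 / min d1 d2 < real n" using N0 by auto
    then have fine: "1 / real n < d1" "1 / real n < d2" using d1(1) d2(1)
      by (auto simp: field_simps min_def split: if_splits intro: less_le_trans mult_right_mono order_trans less_imp_le)
    let ?p = "mesh 0 1 n"
    have f: "fine_partition d1 1 n ?p" "fine_partition d2 1 n ?p"
      unfolding fine_partition_def using fine n mesh_mono[of 0 1 n] by (auto simp: mesh_n mesh_Suc)
    have p0: "?p i \<ge> 0" for i using mesh_ge[of 0 1] by simp
    have [measurable]: "S n ?p \<in> borel_measurable M" unfolding S_def using p0 by measurable
    have [measurable]: "S' n ?p \<in> borel_measurable M" unfolding S'_def using p0 by measurable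
    have [measurable]: "F 1 \<in> borel_measurable M" "F 0 \<in> borel_measurable M" by auto
    let ?A1 = "{\<omega> \<in> space M. norm (S n ?p \<omega> - (F 1 \<omega> - F 0 \<omega>)) > \<epsilon> / 4}"
    let ?A2 = "{\<omega> \<in> space M. norm (S' n ?p \<omega> - (F 1 \<omega> - F 0 \<omega>)) > \<epsilon> / 4}"
    let ?V = "\<lambda>\<omega>. \<Sum>i<n. (F (?p (Suc i)) \<omega> - F (?p i) \<omega>) ** (B (?p (Suc i)) \<omega> - B (?p i) \<omega>)"
    have V: "?V \<omega> = 2 *\<^sub>R (S' n ?p \<omega> - (F 1 \<omega> - F 0 \<omega>)) - 2 *\<^sub>R (S n ?p \<omega> - (F 1 \<omega> - F 0 \<omega>))" for \<omega>
    proof -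
      have "(X' - X) ** Y = 2 *\<^sub>R (((1/2) *\<^sub>R (X + X')) ** Y) - 2 *\<^sub>R (X ** Y)" for X X' Y :: "real^2^2"
        unfolding mat_eq_iff_22 by (simp add: matrix_mult_22 algebra_simps)
      then have "?V \<omega> = 2 *\<^sub>R S' n ?p \<omega> - 2 *\<^sub>R S n ?p \<omega>"
        unfolding S_def S'_def by (simp add: scaleR_sum_right sum_subtractf)
      then show ?thesis by (simp add: scaleR_diff_right)
    qed
    have "{\<omega>\<in>space M. norm (?V \<omega>) > \<epsilon>} \<subseteq> ?A1 \<union> ?A2"
    proof safe
      fix \<omega> assume *: "\<omega> \<in> space M" "\<epsilon> < norm (?V \<omega>)" "\<not> \<epsilon> / 4 < norm (S' n ?p \<omega> - (F 1 \<omega> - F 0 \<omega>))"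
      then show "\<epsilon> / 4 < norm (S n ?p \<omega> - (F 1 \<omega> - F 0 \<omega>))"
        using norm_triangle_ineq4[of "2 *\<^sub>R (S' n ?p \<omega> - (F 1 \<omega> - F 0 \<omega>))" "2 *\<^sub>R (S n ?p \<omega> - (F 1 \<omega> - F 0 \<omega>))"]
        unfolding V norm_scaleR by simp
    qed
    then have "prob {\<omega>\<in>space M. norm (?V \<omega>) > \<epsilon>} \<le> prob (?A1 \<union> ?A2)"
      by (intro finite_measure_mono) measurable
    also have "\<dots> \<le> prob ?A1 + prob ?A2" by (rule measure_Un_le) measurable
    also have "\<dots> < \<eta>" using d1(2)[OF f(1)] d2(2)[OF f(2)] by simp
    finally show "prob {\<omega>\<in>space M. norm (?V \<omega>) > \<epsilon>} < \<eta>" .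
  qed
qed

text \<open>In the coordinates \<open>x, y, w\<close> of a trace-free matrix,
  \<open>sq_coeff\<close> is x^2 + y^2 - w^2.\<close>

lemma sq_coeff_increment:
  assumes st: "0 \<le> s" "s \<le> t"
  shows "integrable M (\<lambda>\<omega>. sq_coeff (B t \<omega> - B s \<omega>))"
    "expectation (\<lambda>\<omega>. sq_coeff (B t \<omega> - B s \<omega>)) = (t - s) * (2 * cov S1 S1 - cov J J)"
    "integrable M (\<lambda>\<omega>. (sq_coeff (B t \<omega> - B s \<omega>))\<^sup>2)"
    "expectation (\<lambda>\<omega>. (sq_coeff (B t \<omega> - B s \<omega>))\<^sup>2) \<le> K * (t - s)\<^sup>2"
proof -
  have [measurable]: "B t \<in> borel_measurable M" "B s \<in> borel_measurable M" using st by auto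
  have m: "(\<lambda>\<omega>. sq_coeff (B t \<omega> - B s \<omega>)) \<in> borel_measurable M" by measurable
  have i: "integrable M (\<lambda>\<omega>. (A \<bullet> (B t \<omega> - B s \<omega>)) * (A \<bullet> (B t \<omega> - B s \<omega>)))" for A
    by (rule inner_increment_prod_integrable[OF st])
  have eq: "sq_coeff (B t \<omega> - B s \<omega>) = (S1 \<bullet> (B t \<omega> - B s \<omega>)) * (S1 \<bullet> (B t \<omega> - B s \<omega>))
      + (S2 \<bullet> (B t \<omega> - B s \<omega>)) * (S2 \<bullet> (B t \<omega> - B s \<omega>)) - (J \<bullet> (B t \<omega> - B s \<omega>)) * (J \<bullet> (B t \<omega> - B s \<omega>))"
    if "\<omega> \<in> space M" for \<omega>
    unfolding sq_coeff_def inner_S1 inner_S2 inner_J increment_trace[OF st that]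
    by (simp add: field_simps)
  show "integrable M (\<lambda>\<omega>. sq_coeff (B t \<omega> - B s \<omega>))"
    by (subst Bochner_Integration.integrable_cong[OF refl eq]) (use i in auto)
  have "expectation (\<lambda>\<omega>. sq_coeff (B t \<omega> - B s \<omega>)) = (t - s) * cov S1 S1 + (t - s) * cov S2 S2 - (t - s) * cov J J"
    unfolding increment_cov[OF st, symmetric] using i
    by (subst Bochner_Integration.integral_cong[OF refl eq]) auto
  then show "expectation (\<lambda>\<omega>. sq_coeff (B t \<omega> - B s \<omega>)) = (t - s) * (2 * cov S1 S1 - cov J J)"
    by (simp add: cov_cross algebra_simps)
  have i4: "integrable M (\<lambda>\<omega>. norm (B t \<omega> - B s \<omega>) ^ 4)" using increment_norm_moment(1)[OF st, of 2] by simp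
  have le: "(sq_coeff A)\<^sup>2 \<le> norm A ^ 4" for A
    using power_mono[OF sq_coeff_le[of A], of 2] by (simp add: power_mult[symmetric])
  show i2: "integrable M (\<lambda>\<omega>. (sq_coeff (B t \<omega> - B s \<omega>))\<^sup>2)"
    by (rule integrable_dominated[OF i4]) (use le in auto)
  have "expectation (\<lambda>\<omega>. (sq_coeff (B t \<omega> - B s \<omega>))\<^sup>2) \<le> expectation (\<lambda>\<omega>. norm (B t \<omega> - B s \<omega>) ^ 4)"
    by (rule integral_mono[OF i2 i4 le])
  also have "\<dots> \<le> K * (t - s)\<^sup>2" using increment_norm_moment_le[OF st, of 2] by simp
  finally show "expectation (\<lambda>\<omega>. (sq_coeff (B t \<omega> - B s \<omega>))\<^sup>2) \<le> K * (t - s)\<^sup>2" .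
qed

text \<open>Since the Ito and Stratonovich integrals agree, the sums of \<open>dF dB\<close> vanish in the limit. For trace-free
  \<open>dB\<close> the square \<open>dB dB\<close> is the scalar \<open>sq_coeff dB\<close>, so the mean of their upper left entry is
  the left-hand side below.\<close>

lemma cov_ito_correction: "2 * cov S1 S1 - cov J J = 0"
proof -
  define \<kappa> where "\<kappa> = 2 * cov S1 S1 - cov J J"
  have "\<bar>\<kappa>\<bar> \<le> 0"
  proof (rule field_le_epsilon)
    fix e :: real assume e: "e > 0"
    \<comment> \<open>Makes \<open>c * (2 * exp 1 * K)\<close> equal to \<open>e / 4\<close>, where
      \<open>2 * exp 1 * K\<close> is the bound \<open>EY2\<close>.\<close>
    define c where "c = e / (8 * exp 1 * K)"
    have c: "c > 0" using K_ge_1 e by (simp add: c_def)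
    define K'' where "K'' = 8 * K\<^sup>2 * exp 1 + K"
    have K'': "K'' > 0" using K_ge_1 by (simp add: K''_def add_nonneg_pos)
    have e4: "e / 4 > 0" "c * (e / 4) > 0" using e c by auto
    obtain N where N: "\<And>n. n \<ge> N \<Longrightarrow> prob {\<omega>\<in>space M.
      norm (\<Sum>i<n. (F (mesh 0 1 n (Suc i)) \<omega> - F (mesh 0 1 n i) \<omega>) **
        (B (mesh 0 1 n (Suc i)) \<omega> - B (mesh 0 1 n i) \<omega>)) > e / 4} < c * (e / 4)"
      by (rule quadratic_variation_limit[OF e4]) blast
    obtain N1 :: nat where N1: "4 * K'' / e < real N1" using reals_Archimedean2 by blast
    define k where "k = max 1 (max N N1)"
    \<comment> \<open>With a square number of steps the step length is \<open>h * h\<close> for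
      \<open>h = 1 / k\<close>, as \<open>young\<close> with weight \<open>h\<close> requires;
      \<open>k\<close> is large enough for \<open>n \<ge> N\<close> and for
      \<open>hK\<close>.\<close>
    define n where "n = k * k"
    have k: "k \<ge> 1" "k \<ge> N1" and n: "n \<ge> 1" "n \<ge> N"
      by (auto simp: k_def n_def) (metis le_square max.coboundedI1 max.cobounded2 order_trans max_def)
    define h where "h = 1 / real k"
    have h: "0 < h" "h \<le> 1" "h * h = 1 / real n" using k by (auto simp: h_def n_def)
    have hK: "K'' * h < e / 4"
    proof -
      have "4 * K'' / e < real k" using N1 k by linarith
      then show ?thesis using e k by (simp add: h_def field_simps)
    qed
    let ?p = "mesh 0 1 n"
    have p: "0 \<le> ?p i" "?p i \<le> ?p (Suc i)" "?p (Suc i) - ?p i = h * h" for i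
      using mesh_mono[of 0 1 n i] mesh_ge[of 0 1 n i] by (auto simp: mesh_Suc h)
    have p1: "?p i \<le> 1" if "i \<le> n" for i using mesh_le[of 0 1 i n] that by simp
    define b where "b = (\<lambda>i \<omega>. B (?p (Suc i)) \<omega> - B (?p i) \<omega>)"
    have [measurable]: "b i \<in> borel_measurable M" for i unfolding b_def using p by measurable
    define r where "r = (\<lambda>i. remainder (?p i) (?p (Suc i)))"
    have [measurable]: "r i \<in> borel_measurable M" for i unfolding r_def using p by measurable
    have [measurable]: "F (?p i) \<in> borel_measurable M" for i using p by measurable
    define f where "f = (\<lambda>i \<omega>. F (?p i) \<omega> $ 1 $ 1)"
    have fm: "f i \<in> borel_measurable (FF (?p i))" for i unfolding f_def using F_adapted[OF p(1)] by measurable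
    have [measurable]: "f i \<in> borel_measurable M" for i unfolding f_def by measurable
    have f2: "integrable M (\<lambda>\<omega>. (f i \<omega>)\<^sup>2)" "i \<le> n \<Longrightarrow> expectation (\<lambda>\<omega>. (f i \<omega>)\<^sup>2) \<le> 2 * exp 1" for i
    proof -
      have le: "(f i \<omega>)\<^sup>2 \<le> (norm (F (?p i) \<omega>))\<^sup>2" for \<omega>
        unfolding f_def using abs_nth_22_le[of "F (?p i) \<omega>" 1 1] by (simp add: abs_le_square_iff[symmetric])
      show 1: "integrable M (\<lambda>\<omega>. (f i \<omega>)\<^sup>2)"
        by (rule integrable_dominated[OF F_norm_moment(1)[OF p(1)[of i]]]) (use le in auto)
      show "expectation (\<lambda>\<omega>. (f i \<omega>)\<^sup>2) \<le> 2 * exp 1" if "i \<le> n"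
        using integral_mono[OF 1 F_norm_moment(1)[OF p(1)[of i]] le] p1[OF that] F_norm_moment(2)[OF p(1)[of i]]
          exp_le_cancel_iff[of "?p i" 1] by linarith
    qed
    \<comment> \<open>\<open>Z\<close> is the full sum of \<open>dF dB\<close>, small in
      probability. Its upper left entry is \<open>Y\<close>, where \<open>dF\<close> is replaced by
      the Euler step \<open>F dB\<close>, plus remainder terms dominated by \<open>W\<close>. The
      mean of \<open>Y\<close> is exactly \<open>\<kappa>\<close>, since \<open>f i\<close> has mean
      one and the steps add up to one.\<close>
    define Y where "Y = (\<lambda>\<omega>. \<Sum>i<n. f i \<omega> * sq_coeff (b i \<omega>))"
    define Z where "Z = (\<lambda>\<omega>. \<Sum>i<n. (F (?p (Suc i)) \<omega> - F (?p i) \<omega>) ** b i \<omega>)"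
    define W where "W = (\<lambda>\<omega>. \<Sum>i<n. (norm (r i \<omega>))\<^sup>2 / h + h * (norm (b i \<omega>))\<^sup>2)"
    have [measurable]: "Y \<in> borel_measurable M" "Z \<in> borel_measurable M" "W \<in> borel_measurable M"
      unfolding Y_def Z_def W_def by measurable
    have b2: "integrable M (\<lambda>\<omega>. (norm (b i \<omega>))\<^sup>2)" "expectation (\<lambda>\<omega>. (norm (b i \<omega>))\<^sup>2) \<le> K * (h * h)" for i
      unfolding b_def using norm_increment_integrable[OF p(1,2)] increment_norm_moment_le[OF p(1,2), of 1] by (auto simp: p)
    have r2: "integrable M (\<lambda>\<omega>. (norm (r i \<omega>))\<^sup>2)" "i < n \<Longrightarrow> expectation (\<lambda>\<omega>. (norm (r i \<omega>))\<^sup>2) \<le> 8 * K\<^sup>2 * exp 1 * (h * h)\<^sup>2" for i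
    proof -
      show "integrable M (\<lambda>\<omega>. (norm (r i \<omega>))\<^sup>2)" unfolding r_def by (rule remainder_bound(1)[OF p(1,2)])
      assume "i < n"
      then have "exp (?p (Suc i)) \<le> exp 1" using p1[of "Suc i"] by simp
      then have "8 * K\<^sup>2 * exp (?p (Suc i)) * (h * h)\<^sup>2 \<le> 8 * K\<^sup>2 * exp 1 * (h * h)\<^sup>2"
        by (intro mult_right_mono mult_left_mono) auto
      then show "expectation (\<lambda>\<omega>. (norm (r i \<omega>))\<^sup>2) \<le> 8 * K\<^sup>2 * exp 1 * (h * h)\<^sup>2"
        using remainder_bound(2)[OF p(1,2), of i] unfolding r_def p(3) by linarith
    qed
    have W: "integrable M W" unfolding W_def using r2 b2 by auto
    have EW: "expectation W < e / 4"
    proof -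
      have "expectation W = (\<Sum>i<n. expectation (\<lambda>\<omega>. (norm (r i \<omega>))\<^sup>2) / h + h * expectation (\<lambda>\<omega>. (norm (b i \<omega>))\<^sup>2))"
        unfolding W_def using r2 b2 by (subst Bochner_Integration.integral_sum) auto
      also have "\<dots> \<le> (\<Sum>i<n. 8 * K\<^sup>2 * exp 1 * (h * h)\<^sup>2 / h + h * (K * (h * h)))"
        using r2 b2 h by (intro sum_mono add_mono divide_right_mono mult_left_mono) auto
      also have "\<dots> = real n * (h * h) * (K'' * h)"
        using h(1) by (simp add: K''_def power2_eq_square algebra_simps)
      also have "\<dots> = K'' * h" using n by (simp add: h)
      finally show ?thesis using hK by linarith
    qed
    have YZ: "norm (Y \<omega>) \<le> norm (Z \<omega>) + W \<omega>" if \<omega>: "\<omega> \<in> space M" for \<omega>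
    proof -
      have "((F (?p (Suc i)) \<omega> - F (?p i) \<omega>) ** b i \<omega>) $ 1 $ 1 = f i \<omega> * sq_coeff (b i \<omega>) + (r i \<omega> ** b i \<omega>) $ 1 $ 1" for i
      proof -
        have "b i \<omega> $ 2 $ 2 = - (b i \<omega> $ 1 $ 1)" unfolding b_def by (rule increment_trace[OF p(1,2) \<omega>])
        moreover have "F (?p (Suc i)) \<omega> - F (?p i) \<omega> = r i \<omega> + F (?p i) \<omega> ** b i \<omega>"
          unfolding r_def remainder_def b_def by simp
        ultimately show ?thesis by (simp add: f_def sq_coeff_def matrix_mult_22 algebra_simps)
      qed
      then have "Y \<omega> = Z \<omega> $ 1 $ 1 - (\<Sum>i<n. (r i \<omega> ** b i \<omega>) $ 1 $ 1)"
        by (simp add: Y_def Z_def sum.distrib)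
      then have "norm (Y \<omega>) \<le> \<bar>Z \<omega> $ 1 $ 1\<bar> + \<bar>\<Sum>i<n. (r i \<omega> ** b i \<omega>) $ 1 $ 1\<bar>" by simp
      also have "\<bar>Z \<omega> $ 1 $ 1\<bar> \<le> norm (Z \<omega>)" by (rule abs_nth_22_le)
      also have "\<bar>\<Sum>i<n. (r i \<omega> ** b i \<omega>) $ 1 $ 1\<bar> \<le> W \<omega>"
        unfolding W_def
      proof (rule order_trans[OF sum_abs], rule sum_mono)
        fix i
        have "\<bar>(r i \<omega> ** b i \<omega>) $ 1 $ 1\<bar> \<le> norm (r i \<omega>) * norm (b i \<omega>)"
          using abs_nth_22_le norm_matrix_mult_22 order_trans by blast
        also have "\<dots> \<le> (norm (r i \<omega>))\<^sup>2 / h + h * (norm (b i \<omega>))\<^sup>2"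
          using young[OF h(1), of "norm (r i \<omega>)" "norm (b i \<omega>)"] mult_nonneg_nonneg[OF norm_ge_zero norm_ge_zero, of "r i \<omega>" "b i \<omega>"]
          by linarith
        finally show "\<bar>(r i \<omega> ** b i \<omega>) $ 1 $ 1\<bar> \<le> (norm (r i \<omega>))\<^sup>2 / h + h * (norm (b i \<omega>))\<^sup>2" .
      qed
      finally show ?thesis by simp
    qed
    have Y1: "integrable M (\<lambda>\<omega>. f i \<omega> * sq_coeff (b i \<omega>))" "expectation (\<lambda>\<omega>. f i \<omega> * sq_coeff (b i \<omega>)) = (h * h) * \<kappa>" for i
    proof -
      have fi: "integrable M (f i)" "expectation (f i) = 1"
        unfolding f_def using E_F[OF p(1)] by (simp_all add: mat_def)
      note ind = indep_increment[OF p(1,2) fm fi(1) sq_coeff_measurable sq_coeff_increment(1)[OF p(1,2)]]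
      show "integrable M (\<lambda>\<omega>. f i \<omega> * sq_coeff (b i \<omega>))" "expectation (\<lambda>\<omega>. f i \<omega> * sq_coeff (b i \<omega>)) = (h * h) * \<kappa>"
        unfolding b_def \<kappa>_def using ind sq_coeff_increment(2)[OF p(1,2), of i] fi(2) by (simp_all add: p(3))
    qed
    have EY: "expectation Y = \<kappa>"
    proof -
      have "expectation Y = (\<Sum>i<n. (h * h) * \<kappa>)"
        unfolding Y_def using Y1 by (subst Bochner_Integration.integral_sum) auto
      then show ?thesis using n by (simp add: h)
    qed
    have iY: "integrable M Y" unfolding Y_def using Y1 by auto
    have Y2: "integrable M (\<lambda>\<omega>. (f i \<omega>)\<^sup>2 * (sq_coeff (b i \<omega>))\<^sup>2)"
      "i < n \<Longrightarrow> expectation (\<lambda>\<omega>. (f i \<omega>)\<^sup>2 * (sq_coeff (b i \<omega>))\<^sup>2) \<le> 2 * exp 1 * (K * (h * h)\<^sup>2)" for i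
    proof -
      have m2: "(\<lambda>\<omega>. (f i \<omega>)\<^sup>2) \<in> borel_measurable (FF (?p i))" using fm by measurable
      have ms: "(\<lambda>A. (sq_coeff A)\<^sup>2) \<in> borel_measurable borel" by measurable
      note ind = indep_increment[OF p(1,2) m2 f2(1) ms sq_coeff_increment(3)[OF p(1,2)]]
      show "integrable M (\<lambda>\<omega>. (f i \<omega>)\<^sup>2 * (sq_coeff (b i \<omega>))\<^sup>2)"
        unfolding b_def using ind(1) by simp
      assume "i < n"
      have "expectation (\<lambda>\<omega>. (f i \<omega>)\<^sup>2 * (sq_coeff (b i \<omega>))\<^sup>2) = expectation (\<lambda>\<omega>. (f i \<omega>)\<^sup>2) * expectation (\<lambda>\<omega>. (sq_coeff (b i \<omega>))\<^sup>2)"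
        unfolding b_def using ind(2) by simp
      also have "\<dots> \<le> 2 * exp 1 * (K * (h * h)\<^sup>2)"
        using f2(2)[of i] sq_coeff_increment(4)[OF p(1,2), of i] \<open>i < n\<close> unfolding p(3) b_def by (intro mult_mono) auto
      finally show "expectation (\<lambda>\<omega>. (f i \<omega>)\<^sup>2 * (sq_coeff (b i \<omega>))\<^sup>2) \<le> 2 * exp 1 * (K * (h * h)\<^sup>2)" .
    qed
    \<comment> \<open>The crude factor \<open>n\<close> is affordable: each of the \<open>n\<close>
      squares has mean of order \<open>(h * h)\<^sup>2 = 1 / n\<^sup>2\<close>.\<close>
    have Y2le: "(norm (Y \<omega>))\<^sup>2 \<le> real n * (\<Sum>i<n. (f i \<omega>)\<^sup>2 * (sq_coeff (b i \<omega>))\<^sup>2)" for \<omega>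
      unfolding Y_def using sum_square_le[of "\<lambda>i. f i \<omega> * sq_coeff (b i \<omega>)" n] by (simp add: power_mult_distrib)
    have iYb: "integrable M (\<lambda>\<omega>. real n * (\<Sum>i<n. (f i \<omega>)\<^sup>2 * (sq_coeff (b i \<omega>))\<^sup>2))"
      using Y2(1) by (intro integrable_mult_right Bochner_Integration.integrable_sum) auto
    have iY2: "integrable M (\<lambda>\<omega>. (norm (Y \<omega>))\<^sup>2)"
      by (rule integrable_dominated[OF iYb])
        (use Y2le in \<open>auto intro!: AE_I2 intro: order_trans[OF _ abs_ge_self]\<close>)
    have "expectation (\<lambda>\<omega>. (norm (Y \<omega>))\<^sup>2) \<le> expectation (\<lambda>\<omega>. real n * (\<Sum>i<n. (f i \<omega>)\<^sup>2 * (sq_coeff (b i \<omega>))\<^sup>2))"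
      by (rule integral_mono[OF iY2 iYb Y2le])
    also have "\<dots> = real n * (\<Sum>i<n. expectation (\<lambda>\<omega>. (f i \<omega>)\<^sup>2 * (sq_coeff (b i \<omega>))\<^sup>2))"
      using Y2(1) by (simp add: Bochner_Integration.integral_sum)
    also have "\<dots> \<le> real n * (\<Sum>i<n. 2 * exp 1 * (K * (h * h)\<^sup>2))"
      using Y2(2) by (intro mult_left_mono sum_mono) auto
    also have "\<dots> = 2 * exp 1 * K" using n by (simp add: h power2_eq_square)
    finally have EY2: "expectation (\<lambda>\<omega>. (norm (Y \<omega>))\<^sup>2) \<le> 2 * exp 1 * K" .
    have W0: "W \<omega> \<ge> 0" for \<omega> unfolding W_def using h by (intro sum_nonneg) auto
    have PZ: "prob {\<omega>\<in>space M. norm (Z \<omega>) > e / 4} \<le> c * (e / 4)"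
      using N[OF n(2)] unfolding Z_def b_def by simp
    have "\<bar>\<kappa>\<bar> \<le> expectation (\<lambda>\<omega>. norm (Y \<omega>))"
      using integral_norm_bound[of M Y] EY by simp
    also have "\<dots> \<le> e / 4 + expectation W + c * expectation (\<lambda>\<omega>. (norm (Y \<omega>))\<^sup>2)
           + prob {\<omega>\<in>space M. norm (Z \<omega>) > e / 4} / c"
      by (rule expectation_near) (use iY2 W YZ W0 c e in auto)
    also have "\<dots> \<le> e / 4 + e / 4 + c * (2 * exp 1 * K) + (c * (e / 4)) / c"
      using EW EY2 PZ c by (intro add_mono mult_left_mono divide_right_mono) auto
    also have "\<dots> \<le> 0 + e"
    proof -
      have "c * (2 * exp 1 * K) = e / 4" using K_ge_1 by (simp add: c_def)
      moreover have "(c * (e / 4)) / c = e / 4" using c by simp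
      ultimately show ?thesis by simp
    qed
    finally show "\<bar>\<kappa>\<bar> \<le> 0 + e" .
  qed
  then show ?thesis by (simp add: \<kappa>_def)
qed

lemma cov_values: "cov S1 S1 = 1/4" "cov S2 S2 = 1/4" "cov J J = 1/2"
  using cov_normalized cov_ito_correction cov_cross(4) by auto

end

subsection \<open>Complex powers of the length of a row\<close>

text \<open>Complex Taylor expansion at 1 along a real interval: derivatives of a power are falling
  factorials times powers, whose modulus depends only on the real part of \<open>b\<close>.
  \<open>I\<close> is a parameter because \<open>C\<close> differs on \<open>{1..}\<close>,
  \<open>{0<..}\<close> and \<open>{1/2..}\<close>.\<close>

lemma powr_Taylor:
  fixes b :: complex and I :: "real set"
  assumes I: "convex I" "\<And>x. x \<in> I \<Longrightarrow> x > 0" "1 \<in> I" "u \<in> I"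
    and bound: "\<And>x. x \<in> I \<Longrightarrow> x powr (Re b - real (Suc n)) \<le> C"
  shows "norm (of_real u powr b - (\<Sum>i\<le>n. (\<Prod>j<i. b - of_nat j) * of_real (u - 1) ^ i / fact i))
    \<le> norm (\<Prod>j<Suc n. b - of_nat j) * C * \<bar>u - 1\<bar> ^ Suc n"
proof -
  define f where "f = (\<lambda>i z. (\<Prod>j<i. b - of_nat j) * z powr (b - of_nat i))"
  let ?S = "complex_of_real ` I"
  let ?c = "norm (\<Prod>j<Suc n. b - of_nat j)"
  have "norm (f 0 (of_real u) - (\<Sum>i\<le>n. f i 1 * (of_real u - 1) ^ i / fact i)) \<le> ?c * C * norm (complex_of_real u - 1) ^ Suc n / fact n"
  proof (rule complex_Taylor)
    show "convex ?S" by (rule convex_linear_image[OF _ I(1)]) (auto intro: linearI simp: scaleR_conv_of_real)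
    fix i x assume x: "x \<in> ?S"
    then obtain y where y: "x = of_real y" "y > 0" "y \<in> I" using I(2) by auto
    then have "x \<notin> \<real>\<^sub>\<le>\<^sub>0" by simp
    note has_field_derivative_powr[OF this, of "b - of_nat i"]
    from has_field_derivative_at_within[OF DERIV_cmult[OF this, of "\<Prod>j<i. b - of_nat j"]]
    show "(f i has_field_derivative f (Suc i) x) (at x within ?S)"
      by (simp add: f_def algebra_simps)
  next
    fix x assume x: "x \<in> ?S"
    then obtain y where y: "x = of_real y" "y > 0" "y \<in> I" using I(2) by auto
    have "norm (f (Suc n) x) = ?c * norm (x powr (b - of_nat (Suc n)))"
      unfolding f_def norm_mult ..
    also have "norm (x powr (b - of_nat (Suc n))) = y powr (Re b - real (Suc n))"
      using y by (simp add: norm_powr_real_powr)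
    also have "?c * \<dots> \<le> ?c * C" using bound[OF y(3)] by (intro mult_left_mono) auto
    finally show "norm (f (Suc n) x) \<le> ?c * C" .
  qed (use I in auto)
  also have "\<dots> \<le> ?c * C * norm (complex_of_real u - 1) ^ Suc n"
  proof -
    have "0 \<le> 1 powr (Re b - real (Suc n))" by simp
    also have "\<dots> \<le> C" using bound[OF I(3)] .
    finally have "0 \<le> ?c * C * norm (complex_of_real u - 1) ^ Suc n" by simp
    moreover have "1 \<le> (fact n :: real)" by simp
    ultimately show ?thesis by (simp add: divide_le_eq mult_le_cancel_left1 not_less)
  qed
  finally show ?thesis
    using of_real_diff[of u 1, symmetric, where 'a=complex] by (simp add: f_def flip: of_real_diff)
qed

lemma powr_of_real_mult:
  "r \<ge> 0 \<Longrightarrow> s \<ge> 0 \<Longrightarrow> complex_of_real (r * s) powr b = of_real r powr b * of_real s powr b"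
  unfolding of_real_mult by (rule powr_times_real) auto

context
  fixes \<xi> :: real
begin

definition cexpo :: complex ("\<aa>") where "\<aa> = 1 + \<i> * of_real \<xi>"

text \<open>The factor of modulus one in \<open>|x|^(2a)\<close>, which is \<open>twist\<close>.
  Since \<open>0 powr z = 0\<close>, it vanishes at the origin, and every estimate below has to hold
  uniformly up to this discontinuity.\<close>

definition phase :: "real^2 \<Rightarrow> complex" where
  "phase x = of_real ((norm x)\<^sup>2) powr (\<i> * of_real \<xi>)"

definition twist :: "real^2 \<Rightarrow> complex" where
  "twist x = of_real ((norm x)\<^sup>2) * phase x"

lemma norm_phase: "norm (phase x) \<le> 1"
  by (cases "x = 0") (auto simp: phase_def norm_powr_real_powr)

lemma phase_0 [simp]: "phase 0 = 0" and twist_0 [simp]: "twist 0 = 0"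
  by (simp_all add: phase_def twist_def)

lemma norm_twist: "norm (twist x) \<le> (norm x)\<^sup>2"
  using norm_phase[of x] by (simp add: twist_def norm_mult mult_left_le norm_power)

lemma powr_square: "(of_real (u\<^sup>2) :: complex) powr b = of_real u powr (2 * b)" if "u \<ge> 0" for u b
proof (cases "u = 0")
  case False
  with that have u: "u > 0" by simp
  then have "Ln (of_real (u\<^sup>2)) = 2 * Ln (of_real u)"
    by (simp add: Ln_of_real ln_realpow del: of_real_power)
  with u show ?thesis by (simp add: powr_def algebra_simps del: of_real_power)
qed simp

lemma phase_scale:
  assumes y: "y \<noteq> 0"
  shows "phase x = phase y * of_real (norm x / norm y) powr (2 * (\<i> * of_real \<xi>))"
proof -
  have "(norm x)\<^sup>2 = (norm y)\<^sup>2 * (norm x / norm y)\<^sup>2" using y by (simp add: power_divide)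
  then show ?thesis
    unfolding phase_def using powr_of_real_mult[of "(norm y)\<^sup>2" "(norm x / norm y)\<^sup>2"] powr_square[of "norm x / norm y"]
    by (metis divide_nonneg_nonneg norm_ge_zero zero_le_power2)
qed

text \<open>Homogeneity reduces expansions about any nonzero \<open>y\<close> to a power of one
  positive variable at 1. The ratio of squared lengths serves the Euler step, the ratio of lengths
  the small perturbation in \<open>twist_expand\<close>.\<close>

lemma twist_scale:
  assumes y: "y \<noteq> 0"
  shows "twist x = twist y * of_real ((norm x)\<^sup>2 / (norm y)\<^sup>2) powr \<aa>"
    "twist x = twist y * of_real (norm x / norm y) powr (2 * \<aa>)"
proof -
  show 1: "twist x = twist y * of_real ((norm x)\<^sup>2 / (norm y)\<^sup>2) powr \<aa>"
  proof (cases "x = 0")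
    case False
    have t: "twist z = of_real ((norm z)\<^sup>2) powr \<aa>" if "z \<noteq> 0" for z
      using that by (simp add: twist_def phase_def cexpo_def powr_add)
    have "(norm x)\<^sup>2 = (norm y)\<^sup>2 * ((norm x)\<^sup>2 / (norm y)\<^sup>2)" using y by simp
    then show ?thesis unfolding t[OF False] t[OF y]
      using powr_of_real_mult[of "(norm y)\<^sup>2" "(norm x)\<^sup>2 / (norm y)\<^sup>2" \<aa>]
      by (metis divide_nonneg_nonneg zero_le_power2)
  qed simp
  show "twist x = twist y * of_real (norm x / norm y) powr (2 * \<aa>)"
    unfolding 1 power_divide[symmetric] by (subst powr_square) auto
qed

text \<open>With \<open>u\<close> the ratio of the lengths, the phase changes by at most a multiple
  of \<open>u - 1\<close>, and the factor \<open>norm y\<close> from \<open>y \<bullet> v\<close>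
  turns this into \<open>norm x - norm y\<close>. Ordering the lengths gives
  \<open>u \<ge> 1\<close>, where the derivative of the power is bounded.\<close>

lemma phase_Lipschitz_aux:
  assumes "norm y \<le> norm x"
  shows "norm ((phase x - phase y) * of_real (y \<bullet> v)) \<le> 2 * \<bar>\<xi>\<bar> * norm (x - y) * norm v"
proof (cases "y = 0")
  case False
  define u where "u = norm x / norm y"
  have u: "u \<ge> 1" using assms False by (simp add: u_def)
  have "norm (complex_of_real u powr (2 * (\<i> * of_real \<xi>)) - (\<Sum>i\<le>0. (\<Prod>j<i. 2 * (\<i> * of_real \<xi>) - of_nat j) * of_real (u - 1) ^ i / fact i))
      \<le> norm (\<Prod>j<Suc 0. 2 * (\<i> * of_real \<xi>) - of_nat j) * 1 * \<bar>u - 1\<bar> ^ Suc 0"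
    by (rule powr_Taylor[of "{1..}"]) (use u in \<open>auto simp: powr_minus_divide powr_minus field_simps\<close>)
  then have le: "norm (complex_of_real u powr (2 * (\<i> * of_real \<xi>)) - 1) \<le> 2 * \<bar>\<xi>\<bar> * (u - 1)"
    using u by (simp add: norm_mult)
  have "norm (phase x - phase y) = norm (phase y) * norm (complex_of_real u powr (2 * (\<i> * of_real \<xi>)) - 1)"
    unfolding phase_scale[OF False, of x] u_def norm_mult[symmetric] by (simp add: algebra_simps)
  also have "\<dots> \<le> 1 * (2 * \<bar>\<xi>\<bar> * (u - 1))" using norm_phase[of y] le by (intro mult_mono) auto
  finally have "norm (phase x - phase y) \<le> 2 * \<bar>\<xi>\<bar> * (u - 1)" by simp
  then have "norm ((phase x - phase y) * of_real (y \<bullet> v)) \<le> (2 * \<bar>\<xi>\<bar> * (u - 1)) * (norm y * norm v)"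
    unfolding norm_mult using Cauchy_Schwarz_ineq2[of y v] u by (intro mult_mono) auto
  also have "\<dots> = 2 * \<bar>\<xi>\<bar> * (norm x - norm y) * norm v" using False by (simp add: u_def field_simps)
  also have "\<dots> \<le> 2 * \<bar>\<xi>\<bar> * norm (x - y) * norm v"
    using norm_triangle_ineq2[of x y] by (intro mult_right_mono mult_left_mono) auto
  finally show ?thesis .
qed simp

text \<open>Up to the factor \<open>2 * \<aa>\<close> the compared terms are derivatives of
  \<open>twist\<close> in direction \<open>v\<close>. They are Lipschitz in the base point although
  \<open>phase\<close> is discontinuous at the origin.\<close>

lemma phase_Lipschitz:
  "norm (phase x * of_real (x \<bullet> v) - phase y * of_real (y \<bullet> v)) \<le> (1 + 2 * \<bar>\<xi>\<bar>) * norm (x - y) * norm v"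
proof -
  have *: "norm (phase x * of_real (x \<bullet> v) - phase y * of_real (y \<bullet> v)) \<le> (1 + 2 * \<bar>\<xi>\<bar>) * norm (x - y) * norm v"
    if "norm y \<le> norm x" for x y
  proof -
    have "phase x * of_real (x \<bullet> v) - phase y * of_real (y \<bullet> v) = phase x * of_real ((x - y) \<bullet> v) + (phase x - phase y) * of_real (y \<bullet> v)"
      by (simp add: inner_diff_left algebra_simps)
    also have "norm \<dots> \<le> norm (x - y) * norm v + 2 * \<bar>\<xi>\<bar> * norm (x - y) * norm v"
    proof (rule norm_triangle_mono[OF _ phase_Lipschitz_aux[OF that]])
      show "norm (phase x * of_real ((x - y) \<bullet> v)) \<le> norm (x - y) * norm v"
        using norm_phase[of x] Cauchy_Schwarz_ineq2[of "x - y" v] mult_mono[of "norm (phase x)" 1 "\<bar>(x - y) \<bullet> v\<bar>" "norm (x - y) * norm v"]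
        by (simp add: norm_mult)
    qed
    finally show ?thesis by (simp add: algebra_simps)
  qed
  show ?thesis
    using *[of y x] *[of x y] by (cases "norm y \<le> norm x") (simp_all add: norm_minus_commute)
qed

text \<open>An error quadratic in \<open>e\<close>, uniformly in \<open>y\<close>, because
  \<open>twist\<close> is homogeneous of degree two in modulus. The change of length is handled by
  Taylor's formula; replacing \<open>(norm y)\<^sup>2 * (u - 1)\<close> by
  \<open>y \<bullet> e\<close> costs at most half of \<open>(norm e)\<^sup>2\<close>.\<close>

lemma twist_expand:
  "norm (twist (y + e) - twist y - 2 * \<aa> * (phase y * of_real (y \<bullet> e))) \<le> (norm (2 * \<aa> * (2 * \<aa> - 1)) + 2 * norm \<aa> + 1) * (norm e)\<^sup>2"
proof (cases "y = 0")
  case True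
  then show ?thesis using norm_twist[of e] mult_right_mono[of 1 "norm (2 * \<aa> * (2 * \<aa> - 1)) + 2 * norm \<aa> + 1" "(norm e)\<^sup>2"]
    by simp
next
  case False
  define u where "u = norm (y + e) / norm y"
  have u: "u \<ge> 0" by (simp add: u_def)
  define c where "c = norm (2 * \<aa> * (2 * \<aa> - 1))"
  have Re: "Re \<aa> = 1" by (simp add: cexpo_def)
  have T: "norm (complex_of_real u powr (2 * \<aa>) - 1 - 2 * \<aa> * of_real (u - 1)) \<le> (c + norm \<aa> + 1) * (u - 1)\<^sup>2"
  \<comment> \<open>At \<open>y + e = 0\<close> Taylor's formula on the positive half-line does not
    apply. The left side is then \<open>norm (2 * \<aa> - 1)\<close>, which is at most
    \<open>c\<close> because \<open>\<aa>\<close> has modulus at least one.\<close>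
  proof (cases "u = 0")
    case True
    then show ?thesis
    proof -
      have "1 \<le> norm (2 * \<aa> - 1)" using complex_Re_le_cmod[of "2 * \<aa> - 1"] Re by simp
      moreover have "1 \<le> norm \<aa>" using complex_Re_le_cmod[of \<aa>] Re by simp
      ultimately have "norm (2 * \<aa> - 1) \<le> c"
        unfolding c_def norm_mult by (simp add: mult_le_cancel_right1)
      moreover have "- 1 - 2 * \<aa> * of_real (0 - 1) = 2 * \<aa> - 1" by simp
      ultimately show ?thesis using True by simp (smt (verit) norm_ge_zero)
    qed
  next
    case False
    with u have u0: "u > 0" by simp
    have "norm (complex_of_real u powr (2 * \<aa>) - (\<Sum>i\<le>1. (\<Prod>j<i. 2 * \<aa> - of_nat j) * of_real (u - 1) ^ i / fact i))
      \<le> norm (\<Prod>j<Suc 1. 2 * \<aa> - of_nat j) * 1 * \<bar>u - 1\<bar> ^ Suc 1"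
      by (rule powr_Taylor[of "{0<..}"]) (use u0 in \<open>auto simp: Re\<close>)
    then have "norm (complex_of_real u powr (2 * \<aa>) - 1 - 2 * \<aa> * of_real (u - 1)) \<le> c * (u - 1)\<^sup>2"
      by (simp add: c_def algebra_simps power2_eq_square)
    also have "\<dots> \<le> (c + norm \<aa> + 1) * (u - 1)\<^sup>2" by (intro mult_right_mono) auto
    finally show ?thesis .
  qed
  have yu: "norm (y + e) = norm y * u" using False by (simp add: u_def)
  have "twist (y + e) = twist y * of_real u powr (2 * \<aa>)" unfolding u_def by (rule twist_scale(2)[OF False])
  then have "twist (y + e) - twist y - 2 * \<aa> * (phase y * of_real (y \<bullet> e)) =
      twist y * (of_real u powr (2 * \<aa>) - 1 - 2 * \<aa> * of_real (u - 1)) + 2 * \<aa> * phase y * of_real ((norm y)\<^sup>2 * (u - 1) - y \<bullet> e)"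
    by (simp add: twist_def algebra_simps)
  also have "norm \<dots> \<le> (c + norm \<aa> + 1) * (norm e)\<^sup>2 + norm \<aa> * (norm e)\<^sup>2"
  proof (rule norm_triangle_mono)
    have "norm (twist y * (of_real u powr (2 * \<aa>) - 1 - 2 * \<aa> * of_real (u - 1))) \<le> (norm y)\<^sup>2 * ((c + norm \<aa> + 1) * (u - 1)\<^sup>2)"
      unfolding norm_mult using norm_twist[of y] T by (intro mult_mono) auto
    also have "\<dots> = (c + norm \<aa> + 1) * (norm (y + e) - norm y)\<^sup>2"
      unfolding yu by (simp add: power2_eq_square algebra_simps)
    also have "\<dots> \<le> (c + norm \<aa> + 1) * (norm e)\<^sup>2"
    proof (rule mult_left_mono)
      have "\<bar>norm (y + e) - norm y\<bar> \<le> norm e" using norm_triangle_ineq3[of "y + e" y] by simp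
      then show "(norm (y + e) - norm y)\<^sup>2 \<le> (norm e)\<^sup>2" by (simp add: abs_le_square_iff[symmetric])
      show "0 \<le> c + norm \<aa> + 1" by (simp add: c_def)
    qed
    finally show "norm (twist y * (of_real u powr (2 * \<aa>) - 1 - 2 * \<aa> * of_real (u - 1))) \<le> (c + norm \<aa> + 1) * (norm e)\<^sup>2" .
    \<comment> \<open>The right side is nonnegative by Cauchy-Schwarz; the bound on twice its value
      combines the inequality of arithmetic and geometric means with the expansion of
      \<open>(norm e)\<^sup>2\<close>.\<close>
    have eq: "(norm y)\<^sup>2 * (u - 1) - y \<bullet> e = norm y * norm (y + e) - y \<bullet> (y + e)"
      unfolding yu by (simp add: power2_eq_square algebra_simps inner_add_right dot_square_norm)
    have "y \<bullet> (y + e) \<le> norm y * norm (y + e)" using Cauchy_Schwarz_ineq2[of y "y + e"] by simp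
    moreover have "2 * (norm y * norm (y + e)) \<le> (norm y)\<^sup>2 + (norm (y + e))\<^sup>2"
      using sum_squares_bound[of "norm y" "norm (y + e)"] by simp
    moreover have "(norm y)\<^sup>2 + (norm (y + e))\<^sup>2 = 2 * (y \<bullet> (y + e)) + (norm e)\<^sup>2"
      unfolding power2_norm_eq_inner by (simp add: inner_add_left inner_add_right inner_commute)
    moreover have "2 * \<bar>n - p\<bar> \<le> E" if "p \<le> n" "2 * n \<le> s" "s = 2 * p + E" for n p s E :: real
      using that by (simp add: abs_if)
    ultimately have "2 * \<bar>(norm y)\<^sup>2 * (u - 1) - y \<bullet> e\<bar> \<le> (norm e)\<^sup>2" unfolding eq by blast
    then have "(2 * \<bar>(norm y)\<^sup>2 * (u - 1) - y \<bullet> e\<bar>) * (norm \<aa> * norm (phase y)) \<le> (norm e)\<^sup>2 * (norm \<aa> * 1)"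
      using norm_phase[of y] by (intro mult_mono mult_left_mono) auto
    then show "norm (2 * \<aa> * phase y * of_real ((norm y)\<^sup>2 * (u - 1) - y \<bullet> e)) \<le> norm \<aa> * (norm e)\<^sup>2"
      unfolding norm_mult norm_of_real by (simp add: mult_ac)
  qed
  finally show ?thesis by (simp add: c_def algebra_simps)
qed

text \<open>For \<open>z \<ge> -1/2\<close> this is Taylor's formula, the factor 4 bounding
  \<open>x powr (-2)\<close> on \<open>{1/2..}\<close>. For smaller \<open>z\<close> all terms are
  bounded, and \<open>\<bar>z\<bar> ^ 3 \<ge> 1/8\<close> accounts for the factor 8.\<close>

lemma powr_expand:
  obtains C where "C \<ge> 0" "\<And>z. z \<ge> -1 \<Longrightarrow> norm (of_real (1 + z) powr \<aa> - 1 - \<aa> * of_real z - \<aa> * (\<aa> - 1) / 2 * of_real (z\<^sup>2)) \<le> C * \<bar>z\<bar> ^ 3"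
proof -
  define c where "c = norm (\<aa> * (\<aa> - 1) * (\<aa> - 2))"
  define d where "d = 2 + norm \<aa> + norm (\<aa> * (\<aa> - 1) / 2)"
  have Re: "Re \<aa> = 1" by (simp add: cexpo_def)
  have cd: "c \<ge> 0" "d \<ge> 0" by (auto simp: c_def d_def)
  show thesis
  proof (rule that)
    show "0 \<le> 4 * c + 8 * d" using cd by simp
    fix z :: real assume z: "z \<ge> -1"
    let ?R = "of_real (1 + z) powr \<aa> - 1 - \<aa> * of_real z - \<aa> * (\<aa> - 1) / 2 * of_real (z\<^sup>2)"
    show "norm ?R \<le> (4 * c + 8 * d) * \<bar>z\<bar> ^ 3"
    proof (cases "z \<ge> -1/2")
      case True
      have *: "x powr (- 2) \<le> 4" if "x \<ge> 1/2" for x :: real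
        using powr_mono2'[of "-2" "1/2" x] that by (simp add: powr_minus powr_numeral power2_eq_square)
      have "norm (complex_of_real (1 + z) powr \<aa> - (\<Sum>i\<le>2. (\<Prod>j<i. \<aa> - of_nat j) * of_real ((1 + z) - 1) ^ i / fact i))
          \<le> norm (\<Prod>j<Suc 2. \<aa> - of_nat j) * 4 * \<bar>(1 + z) - 1\<bar> ^ Suc 2"
        by (rule powr_Taylor[of "{1/2..}"]) (use True * in \<open>auto simp: Re\<close>)
      then have "norm ?R \<le> 4 * c * \<bar>z\<bar> ^ 3"
        by (simp add: c_def numeral_2_eq_2 numeral_3_eq_3 algebra_simps)
      also have "\<dots> \<le> (4 * c + 8 * d) * \<bar>z\<bar> ^ 3" using cd by (intro mult_right_mono) auto
      finally show ?thesis .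
    next
      case False
      then have z1: "\<bar>z\<bar> \<le> 1" "\<bar>z\<bar> \<ge> 1/2" using z by auto
      have "norm (complex_of_real (1 + z) powr \<aa>) = 1 + z"
        using z Re norm_powr_real_powr[of "complex_of_real (1 + z)" \<aa>] by (simp del: of_real_add)
      then have 1: "norm (complex_of_real (1 + z) powr \<aa>) \<le> 1" using False by simp
      have 2: "norm (\<aa> * of_real z) \<le> norm \<aa>" using z1 by (simp add: norm_mult mult_left_le)
      have 3: "norm (\<aa> * (\<aa> - 1) / 2 * of_real (z\<^sup>2)) \<le> norm (\<aa> * (\<aa> - 1) / 2)"
      proof -
        have "z\<^sup>2 \<le> 1" using z1(1) abs_square_le_1 by blast
        then show ?thesis unfolding norm_mult[of _ "of_real (z\<^sup>2)"] norm_of_real by (intro mult_left_le) auto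
      qed
      have "norm ?R \<le> d"
        using 1 2 3 norm_triangle_ineq4[of "of_real (1 + z) powr \<aa> - 1 - \<aa> * of_real z" "\<aa> * (\<aa> - 1) / 2 * of_real (z\<^sup>2)"]
          norm_triangle_ineq4[of "of_real (1 + z) powr \<aa> - 1" "\<aa> * of_real z"] norm_triangle_ineq4[of "of_real (1 + z) powr \<aa>" 1]
        unfolding d_def norm_one by linarith
      also have "d = 8 * d * (1/2) ^ 3" by (simp add: power_numeral_reduce)
      also have "\<dots> \<le> 8 * d * \<bar>z\<bar> ^ 3" using z1 cd by (intro mult_left_mono power_mono) auto
      also have "\<dots> \<le> (4 * c + 8 * d) * \<bar>z\<bar> ^ 3" using cd by (intro mult_right_mono) auto
      finally show ?thesis .
    qed
  qed
qed

text \<open>The expansion of \<open>twist (x + x v* A)\<close> through second order in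
  \<open>A\<close>. The relative change of the squared length is \<open>z1 + z2\<close>, linear plus
  quadratic in \<open>A\<close>; in the second-order term only the square of \<open>z1\<close> is
  kept, the rest being of third order.\<close>

definition euler_twist :: "real^2 \<Rightarrow> real^2^2 \<Rightarrow> complex" where
  "euler_twist x A = twist x + \<aa> * phase x * of_real (2 * (x \<bullet> (x v* A)) + (norm (x v* A))\<^sup>2)
      + \<aa> * (\<aa> - 1) / 2 * phase x * of_real (4 * (x \<bullet> (x v* A))\<^sup>2 / (norm x)\<^sup>2)"

text \<open>The relative change of the squared length is at most \<open>2 * b + b\<^sup>2\<close>,
  with \<open>b = norm A\<close>. Its cube ranges over the powers 3 to 6 of \<open>b\<close>, which
  the two extreme powers dominate, for small and for large \<open>A\<close>.\<close>

lemma twist_mult_expand: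
  obtains C where "C \<ge> 0" "\<And>x A. norm (twist (x + x v* A) - euler_twist x A) \<le> C * (norm x)\<^sup>2 * (norm A ^ 3 + norm A ^ 6)"
proof -
  obtain C where C: "C \<ge> 0" "\<And>z. z \<ge> -1 \<Longrightarrow> norm (of_real (1 + z) powr \<aa> - 1 - \<aa> * of_real z - \<aa> * (\<aa> - 1) / 2 * of_real (z\<^sup>2)) \<le> C * \<bar>z\<bar> ^ 3"
    by (rule powr_expand) (rule that)
  define k where "k = norm (\<aa> * (\<aa> - 1) / 2)"
  show thesis
  proof (rule that)
    show "0 \<le> 32 * C + 5 * k" using C by (simp add: k_def)
    fix x :: "real^2" and A :: "real^2^2"
    define b where "b = norm A"
    have b0: "b \<ge> 0" by (simp add: b_def)
    let ?L = "twist (x + x v* A) - euler_twist x A"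
    show "norm ?L \<le> (32 * C + 5 * k) * (norm x)\<^sup>2 * (norm A ^ 3 + norm A ^ 6)"
    proof (cases "x = 0")
      case True
      then have "x v* A = 0" by (simp add: vec_eq_iff vector_matrix_mult_2)
      with True show ?thesis by (simp add: euler_twist_def)
    next
      case False
      define z1 where "z1 = 2 * (x \<bullet> (x v* A)) / (norm x)\<^sup>2"
      define z2 where "z2 = (norm (x v* A))\<^sup>2 / (norm x)\<^sup>2"
      define z where "z = z1 + z2"
      have n0: "(norm x)\<^sup>2 > 0" using False by simp
      have nxA: "norm (x v* A) \<le> norm x * b" unfolding b_def by (rule norm_vector_matrix_mult_2)
      have z: "1 + z = (norm (x + x v* A))\<^sup>2 / (norm x)\<^sup>2"
      proof -
        have "(norm (x + x v* A))\<^sup>2 = (norm x)\<^sup>2 + 2 * (x \<bullet> (x v* A)) + (norm (x v* A))\<^sup>2"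
          unfolding power2_norm_eq_inner by (simp add: inner_add_left inner_add_right inner_commute)
        then show ?thesis using n0 by (simp add: z_def z1_def z2_def add_divide_distrib)
      qed
      then have z': "z \<ge> -1" by (smt (verit) divide_nonneg_nonneg zero_le_power2)
      have z1: "\<bar>z1\<bar> \<le> 2 * b"
      proof -
        have "\<bar>x \<bullet> (x v* A)\<bar> \<le> norm x * (norm x * b)"
          using Cauchy_Schwarz_ineq2[of x "x v* A"] mult_left_mono[OF nxA norm_ge_zero[of x]] by linarith
        then show ?thesis using n0 by (simp add: z1_def abs_mult divide_le_eq power2_eq_square mult_ac)
      qed
      have z2: "0 \<le> z2" "z2 \<le> b\<^sup>2"
        using power_mono[OF nxA norm_ge_zero, of 2] n0 by (auto simp: z2_def divide_le_eq power_mult_distrib mult_ac)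
      have nx: "(norm x)\<^sup>2 * z = 2 * (x \<bullet> (x v* A)) + (norm (x v* A))\<^sup>2" "(norm x)\<^sup>2 * z1\<^sup>2 = 4 * (x \<bullet> (x v* A))\<^sup>2 / (norm x)\<^sup>2"
        using n0 by (simp_all add: z_def z1_def z2_def field_simps power2_eq_square)
      have "?L = twist x * (of_real (1 + z) powr \<aa> - 1 - \<aa> * of_real z - \<aa> * (\<aa> - 1) / 2 * of_real (z\<^sup>2))
          + twist x * (\<aa> * (\<aa> - 1) / 2 * of_real (z\<^sup>2 - z1\<^sup>2))"
        unfolding euler_twist_def twist_scale(1)[OF False, of "x + x v* A"] z[symmetric] nx[symmetric] by (simp add: twist_def algebra_simps)
      also have "norm \<dots> \<le> (norm x)\<^sup>2 * (C * (32 * (b ^ 3 + b ^ 6))) + (norm x)\<^sup>2 * (k * (5 * (b ^ 3 + b ^ 6)))"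
      proof (rule norm_triangle_mono)
        have "\<bar>z\<bar> \<le> 2 * b + b\<^sup>2" using z1 z2 by (simp add: z_def)
        then have "\<bar>z\<bar> ^ 3 \<le> (2 * b + b\<^sup>2) ^ 3" by (intro power_mono) auto
        also have "\<dots> \<le> 4 * ((2 * b) ^ 3 + (b\<^sup>2) ^ 3)"
        proof -
          have "4 * (p ^ 3 + q ^ 3) - (p + q) ^ 3 = 3 * ((p - q)\<^sup>2 * (p + q))" for p q :: real
            by (simp add: power2_eq_square power3_eq_cube algebra_simps)
          moreover have "0 \<le> 3 * ((2 * b - b\<^sup>2)\<^sup>2 * (2 * b + b\<^sup>2))" using b0 by simp
          ultimately show ?thesis by (metis diff_ge_0_iff_ge)
        qed
        also have "\<dots> \<le> 32 * (b ^ 3 + b ^ 6)" using b0 by (simp add: power_mult_distrib power_mult[symmetric])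
        finally have "\<bar>z\<bar> ^ 3 \<le> 32 * (b ^ 3 + b ^ 6)" .
        then have "C * \<bar>z\<bar> ^ 3 \<le> C * (32 * (b ^ 3 + b ^ 6))" using C(1) by (rule mult_left_mono)
        then show "norm (twist x * (of_real (1 + z) powr \<aa> - 1 - \<aa> * of_real z - \<aa> * (\<aa> - 1) / 2 * of_real (z\<^sup>2))) \<le> (norm x)\<^sup>2 * (C * (32 * (b ^ 3 + b ^ 6)))"
          unfolding norm_mult[of "twist x"] using norm_twist[of x] C(2)[OF z'] by (intro mult_mono) auto
        have "z\<^sup>2 - z1\<^sup>2 = z2 * (2 * z1 + z2)" by (simp add: z_def power2_eq_square algebra_simps)
        then have "\<bar>z\<^sup>2 - z1\<^sup>2\<bar> = z2 * \<bar>2 * z1 + z2\<bar>" using z2 by (simp add: abs_mult)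
        also have "\<dots> \<le> b\<^sup>2 * (4 * b + b\<^sup>2)" using z1 z2 by (intro mult_mono) auto
        also have "\<dots> = 4 * b ^ 3 + b ^ 4" by (simp add: power_numeral_reduce algebra_simps)
        also have "b ^ 4 \<le> b ^ 3 + b ^ 6"
        proof (cases "b \<le> 1")
          case True
          then show ?thesis using power_decreasing[of 3 4 b] b0 by (simp add: add_increasing2)
        next
          case False
          then show ?thesis using power_increasing[of 4 6 b] b0 by (simp add: add_increasing)
        qed
        finally have "\<bar>z\<^sup>2 - z1\<^sup>2\<bar> \<le> 5 * (b ^ 3 + b ^ 6)" using zero_le_power[OF b0, of 6]
          unfolding distrib_left by linarith
        then have "norm (\<aa> * (\<aa> - 1) / 2 * of_real (z\<^sup>2 - z1\<^sup>2)) \<le> k * (5 * (b ^ 3 + b ^ 6))"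
          unfolding norm_mult[of "\<aa> * (\<aa> - 1) / 2"] norm_of_real k_def by (rule mult_left_mono) auto
        then show "norm (twist x * (\<aa> * (\<aa> - 1) / 2 * of_real (z\<^sup>2 - z1\<^sup>2))) \<le> (norm x)\<^sup>2 * (k * (5 * (b ^ 3 + b ^ 6)))"
          unfolding norm_mult[of "twist x"] using norm_twist[of x] by (intro mult_mono) auto
      qed
      also have "\<dots> = (32 * C + 5 * k) * (norm x)\<^sup>2 * (b ^ 3 + b ^ 6)" by (simp add: algebra_simps)
      finally show ?thesis by (simp add: b_def)
    qed
  qed
qed

lemma phase_eq: "phase x = (if x = 0 then 0 else cis (\<xi> * ln ((norm x)\<^sup>2)))"
  by (simp add: phase_def powr_def Ln_of_real cis_conv_exp algebra_simps del: of_real_power)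

lemma phase_measurable [measurable]: "phase \<in> borel_measurable borel"
proof -
  have [measurable]: "cis \<in> borel_measurable borel" by (rule borel_measurable_continuous_onI) (intro continuous_intros)
  have "(\<lambda>x::real^2. if x = 0 then 0 else cis (\<xi> * ln ((norm x)\<^sup>2))) \<in> borel_measurable borel" by measurable
  then show ?thesis by (simp add: phase_eq[abs_def])
qed

lemma twist_measurable [measurable]: "twist \<in> borel_measurable borel"
  unfolding twist_def by measurable

end

subsection \<open>The characteristic function of the length of a row\<close>

context geometric_brownian_motion_SL2
begin

lemma indep_increment_inner:
  fixes g :: "'a \<Rightarrow> complex"
  assumes st: "0 \<le> s" "s \<le> t" and g: "g \<in> borel_measurable (FF s)" "integrable M g"
  shows "has_bochner_integral M (\<lambda>\<omega>. g \<omega> * of_real (A \<bullet> (B t \<omega> - B s \<omega>))) 0"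
    "has_bochner_integral M (\<lambda>\<omega>. g \<omega> * of_real ((A \<bullet> (B t \<omega> - B s \<omega>)) * (A' \<bullet> (B t \<omega> - B s \<omega>)))) (expectation g * of_real ((t - s) * cov A A'))"
proof -
  have [measurable]: "B t \<in> borel_measurable M" "B s \<in> borel_measurable M" using st by auto
  have "integrable M (\<lambda>\<omega>. A \<bullet> (B t \<omega> - B s \<omega>))"
    by (rule integrable_of_square) (use increment_even_moment(1)[OF st, of A 1] in auto)
  then show "has_bochner_integral M (\<lambda>\<omega>. g \<omega> * of_real (A \<bullet> (B t \<omega> - B s \<omega>))) 0"
    using indep_increment[OF st g, of "\<lambda>X. A \<bullet> X"] increment_even_moment(3)[OF st, of A]
    by (simp add: has_bochner_integral_iff)
  show "has_bochner_integral M (\<lambda>\<omega>. g \<omega> * of_real ((A \<bullet> (B t \<omega> - B s \<omega>)) * (A' \<bullet> (B t \<omega> - B s \<omega>)))) (expectation g * of_real ((t - s) * cov A A'))"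
    using indep_increment[OF st g, of "\<lambda>X. (A \<bullet> X) * (A' \<bullet> X)"] inner_increment_prod_integrable[OF st, of A A']
    unfolding increment_cov[OF st] by (simp add: has_bochner_integral_iff)
qed

text \<open>\<open>c\<close> ranges over the coefficients, of degree two in the row, that appear
  when \<open>euler_twist\<close> is expanded in the coordinates of the increment.\<close>

lemma phase_mult_integrable:
  assumes s: "s \<ge> 0" and c: "c \<in> borel_measurable borel" "\<And>x. \<bar>c x\<bar> \<le> (norm x)\<^sup>2"
  shows "(\<lambda>\<omega>. phase \<xi> (F s \<omega> $ 1) * of_real (c (F s \<omega> $ 1))) \<in> borel_measurable (FF s)"
    "integrable M (\<lambda>\<omega>. phase \<xi> (F s \<omega> $ 1) * of_real (c (F s \<omega> $ 1)))"
proof -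
  have [measurable]: "F s \<in> borel_measurable (FF s)" by (rule F_adapted[OF s])
  note [measurable] = c(1)
  show m: "(\<lambda>\<omega>. phase \<xi> (F s \<omega> $ 1) * of_real (c (F s \<omega> $ 1))) \<in> borel_measurable (FF s)" by measurable
  have "norm (phase \<xi> x * of_real (c x)) \<le> (norm x)\<^sup>2" for x
    using mult_mono[OF norm_phase[of \<xi> x] c(2)[of x]] by (simp add: norm_mult)
  then show "integrable M (\<lambda>\<omega>. phase \<xi> (F s \<omega> $ 1) * of_real (c (F s \<omega> $ 1)))"
    by (intro integrable_dominated[OF F_row_moment(1)[OF s, of 1] FF_M_measurable[OF s m]]) auto
qed

definition twisted_mean :: "real \<Rightarrow> real \<Rightarrow> complex" where
  "twisted_mean \<xi> t = expectation (\<lambda>\<omega>. twist \<xi> (F t \<omega> $ 1))"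

lemma twist_integrable:
  assumes "t \<ge> 0"
  shows "integrable M (\<lambda>\<omega>. twist \<xi> (F t \<omega> $ 1))" "norm (twisted_mean \<xi> t) \<le> exp t"
proof -
  have [measurable]: "F t \<in> borel_measurable M" using assms by auto
  show 1: "integrable M (\<lambda>\<omega>. twist \<xi> (F t \<omega> $ 1))"
    by (rule integrable_dominated[OF F_row_moment(1)[OF assms, of 1]]) (use norm_twist in auto)
  have "norm (twisted_mean \<xi> t) \<le> expectation (\<lambda>\<omega>. norm (twist \<xi> (F t \<omega> $ 1)))"
    unfolding twisted_mean_def by (rule integral_norm_bound)
  also have "\<dots> \<le> expectation (\<lambda>\<omega>. (norm (F t \<omega> $ 1))\<^sup>2)"
    by (rule integral_mono) (use 1 F_row_moment(1)[OF assms, of 1] norm_twist in auto)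
  finally show "norm (twisted_mean \<xi> t) \<le> exp t" using F_row_moment(2)[OF assms, of 1] by simp
qed

text \<open>With variances 1/4, 1/4, 1/2 per unit time, \<open>(norm (x v* A))\<^sup>2\<close> and
  \<open>4 * (x \<bullet> (x v* A))\<^sup>2 / (norm x)\<^sup>2\<close> both have conditional mean
  \<open>(t - s) * (norm x)\<^sup>2\<close>. Their coefficients add up to a + a (a - 1) / 2 = a (a +
  1) / 2.\<close>

lemma euler_twist_mean:
  assumes st: "0 \<le> s" "s \<le> t"
  shows "has_bochner_integral M (\<lambda>\<omega>. euler_twist \<xi> (F s \<omega> $ 1) (B t \<omega> - B s \<omega>))
     (twisted_mean \<xi> s * (1 + of_real (t - s) * (cexpo \<xi> * (cexpo \<xi> + 1) / 2)))"
proof -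
  \<comment> \<open>\<open>p\<close> and \<open>2 * q\<close> are the real and imaginary parts of
    the square of the complex number \<open>x$1 + i x$2\<close>; hence \<open>pqn\<close>. They are
    the coefficients in \<open>x \<bullet> (x v* A)\<close> of the coordinates along
    \<open>S1\<close> and \<open>S2\<close>.\<close>
  define p where "p = (\<lambda>x::real^2. (x$1)\<^sup>2 - (x$2)\<^sup>2)"
  define q where "q = (\<lambda>x::real^2. x$1 * x$2)"
  define n where "n = (\<lambda>x::real^2. (norm x)\<^sup>2)"
  have n0: "n x \<ge> 0" for x by (simp add: n_def)
  have pqn: "(p x)\<^sup>2 + 4 * (q x)\<^sup>2 = (n x)\<^sup>2" for x
    unfolding p_def q_def n_def norm_sq_2 by (simp add: power2_eq_square algebra_simps)
  have p2: "(p x)\<^sup>2 \<le> (n x)\<^sup>2" and q2: "(q x)\<^sup>2 \<le> (n x)\<^sup>2" for x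
    using pqn[of x] zero_le_power2[of "p x"] zero_le_power2[of "q x"] by linarith+
  have p: "\<bar>p x\<bar> \<le> n x" and q: "\<bar>q x\<bar> \<le> n x" for x
    using p2[of x] q2[of x] n0[of x] by (auto intro: power2_le_imp_le simp: abs_le_square_iff[symmetric])
  have div: "\<bar>c / n x\<bar> \<le> n x" if "\<bar>c\<bar> \<le> (n x)\<^sup>2" for c x
    using that n0[of x] by (cases "n x = 0") (auto simp: divide_le_eq power2_eq_square)
  have pq: "\<bar>p x * q x\<bar> \<le> (n x)\<^sup>2" for x
    unfolding abs_mult power2_eq_square by (rule mult_mono[OF p q n0]) auto
  have [measurable]: "p \<in> borel_measurable borel" "q \<in> borel_measurable borel" "n \<in> borel_measurable borel"
    unfolding p_def q_def n_def by measurable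
  define G where "G = (\<lambda>c \<omega>. phase \<xi> (F s \<omega> $ 1) * of_real (c (F s \<omega> $ 1)))"
  have G: "G c \<in> borel_measurable (FF s)" "integrable M (G c)" if "c \<in> borel_measurable borel" "\<And>x. \<bar>c x\<bar> \<le> n x" for c
    unfolding G_def using phase_mult_integrable[OF st(1) that(1)] that(2) unfolding n_def by auto
  have Gp: "G p \<in> borel_measurable (FF s)" "integrable M (G p)" by (rule G, use p in auto)+
  have Gq: "G q \<in> borel_measurable (FF s)" "integrable M (G q)" by (rule G, use q in auto)+
  have Gn: "G n \<in> borel_measurable (FF s)" "integrable M (G n)" by (rule G, use n0 in auto)+
  have Gpp: "G (\<lambda>x. (p x)\<^sup>2 / n x) \<in> borel_measurable (FF s)" "integrable M (G (\<lambda>x. (p x)\<^sup>2 / n x))" by (rule G, use div[of "(p _)\<^sup>2"] p2 in auto)+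
  have Gqq: "G (\<lambda>x. (q x)\<^sup>2 / n x) \<in> borel_measurable (FF s)" "integrable M (G (\<lambda>x. (q x)\<^sup>2 / n x))" by (rule G, use div[of "(q _)\<^sup>2"] q2 in auto)+
  have Gpq: "G (\<lambda>x. p x * q x / n x) \<in> borel_measurable (FF s)" "integrable M (G (\<lambda>x. p x * q x / n x))" by (rule G, use div[of "p _ * q _"] pq in auto)+
  define D where "D = (\<lambda>\<omega>. B t \<omega> - B s \<omega>)"
  define L where "L = (\<lambda>A \<omega>. A \<bullet> D \<omega>)"
  define a where "a = cexpo \<xi>"
  define m where "m = twisted_mean \<xi> s"
  define d where "d = t - s"
  have En: "expectation (G n) = m"
    by (simp add: m_def twisted_mean_def G_def n_def twist_def mult.commute)
  have En': "expectation (G (\<lambda>x. (p x)\<^sup>2 / n x)) + 4 * expectation (G (\<lambda>x. (q x)\<^sup>2 / n x)) = m"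
  proof -
    have e: "n x = (p x)\<^sup>2 / n x + 4 * ((q x)\<^sup>2 / n x)" for x
      using pqn[of x] by (cases "n x = 0") (auto simp: field_simps power2_eq_square)
    have "G n \<omega> = G (\<lambda>x. (p x)\<^sup>2 / n x) \<omega> + 4 * G (\<lambda>x. (q x)\<^sup>2 / n x) \<omega>" for \<omega>
      unfolding G_def by (subst e) (simp add: distrib_left)
    then have "expectation (G n) = expectation (\<lambda>\<omega>. G (\<lambda>x. (p x)\<^sup>2 / n x) \<omega> + 4 * G (\<lambda>x. (q x)\<^sup>2 / n x) \<omega>)" by presburger
    then show ?thesis using Gpp Gqq En by simp
  qed
  \<comment> \<open>Each summand is a factor \<open>G c\<close> from the past times at most two
    coordinates of the increment, so that expectations can be taken term by term.\<close>
  define R where "R = (\<lambda>\<omega>. G n \<omega> + a * (2 * (G p \<omega> * of_real (L S1 \<omega>)) + 4 * (G q \<omega> * of_real (L S2 \<omega>))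
       + (G n \<omega> * of_real (L S1 \<omega> * L S1 \<omega>) + G n \<omega> * of_real (L S2 \<omega> * L S2 \<omega>) + G n \<omega> * of_real (L J \<omega> * L J \<omega>)
         - 4 * (G q \<omega> * of_real (L S1 \<omega> * L J \<omega>)) + 2 * (G p \<omega> * of_real (L S2 \<omega> * L J \<omega>))))
     + a * (a - 1) / 2 * (4 * (G (\<lambda>x. (p x)\<^sup>2 / n x) \<omega> * of_real (L S1 \<omega> * L S1 \<omega>))
        + 16 * (G (\<lambda>x. (q x)\<^sup>2 / n x) \<omega> * of_real (L S2 \<omega> * L S2 \<omega>))
        + 16 * (G (\<lambda>x. p x * q x / n x) \<omega> * of_real (L S1 \<omega> * L S2 \<omega>))))"
  have E: "euler_twist \<xi> (F s \<omega> $ 1) (D \<omega>) = R \<omega>" if \<omega>: "\<omega> \<in> space M" for \<omega>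
  proof -
    define x where "x = F s \<omega> $ 1"
    define X where "X = L S1 \<omega>" define Y where "Y = L S2 \<omega>" define W where "W = L J \<omega>"
    have "D \<omega> $ 2 $ 2 = - (D \<omega> $ 1 $ 1)" unfolding D_def by (rule increment_trace[OF st \<omega>])
    then have D: "D \<omega> $ 1 $ 1 = X" "D \<omega> $ 1 $ 2 = Y + W" "D \<omega> $ 2 $ 1 = Y - W" "D \<omega> $ 2 $ 2 = - X"
      unfolding X_def Y_def W_def L_def inner_S1 inner_S2 inner_J by (simp_all add: field_simps)
    have 1: "x \<bullet> (x v* D \<omega>) = p x * X + 2 * q x * Y"
      unfolding inner_2 vector_matrix_mult_2 D p_def q_def by (simp add: power2_eq_square algebra_simps)
    have 2: "(norm (x v* D \<omega>))\<^sup>2 = n x * (X * X) + n x * (Y * Y) + n x * (W * W) - 4 * (q x * (X * W)) + 2 * (p x * (Y * W))"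
      unfolding n_def norm_sq_2 vector_matrix_mult_2 D p_def q_def by (simp add: power2_eq_square algebra_simps)
    have 3: "4 * (x \<bullet> (x v* D \<omega>))\<^sup>2 / (norm x)\<^sup>2 = 4 * ((p x)\<^sup>2 / n x * (X * X)) + 16 * ((q x)\<^sup>2 / n x * (Y * Y)) + 16 * (p x * q x / n x * (X * Y))"
    proof -
      have "(norm x)\<^sup>2 = n x" by (simp add: n_def)
      then show ?thesis unfolding 1 by (simp only:) (simp add: power2_eq_square add_divide_distrib algebra_simps)
    qed
    have 4: "twist \<xi> x = phase \<xi> x * of_real (n x)" by (simp add: twist_def n_def)
    show ?thesis
      unfolding R_def euler_twist_def x_def[symmetric] G_def X_def[symmetric] Y_def[symmetric] W_def[symmetric] 1 2 3[unfolded 1] 4 a_def[symmetric]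
      by (simp add: algebra_simps)
  qed
  have ind: "has_bochner_integral M (\<lambda>\<omega>. g \<omega> * of_real (L A \<omega>)) 0"
    "has_bochner_integral M (\<lambda>\<omega>. g \<omega> * of_real (L A \<omega> * L A' \<omega>)) (expectation g * of_real (d * cov A A'))"
    if "g \<in> borel_measurable (FF s)" "integrable M g" for g :: "'a \<Rightarrow> complex" and A A'
    unfolding L_def D_def d_def using indep_increment_inner[OF st that] by blast+
  have "has_bochner_integral M R
     (m + a * (2 * 0 + 4 * 0 + (m * of_real (d * (1/4)) + m * of_real (d * (1/4)) + m * of_real (d * (1/2))
         - 4 * (expectation (G q) * of_real (d * 0)) + 2 * (expectation (G p) * of_real (d * 0))))
       + a * (a - 1) / 2 * (4 * (expectation (G (\<lambda>x. (p x)\<^sup>2 / n x)) * of_real (d * (1/4)))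
        + 16 * (expectation (G (\<lambda>x. (q x)\<^sup>2 / n x)) * of_real (d * (1/4)))
        + 16 * (expectation (G (\<lambda>x. p x * q x / n x)) * of_real (d * 0))))" (is "has_bochner_integral M R ?v")
    unfolding R_def
    by (intro has_bochner_integral_add has_bochner_integral_diff has_bochner_integral_mult_right)
      (use ind(1)[OF Gp, of S1] ind(1)[OF Gq, of S2] ind(2)[OF Gn, of S1 S1] ind(2)[OF Gn, of S2 S2] ind(2)[OF Gn, of J J]
        ind(2)[OF Gq, of S1 J] ind(2)[OF Gp, of S2 J] ind(2)[OF Gpp, of S1 S1] ind(2)[OF Gqq, of S2 S2] ind(2)[OF Gpq, of S1 S2]
        has_bochner_integral_integrable[OF Gn(2)] in \<open>simp_all add: cov_values cov_cross En\<close>)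
  moreover have "?v = m * (1 + of_real d * (a * (a + 1) / 2))"
    unfolding En'[symmetric] by (simp add: field_simps)
  ultimately have "has_bochner_integral M (\<lambda>\<omega>. euler_twist \<xi> (F s \<omega> $ 1) (D \<omega>)) (m * (1 + of_real d * (a * (a + 1) / 2)))"
    by (subst has_bochner_integral_cong[OF refl E refl]) simp_all
  then show ?thesis unfolding a_def m_def d_def D_def .
qed

text \<open>The new row is \<open>y + e\<close> with Euler step
  \<open>y = x + x v* (B t - B s)\<close> and remainder \<open>e\<close>. Three errors arise: the
  second order in \<open>e\<close>, the derivative taken at \<open>x\<close> instead of
  \<open>y\<close>, and the Euler expansion of \<open>twist y\<close>. The change of base point is
  needed because \<open>remainder_orthogonal\<close> requires a factor known at time
  \<open>s\<close>; it then removes the remaining term \<open>orth\<close>.\<close>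

lemma twisted_mean_step:
  assumes T: "T \<ge> 0"
  obtains C where "C \<ge> 0" "\<And>s \<eta>. 0 \<le> s \<Longrightarrow> s + \<eta>\<^sup>2 \<le> T \<Longrightarrow> 0 < \<eta> \<Longrightarrow> \<eta> \<le> 1 \<Longrightarrow>
    norm (twisted_mean \<xi> (s + \<eta>\<^sup>2) - twisted_mean \<xi> s * (1 + of_real (\<eta>\<^sup>2) * (cexpo \<xi> * (cexpo \<xi> + 1) / 2))) \<le> C * \<eta> ^ 3"
proof -
  define a where "a = cexpo \<xi>"
  obtain C3 where C3: "C3 \<ge> 0" "\<And>x A. norm (twist \<xi> (x + x v* A) - euler_twist \<xi> x A) \<le> C3 * (norm x)\<^sup>2 * (norm A ^ 3 + norm A ^ 6)"
    by (rule twist_mult_expand[of \<xi>]) (rule that)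
  define C1 where "C1 = norm (2 * a * (2 * a - 1)) + 2 * norm a + 1"
  define C2 where "C2 = 2 * norm a * (1 + 2 * \<bar>\<xi>\<bar>)"
  define Cr where "Cr = 8 * K\<^sup>2 * exp T"
  have C: "C1 \<ge> 0" "C2 \<ge> 0" "Cr \<ge> 0" by (auto simp: C1_def C2_def Cr_def add_nonneg_nonneg)
  define C where "C = C1 * Cr + C2 * (Cr + exp T * K) + C3 * (3 * (exp T * K))"
  show thesis
  proof (rule that)
    show "C \<ge> 0" using C C3 K_ge_1 unfolding C_def by (intro add_nonneg_nonneg mult_nonneg_nonneg) auto
    fix s \<eta> :: real assume s: "0 \<le> s" "s + \<eta>\<^sup>2 \<le> T" and \<eta>: "0 < \<eta>" "\<eta> \<le> 1"
    define t where "t = s + \<eta>\<^sup>2"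
    have st: "0 \<le> s" "s \<le> t" "t \<le> T" "t - s = \<eta>\<^sup>2" "0 \<le> t" using s by (auto simp: t_def)
    have sT: "s \<le> T" using st by simp
    have [measurable]: "F s \<in> borel_measurable M" "F t \<in> borel_measurable M" "B t \<in> borel_measurable M" "B s \<in> borel_measurable M"
      using st by auto
    define x where "x = (\<lambda>\<omega>. F s \<omega> $ 1)"
    define b where "b = (\<lambda>\<omega>. norm (B t \<omega> - B s \<omega>))"
    define e where "e = (\<lambda>\<omega>. remainder s t \<omega> $ 1)"
    define r where "r = (\<lambda>\<omega>. norm (remainder s t \<omega>))"
    define orth where "orth = (\<lambda>\<omega>. 2 * a * (phase \<xi> (x \<omega>) * of_real (x \<omega> \<bullet> e \<omega>)))"
    define W where "W = (\<lambda>\<omega>. C1 * (r \<omega>)\<^sup>2 + C2 * ((r \<omega>)\<^sup>2 / \<eta> + \<eta> * ((norm (x \<omega>))\<^sup>2 * b \<omega> ^ 2))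
        + C3 * (\<eta> * ((norm (x \<omega>))\<^sup>2 * b \<omega> ^ 2) + (norm (x \<omega>))\<^sup>2 * b \<omega> ^ 4 / \<eta> + (norm (x \<omega>))\<^sup>2 * b \<omega> ^ 6))"
    define E where "E = (\<lambda>\<omega>. euler_twist \<xi> (x \<omega>) (B t \<omega> - B s \<omega>))"
    have bound: "norm (twist \<xi> (F t \<omega> $ 1) - E \<omega> - orth \<omega>) \<le> W \<omega>" for \<omega>
    proof -
      define y where "y = x \<omega> + x \<omega> v* (B t \<omega> - B s \<omega>)"
      have er: "norm (e \<omega>) \<le> r \<omega>" unfolding e_def r_def by (rule Finite_Cartesian_Product.norm_nth_le)
      have r0: "0 \<le> r \<omega>" and b0: "0 \<le> b \<omega>" by (auto simp: r_def b_def)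
      have Ft: "F t \<omega> $ 1 = y + e \<omega>"
        unfolding y_def x_def e_def remainder_def by (simp add: row_matrix_mult_22)
      have "twist \<xi> (F t \<omega> $ 1) - E \<omega> - orth \<omega> =
          (twist \<xi> (y + e \<omega>) - twist \<xi> y - 2 * a * (phase \<xi> y * of_real (y \<bullet> e \<omega>)))
          + 2 * a * (phase \<xi> y * of_real (y \<bullet> e \<omega>) - phase \<xi> (x \<omega>) * of_real (x \<omega> \<bullet> e \<omega>))
          + (twist \<xi> y - E \<omega>)"
        unfolding Ft orth_def by (simp add: algebra_simps)
      also have "norm \<dots> \<le> W \<omega>"
        unfolding W_def
      proof (intro norm_triangle_mono)
        have "norm (twist \<xi> (y + e \<omega>) - twist \<xi> y - 2 * a * (phase \<xi> y * of_real (y \<bullet> e \<omega>))) \<le> C1 * (norm (e \<omega>))\<^sup>2"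
          unfolding a_def C1_def by (rule twist_expand)
        also have "\<dots> \<le> C1 * (r \<omega>)\<^sup>2" using er C by (intro mult_left_mono power_mono) auto
        finally show "norm (twist \<xi> (y + e \<omega>) - twist \<xi> y - 2 * a * (phase \<xi> y * of_real (y \<bullet> e \<omega>))) \<le> C1 * (r \<omega>)\<^sup>2" .
        have "norm (y - x \<omega>) \<le> norm (x \<omega>) * b \<omega>"
          unfolding y_def b_def using norm_vector_matrix_mult_2 by simp
        then have "(1 + 2 * \<bar>\<xi>\<bar>) * norm (y - x \<omega>) * norm (e \<omega>) \<le> (1 + 2 * \<bar>\<xi>\<bar>) * (norm (x \<omega>) * b \<omega>) * r \<omega>"
          using er b0 by (intro mult_mono mult_left_mono mult_nonneg_nonneg) auto
        with phase_Lipschitz[of \<xi> y "e \<omega>" "x \<omega>"]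
        have "norm (phase \<xi> y * of_real (y \<bullet> e \<omega>) - phase \<xi> (x \<omega>) * of_real (x \<omega> \<bullet> e \<omega>)) \<le> (1 + 2 * \<bar>\<xi>\<bar>) * (norm (x \<omega>) * b \<omega>) * r \<omega>"
          by linarith
        then have "norm (2 * a) * norm (phase \<xi> y * of_real (y \<bullet> e \<omega>) - phase \<xi> (x \<omega>) * of_real (x \<omega> \<bullet> e \<omega>)) \<le> norm (2 * a) * ((1 + 2 * \<bar>\<xi>\<bar>) * (norm (x \<omega>) * b \<omega>) * r \<omega>)"
          by (rule mult_left_mono) simp
        also have "\<dots> = C2 * (r \<omega> * (norm (x \<omega>) * b \<omega>))" by (simp add: C2_def norm_mult mult_ac)
        also have "\<dots> \<le> C2 * ((r \<omega>)\<^sup>2 / \<eta> + \<eta> * ((norm (x \<omega>))\<^sup>2 * b \<omega> ^ 2))"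
        proof (rule mult_left_mono[OF _ C(2)])
          have "0 \<le> r \<omega> * (norm (x \<omega>) * b \<omega>)" using r0 b0 by simp
          then show "r \<omega> * (norm (x \<omega>) * b \<omega>) \<le> (r \<omega>)\<^sup>2 / \<eta> + \<eta> * ((norm (x \<omega>))\<^sup>2 * b \<omega> ^ 2)"
            using young[OF \<eta>(1), of "r \<omega>" "norm (x \<omega>) * b \<omega>"] unfolding power_mult_distrib by linarith
        qed
        finally show "norm (2 * a * (phase \<xi> y * of_real (y \<bullet> e \<omega>) - phase \<xi> (x \<omega>) * of_real (x \<omega> \<bullet> e \<omega>))) \<le> C2 * ((r \<omega>)\<^sup>2 / \<eta> + \<eta> * ((norm (x \<omega>))\<^sup>2 * b \<omega> ^ 2))"
          unfolding norm_mult[of "2 * a"] .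
        \<comment> \<open>Odd powers of the increment are reduced to even ones, whose moments are
          available; both terms have mean of order \<open>\<eta> ^ 3\<close>.\<close>
        have b3: "b \<omega> ^ 3 \<le> \<eta> * b \<omega> ^ 2 + b \<omega> ^ 4 / \<eta>"
        proof -
          have e: "(b \<omega> ^ 2)\<^sup>2 = b \<omega> ^ 4" "b \<omega> ^ 2 * b \<omega> = b \<omega> ^ 3" by (simp_all add: power_numeral_reduce)
          have "2 * (b \<omega> ^ 2 * b \<omega>) \<le> (b \<omega> ^ 2)\<^sup>2 / \<eta> + \<eta> * (b \<omega>)\<^sup>2" by (rule young[OF \<eta>(1)])
          moreover have "0 \<le> b \<omega> ^ 3" using b0 by simp
          ultimately show ?thesis unfolding e by linarith
        qed
        have "norm (twist \<xi> y - E \<omega>) \<le> C3 * (norm (x \<omega>))\<^sup>2 * (b \<omega> ^ 3 + b \<omega> ^ 6)"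
          unfolding y_def E_def b_def by (rule C3(2))
        also have "\<dots> \<le> C3 * (norm (x \<omega>))\<^sup>2 * (\<eta> * b \<omega> ^ 2 + b \<omega> ^ 4 / \<eta> + b \<omega> ^ 6)"
          using b3 C3(1) by (intro mult_left_mono) auto
        finally show "norm (twist \<xi> y - E \<omega>) \<le> C3 * (\<eta> * ((norm (x \<omega>))\<^sup>2 * b \<omega> ^ 2) + (norm (x \<omega>))\<^sup>2 * b \<omega> ^ 4 / \<eta> + (norm (x \<omega>))\<^sup>2 * b \<omega> ^ 6)"
          by (simp add: algebra_simps)
      qed
      finally show ?thesis .
    qed
    have orth: "integrable M orth" "expectation orth = 0"
    proof -
      have c: "(\<lambda>\<omega>. phase \<xi> (x \<omega>) * of_real (x \<omega> $ j)) \<in> borel_measurable (FF s)" for j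
        unfolding x_def using F_adapted[OF st(1)] by measurable
      have le: "norm (phase \<xi> (x \<omega>) * of_real (x \<omega> $ j)) \<le> norm (x \<omega>)" for \<omega> j
        using mult_mono[OF norm_phase[of \<xi> "x \<omega>"] component_le_norm_cart[of "x \<omega>" j]] by (simp add: norm_mult)
      have "integrable M (\<lambda>\<omega>. (norm (phase \<xi> (x \<omega>) * of_real (x \<omega> $ j)))\<^sup>2)" for j
        by (rule integrable_dominated[OF F_row_moment(1)[OF st(1), of 1]])
          (use power_mono[OF le norm_ge_zero, of _ _ 2] FF_M_measurable[OF st(1) c] in \<open>auto simp: x_def intro!: AE_I2\<close>)
      note o = remainder_orthogonal[OF st(1,2) c this, of _ 1]
      have eq: "orth = (\<lambda>\<omega>. 2 * a * (phase \<xi> (x \<omega>) * of_real (x \<omega> $ 1) * of_real (remainder s t \<omega> $ 1 $ 1) + phase \<xi> (x \<omega>) * of_real (x \<omega> $ 2) * of_real (remainder s t \<omega> $ 1 $ 2)))"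
        by (simp add: orth_def e_def inner_2 fun_eq_iff algebra_simps)
      show "integrable M orth" "expectation orth = 0"
        unfolding eq using o by simp_all
    qed
    have r2: "integrable M (\<lambda>\<omega>. (r \<omega>)\<^sup>2)" "expectation (\<lambda>\<omega>. (r \<omega>)\<^sup>2) \<le> Cr * \<eta> ^ 4"
    proof -
      show "integrable M (\<lambda>\<omega>. (r \<omega>)\<^sup>2)" unfolding r_def by (rule remainder_bound(1)[OF st(1,2)])
      have "8 * K\<^sup>2 * exp t * (t - s)\<^sup>2 \<le> 8 * K\<^sup>2 * exp T * \<eta> ^ 4"
        unfolding st(4) using st(3) by (simp add: mult_left_mono mult_right_mono)
      then show "expectation (\<lambda>\<omega>. (r \<omega>)\<^sup>2) \<le> Cr * \<eta> ^ 4"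
        using remainder_bound(2)[OF st(1,2)] unfolding Cr_def r_def by linarith
    qed
    have xb: "integrable M (\<lambda>\<omega>. (norm (x \<omega>))\<^sup>2 * b \<omega> ^ (2 * k))" "expectation (\<lambda>\<omega>. (norm (x \<omega>))\<^sup>2 * b \<omega> ^ (2 * k)) \<le> exp T * K * \<eta> ^ (2 * k)"
      if k: "k \<in> {1,2,3}" for k
    proof -
      have "(\<lambda>\<omega>. (norm (F s \<omega> $ 1))\<^sup>2) \<in> borel_measurable (FF s)" using F_adapted[OF st(1)] by measurable
      note ind = indep_increment[OF st(1,2) this F_row_moment(1)[OF st(1), of 1], of "\<lambda>A. norm A ^ (2 * k)"]
      have m: "(\<lambda>A::real^2^2. norm A ^ (2 * k)) \<in> borel_measurable borel" by measurable
      show "integrable M (\<lambda>\<omega>. (norm (x \<omega>))\<^sup>2 * b \<omega> ^ (2 * k))"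
        using ind(1)[OF m increment_norm_moment(1)[OF st(1,2)]] by (simp add: b_def x_def)
      have "expectation (\<lambda>\<omega>. (norm (x \<omega>))\<^sup>2 * b \<omega> ^ (2 * k)) = exp s * expectation (\<lambda>\<omega>. b \<omega> ^ (2 * k))"
        using ind(2)[OF m increment_norm_moment(1)[OF st(1,2)]] F_row_moment(2)[OF st(1), of 1] by (simp add: b_def x_def)
      also have "\<dots> \<le> exp T * (K * (\<eta>\<^sup>2) ^ k)"
        using increment_norm_moment_le[OF st(1,2) k] sT st(4) K_ge_1 unfolding b_def
        by (intro mult_mono) auto
      finally show "expectation (\<lambda>\<omega>. (norm (x \<omega>))\<^sup>2 * b \<omega> ^ (2 * k)) \<le> exp T * K * \<eta> ^ (2 * k)" by (simp add: power_mult mult.assoc)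
    qed
    note xb2 = xb[of 1, simplified] note xb4 = xb[of 2, simplified] note xb6 = xb[of 3, simplified]
    have W: "integrable M W" unfolding W_def using r2 xb2 xb4 xb6 by auto
    have "expectation W = C1 * expectation (\<lambda>\<omega>. (r \<omega>)\<^sup>2) + C2 * (expectation (\<lambda>\<omega>. (r \<omega>)\<^sup>2) / \<eta> + \<eta> * expectation (\<lambda>\<omega>. (norm (x \<omega>))\<^sup>2 * b \<omega> ^ 2))
        + C3 * (\<eta> * expectation (\<lambda>\<omega>. (norm (x \<omega>))\<^sup>2 * b \<omega> ^ 2) + expectation (\<lambda>\<omega>. (norm (x \<omega>))\<^sup>2 * b \<omega> ^ 4) / \<eta> + expectation (\<lambda>\<omega>. (norm (x \<omega>))\<^sup>2 * b \<omega> ^ 6))"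
      unfolding W_def using r2 xb2 xb4 xb6 by simp
    also have "\<dots> \<le> C1 * (Cr * \<eta> ^ 4) + C2 * (Cr * \<eta> ^ 4 / \<eta> + \<eta> * (exp T * K * \<eta> ^ 2)) + C3 * (\<eta> * (exp T * K * \<eta> ^ 2) + exp T * K * \<eta> ^ 4 / \<eta> + exp T * K * \<eta> ^ 6)"
      using r2(2) xb2(2) xb4(2) xb6(2) C C3(1) \<eta> by (intro add_mono mult_left_mono divide_right_mono) auto
    also have "\<dots> \<le> C1 * (Cr * \<eta> ^ 3) + C2 * (Cr * \<eta> ^ 3 + exp T * K * \<eta> ^ 3) + C3 * (exp T * K * \<eta> ^ 3 + exp T * K * \<eta> ^ 3 + exp T * K * \<eta> ^ 3)"
      using C C3(1) \<eta> K_ge_1 power_decreasing[of 3 4 \<eta>] power_decreasing[of 3 6 \<eta>]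
      by (intro add_mono mult_left_mono) (auto simp: power_numeral_reduce)
    also have "\<dots> = C * \<eta> ^ 3" by (simp add: C_def algebra_simps)
    finally have EW: "expectation W \<le> C * \<eta> ^ 3" .
    have EE: "integrable M E" "expectation E = twisted_mean \<xi> s * (1 + of_real (\<eta>\<^sup>2) * (cexpo \<xi> * (cexpo \<xi> + 1) / 2))"
      using euler_twist_mean[OF st(1,2), of \<xi>] unfolding st(4) E_def x_def by (auto simp: has_bochner_integral_iff)
    note Ft = twist_integrable(1)[OF st(5), of \<xi>]
    have "twisted_mean \<xi> t - expectation E = expectation (\<lambda>\<omega>. twist \<xi> (F t \<omega> $ 1) - E \<omega> - orth \<omega>)"
      using Ft EE(1) orth by (simp add: twisted_mean_def)
    also have "norm \<dots> \<le> expectation (\<lambda>\<omega>. norm (twist \<xi> (F t \<omega> $ 1) - E \<omega> - orth \<omega>))" by (rule integral_norm_bound)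
    also have "\<dots> \<le> expectation W" by (rule integral_mono) (use Ft EE(1) orth W bound in auto)
    also have "\<dots> \<le> C * \<eta> ^ 3" by (rule EW)
    finally show "norm (twisted_mean \<xi> (s + \<eta>\<^sup>2) - twisted_mean \<xi> s * (1 + of_real (\<eta>\<^sup>2) * (cexpo \<xi> * (cexpo \<xi> + 1) / 2))) \<le> C * \<eta> ^ 3"
      unfolding EE(2) t_def .
  qed
qed

section \<open>Exact value of the twisted mean\<close>

definition rate :: "real \<Rightarrow> complex" where "rate \<xi> = cexpo \<xi> * (cexpo \<xi> + 1) / 2"

text \<open>Per unit time, 1 is the growth exponent of the mean of \<open>|x|^2\<close>; the other
  terms are the weighted mean 3/2 and variance 1 of \<open>ln |x|^2\<close>.\<close>

lemma rate_eq: "rate \<xi> = of_real (1 - \<xi>\<^sup>2 / 2) + \<i> * of_real (3 / 2 * \<xi>)"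
  by (simp add: rate_def cexpo_def complex_eq_iff power2_eq_square field_simps)

lemma F_row_0: "AE \<omega> in M. F 0 \<omega> $ 1 = axis 1 1"
  using F_start by eventually_elim (simp add: vec_eq_iff mat_def axis_def forall_2)

lemma twisted_mean_0: "twisted_mean \<xi> 0 = 1"
proof -
  have "twist \<xi> (axis 1 1) = 1" by (simp add: twist_def phase_def)
  then have "twisted_mean \<xi> 0 = expectation (\<lambda>\<omega>. 1)"
    unfolding twisted_mean_def using F_row_0
    by (intro integral_cong_AE) (auto elim!: eventually_mono)
  then show ?thesis by (simp add: prob_space)
qed

text \<open>Multiplied by \<open>exp (- c * t)\<close>, the twisted mean changes by
  \<open>O(\<eta> ^ 3)\<close> over a time \<open>\<eta>\<^sup>2\<close>; over a fine partition of
  \<open>[0, T]\<close> these changes sum to an arbitrarily small amount, so the product is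
  constant.\<close>

lemma twisted_mean_eq:
  assumes T: "T \<ge> 0"
  shows "twisted_mean \<xi> T = exp (rate \<xi> * of_real T)"
proof -
  define c where "c = rate \<xi>"
  obtain C where C: "C \<ge> 0" "\<And>s \<eta>. 0 \<le> s \<Longrightarrow> s + \<eta>\<^sup>2 \<le> T \<Longrightarrow> 0 < \<eta> \<Longrightarrow> \<eta> \<le> 1 \<Longrightarrow>
    norm (twisted_mean \<xi> (s + \<eta>\<^sup>2) - twisted_mean \<xi> s * (1 + of_real (\<eta>\<^sup>2) * c)) \<le> C * \<eta> ^ 3"
    by (rule twisted_mean_step[OF T, of \<xi>, folded rate_def, folded c_def]) (rule that)
  show ?thesis
  proof (cases "T = 0")
    case True
    then show ?thesis by (simp add: twisted_mean_0)
  next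
    case False
    with T have T0: "T > 0" by simp
    \<comment> \<open>Accounts for replacing \<open>1 + \<eta>\<^sup>2 * c\<close> by
      \<open>exp (c * \<eta>\<^sup>2)\<close>; the factor \<open>exp T\<close> bounds the twisted
      mean.\<close>
    define k where "k = exp (norm c) * (norm c)\<^sup>2 * exp T"
    have k: "k \<ge> 0" by (simp add: k_def)
    define D where "D = C + k"
    define f where "f = (\<lambda>t. twisted_mean \<xi> t * exp (- c * of_real t))"
    have step: "norm (f (s + \<eta>\<^sup>2) - f s) \<le> D * exp (norm c * T) * \<eta> ^ 3"
      if s: "0 \<le> s" "s + \<eta>\<^sup>2 \<le> T" "0 < \<eta>" "\<eta> \<le> 1" for s \<eta>
    proof -
      let ?m = "twisted_mean \<xi>"
      have \<eta>2: "\<eta>\<^sup>2 \<le> 1" "0 \<le> \<eta>\<^sup>2" using s by (auto simp: power_le_one)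
      have "norm (exp (c * of_real (\<eta>\<^sup>2)) - (\<Sum>i\<le>1. (c * of_real (\<eta>\<^sup>2)) ^ i / fact i)) \<le> exp (norm (c * of_real (\<eta>\<^sup>2))) * norm (c * of_real (\<eta>\<^sup>2)) ^ Suc 1 / fact 1"
        by (rule Taylor_exp_field)
      then have "norm (1 + of_real (\<eta>\<^sup>2) * c - exp (c * of_real (\<eta>\<^sup>2))) \<le> exp (norm c * \<eta>\<^sup>2) * (norm c * \<eta>\<^sup>2)\<^sup>2"
        by (simp add: norm_mult norm_power norm_minus_commute mult.commute power2_eq_square)
      also have "\<dots> \<le> exp (norm c) * ((norm c)\<^sup>2 * \<eta> ^ 3)"
      proof (rule mult_mono)
        show "exp (norm c * \<eta>\<^sup>2) \<le> exp (norm c)" using \<eta>2 by (simp add: mult_left_le)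
        have "(\<eta>\<^sup>2)\<^sup>2 \<le> \<eta> ^ 3" using power_decreasing[of 3 4 \<eta>] s by (simp add: power_mult[symmetric])
        then show "(norm c * \<eta>\<^sup>2)\<^sup>2 \<le> (norm c)\<^sup>2 * \<eta> ^ 3" by (simp add: power_mult_distrib mult_left_mono)
      qed auto
      finally have ex: "norm (1 + of_real (\<eta>\<^sup>2) * c - exp (c * of_real (\<eta>\<^sup>2))) \<le> exp (norm c) * ((norm c)\<^sup>2 * \<eta> ^ 3)" .
      have ms: "norm (?m s) \<le> exp T"
        using twist_integrable(2)[OF s(1), of \<xi>] s \<eta>2 exp_le_cancel_iff[of s T] by linarith
      have "?m (s + \<eta>\<^sup>2) - ?m s * exp (c * of_real (\<eta>\<^sup>2)) =
          (?m (s + \<eta>\<^sup>2) - ?m s * (1 + of_real (\<eta>\<^sup>2) * c)) + ?m s * (1 + of_real (\<eta>\<^sup>2) * c - exp (c * of_real (\<eta>\<^sup>2)))"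
        by (simp add: algebra_simps)
      also have "norm \<dots> \<le> C * \<eta> ^ 3 + exp T * (exp (norm c) * ((norm c)\<^sup>2 * \<eta> ^ 3))"
        by (rule norm_triangle_mono[OF C(2)[OF s]]) (unfold norm_mult, rule mult_mono[OF ms ex], auto)
      also have "\<dots> = D * \<eta> ^ 3" by (simp add: D_def k_def algebra_simps)
      finally have 1: "norm (?m (s + \<eta>\<^sup>2) - ?m s * exp (c * of_real (\<eta>\<^sup>2))) \<le> D * \<eta> ^ 3" .
      have "f (s + \<eta>\<^sup>2) - f s = (?m (s + \<eta>\<^sup>2) - ?m s * exp (c * of_real (\<eta>\<^sup>2))) * exp (- c * of_real (s + \<eta>\<^sup>2))"
        unfolding f_def left_diff_distrib mult.assoc exp_add[symmetric] by (simp add: algebra_simps)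
      also have "norm \<dots> \<le> D * \<eta> ^ 3 * exp (norm c * T)"
        unfolding norm_mult
      proof (rule mult_mono[OF 1])
        have "norm (exp (- c * of_real (s + \<eta>\<^sup>2))) \<le> exp (norm (- c * of_real (s + \<eta>\<^sup>2)))" by (rule norm_exp)
        also have "\<dots> \<le> exp (norm c * T)" using s \<eta>2 unfolding norm_mult norm_of_real by (simp add: mult_left_mono)
        finally show "norm (exp (- c * of_real (s + \<eta>\<^sup>2))) \<le> exp (norm c * T)" .
        show "0 \<le> D * \<eta> ^ 3" using C k s by (simp add: D_def)
      qed auto
      finally show ?thesis by (simp add: mult_ac)
    qed
    have "f T - f 0 = 0"
    proof -
      have le: "norm (f T - f 0) \<le> D * exp (norm c * T) * T * sqrt (T / real n)" if n: "n \<ge> 1" "T \<le> real n" for n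
      proof -
        \<comment> \<open>\<open>n\<close> steps of length \<open>\<eta>\<^sup>2 = T / n\<close>
          with error \<open>\<eta> ^ 3\<close> accumulate \<open>T * \<eta>\<close>.\<close>
        define \<eta> where "\<eta> = sqrt (T / real n)"
        have \<eta>: "0 < \<eta>" "\<eta> \<le> 1" "\<eta>\<^sup>2 = T / real n" using T0 n by (auto simp: \<eta>_def divide_le_eq)
        have iter: "i \<le> n \<Longrightarrow> norm (f (real i * \<eta>\<^sup>2) - f 0) \<le> real i * (D * exp (norm c * T) * \<eta> ^ 3)" for i
        proof (induction i)
          case (Suc i)
          have "real (Suc i) * \<eta>\<^sup>2 \<le> real n * \<eta>\<^sup>2" using Suc.prems by (intro mult_right_mono) auto
          moreover have "real n * \<eta>\<^sup>2 = T" using n \<eta>(3) by simp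
          moreover have "real (Suc i) * \<eta>\<^sup>2 = real i * \<eta>\<^sup>2 + \<eta>\<^sup>2" by (simp add: distrib_right)
          ultimately have "real i * \<eta>\<^sup>2 + \<eta>\<^sup>2 \<le> T" by linarith
          then have "norm (f (real i * \<eta>\<^sup>2 + \<eta>\<^sup>2) - f (real i * \<eta>\<^sup>2)) \<le> D * exp (norm c * T) * \<eta> ^ 3"
            by (intro step \<eta>) auto
          moreover have "norm (f (real i * \<eta>\<^sup>2) - f 0) \<le> real i * (D * exp (norm c * T) * \<eta> ^ 3)"
            using Suc by simp
          moreover have "real (Suc i) * \<eta>\<^sup>2 = real i * \<eta>\<^sup>2 + \<eta>\<^sup>2" by (simp add: algebra_simps)
          ultimately show ?case
            using norm_triangle_ineq[of "f (real i * \<eta>\<^sup>2 + \<eta>\<^sup>2) - f (real i * \<eta>\<^sup>2)" "f (real i * \<eta>\<^sup>2) - f 0"]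
            by (simp add: algebra_simps)
        qed simp
        have nT: "real n * \<eta>\<^sup>2 = T" using \<eta>(3) n by simp
        have "real n * (D * exp (norm c * T) * \<eta> ^ 3) = D * exp (norm c * T) * (real n * \<eta>\<^sup>2) * \<eta>"
          by (simp add: power_numeral_reduce algebra_simps)
        with iter[OF order_refl] show ?thesis unfolding nT unfolding \<eta>_def by linarith
      qed
      have "(\<lambda>n. D * exp (norm c * T) * T * sqrt (T / real n)) \<longlonglongrightarrow> D * exp (norm c * T) * T * sqrt 0"
        by (intro tendsto_intros tendsto_real_sqrt lim_const_over_n)
      then have "(\<lambda>n. D * exp (norm c * T) * T * sqrt (T / real n)) \<longlonglongrightarrow> 0" by simp
      moreover have "\<forall>\<^sub>F n in sequentially. norm (f T - f 0) \<le> D * exp (norm c * T) * T * sqrt (T / real n)"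
        using eventually_ge_at_top[of "max 1 (nat \<lceil>T\<rceil>)"]
        by eventually_elim (rule le, auto simp: nat_ceiling_le_eq)
      ultimately have "norm (f T - f 0) \<le> 0"
        by (intro tendsto_lowerbound[of _ 0 sequentially]) auto
      then show ?thesis by simp
    qed
    then have "twisted_mean \<xi> T * exp (- (c * of_real T)) = 1" by (simp add: f_def twisted_mean_0)
    then show ?thesis unfolding c_def[symmetric] exp_minus by (simp add: field_simps)
  qed
qed

text \<open>Under the measure with density \<open>|x|\<^sup>2 / e\<^sup>\<tau>\<close>, where \<open>x\<close> is the first row of \<open>F\<close>, the
  characteristic function of \<open>ln |x|\<^sup>2 - 3\<tau>/2\<close> is even, hence this variable is symmetric.\<close>

lemma row_tail:
  assumes \<tau>: "\<tau> \<ge> 0"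
  shows "expectation (\<lambda>\<omega>. (norm (F \<tau> \<omega> $ 1))\<^sup>2 * indicator {\<omega>. (norm (F \<tau> \<omega> $ 1))\<^sup>2 \<ge> exp (3/2 * \<tau>)} \<omega>) \<ge> exp \<tau> / 2"
proof -
  define \<rho> where "\<rho> = (\<lambda>\<omega>. (norm (F \<tau> \<omega> $ 1))\<^sup>2)"
  have [measurable]: "F \<tau> \<in> borel_measurable M" using \<tau> by auto
  have \<rho>m [measurable]: "\<rho> \<in> borel_measurable M" unfolding \<rho>_def by measurable
  have \<rho>0: "\<rho> \<omega> \<ge> 0" for \<omega> by (simp add: \<rho>_def)
  have \<rho>i: "integrable M \<rho>" "expectation \<rho> = exp \<tau>" using F_row_moment[OF \<tau>, of 1] by (auto simp: \<rho>_def)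
  define w where "w = (\<lambda>\<omega>. \<rho> \<omega> / exp \<tau>)"
  have wm [measurable]: "w \<in> borel_measurable M" unfolding w_def by measurable
  have w0: "w \<omega> \<ge> 0" for \<omega> using \<rho>0 by (simp add: w_def)
  define Q where "Q = density M (\<lambda>\<omega>. ennreal (w \<omega>))"
  have Qsets [measurable_cong]: "sets Q = sets M" by (simp add: Q_def)
  interpret Q: prob_space Q
  proof
    have "emeasure Q (space Q) = (\<integral>\<^sup>+\<omega>. ennreal (w \<omega>) \<partial>M)"
      by (simp add: Q_def emeasure_density)
    also have "\<dots> = ennreal (expectation w)"
      using \<rho>i(1) w0 by (intro nn_integral_eq_integral) (auto simp: w_def)
    also have "expectation w = 1" using \<rho>i by (simp add: w_def)
    finally show "emeasure Q (space Q) = 1" by simp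
  qed
  \<comment> \<open>Where the row vanishes the logarithm carries no information, but there the
    density \<open>w\<close> is zero.\<close>
  define Y where "Y = (\<lambda>\<omega>. ln (\<rho> \<omega>) - 3/2 * \<tau>)"
  have Ym [measurable]: "Y \<in> borel_measurable M" unfolding Y_def by measurable
  then have YQ [measurable]: "Y \<in> borel_measurable Q" by measurable
  have int: "(CLINT \<omega>|Q. iexp (\<xi> * Y \<omega>)) = exp (- of_real (\<xi>\<^sup>2 * \<tau> / 2))" for \<xi> :: real
  proof -
    have eq: "w \<omega> *\<^sub>R iexp (\<xi> * Y \<omega>) = exp (- of_real \<tau> - \<i> * of_real (\<xi> * (3/2 * \<tau>))) * twist \<xi> (F \<tau> \<omega> $ 1)" for \<omega>
    proof (cases "F \<tau> \<omega> $ 1 = 0")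
      case True
      then show ?thesis by (simp add: w_def \<rho>_def)
    next
      case False
      then have "twist \<xi> (F \<tau> \<omega> $ 1) = of_real (\<rho> \<omega>) * exp (\<i> * of_real (\<xi> * ln (\<rho> \<omega>)))"
        by (simp add: twist_def phase_eq \<rho>_def cis_conv_exp)
      moreover have "w \<omega> *\<^sub>R iexp (\<xi> * Y \<omega>) = of_real (\<rho> \<omega>) * (exp (- of_real \<tau>) * exp (\<i> * of_real (\<xi> * Y \<omega>)))"
        by (simp add: w_def scaleR_conv_of_real exp_minus field_simps exp_of_real)
      moreover have "exp (- of_real \<tau>) * exp (\<i> * of_real (\<xi> * Y \<omega>)) =
          exp (- of_real \<tau> - \<i> * of_real (\<xi> * (3/2 * \<tau>))) * exp (\<i> * of_real (\<xi> * ln (\<rho> \<omega>)))"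
        unfolding exp_add[symmetric] by (simp add: Y_def algebra_simps)
      ultimately show ?thesis by simp
    qed
    have "(CLINT \<omega>|Q. iexp (\<xi> * Y \<omega>)) = (CLINT \<omega>|M. w \<omega> *\<^sub>R iexp (\<xi> * Y \<omega>))"
      unfolding Q_def by (rule integral_density) (use w0 in auto)
    also have "\<dots> = exp (- of_real \<tau> - \<i> * of_real (\<xi> * (3/2 * \<tau>))) * twisted_mean \<xi> \<tau>"
      unfolding eq by (simp add: twisted_mean_def)
    also have "\<dots> = exp (- of_real \<tau> - \<i> * of_real (\<xi> * (3/2 * \<tau>)) + rate \<xi> * of_real \<tau>)"
      unfolding twisted_mean_eq[OF \<tau>] exp_add ..
    also have "- of_real \<tau> - \<i> * of_real (\<xi> * (3/2 * \<tau>)) + rate \<xi> * of_real \<tau> = - of_real (\<xi>\<^sup>2 * \<tau> / 2)"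
      unfolding rate_eq by (simp add: complex_eq_iff field_simps)
    finally show ?thesis .
  qed
  \<comment> \<open>The value \<open>int\<close> depends on \<open>\<xi>\<close> only through its
    square, so \<open>Y\<close> and \<open>- Y\<close> have the same characteristic
    function.\<close>
  have "distr Q borel Y = distr Q borel (\<lambda>\<omega>. - Y \<omega>)"
  proof (rule Levy_uniqueness)
    show "real_distribution (distr Q borel Y)" "real_distribution (distr Q borel (\<lambda>\<omega>. - Y \<omega>))"
      by (auto intro!: Q.real_distribution_distr)
    show "char (distr Q borel Y) = char (distr Q borel (\<lambda>\<omega>. - Y \<omega>))"
    proof
      fix \<xi> :: real
      have "char (distr Q borel Y) \<xi> = (CLINT \<omega>|Q. iexp (\<xi> * Y \<omega>))"
        unfolding char_def by (subst integral_distr) auto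
      moreover have "char (distr Q borel (\<lambda>\<omega>. - Y \<omega>)) \<xi> = (CLINT \<omega>|Q. iexp ((- \<xi>) * Y \<omega>))"
        unfolding char_def by (subst integral_distr) auto
      ultimately show "char (distr Q borel Y) \<xi> = char (distr Q borel (\<lambda>\<omega>. - Y \<omega>)) \<xi>"
        unfolding int by simp
    qed
  qed
  then have "measure (distr Q borel Y) {0..} = measure (distr Q borel (\<lambda>\<omega>. - Y \<omega>)) {0..}" by simp
  then have sym: "measure Q {\<omega>\<in>space M. Y \<omega> \<ge> 0} = measure Q {\<omega>\<in>space M. Y \<omega> \<le> 0}"
    by (simp add: measure_distr vimage_def Int_def Q_def conj_commute)
  \<comment> \<open>The two events overlap where \<open>Y = 0\<close>, which has full measure for
    \<open>\<tau> = 0\<close>; subadditivity gives the lower bound one half in every case.\<close>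
  have "space Q = {\<omega>\<in>space M. Y \<omega> \<ge> 0} \<union> {\<omega>\<in>space M. Y \<omega> \<le> 0}"
    unfolding Q_def space_density by (auto intro: linear)
  then have "1 = measure Q ({\<omega>\<in>space M. Y \<omega> \<ge> 0} \<union> {\<omega>\<in>space M. Y \<omega> \<le> 0})"
    using Q.prob_space by simp
  also have "\<dots> \<le> measure Q {\<omega>\<in>space M. Y \<omega> \<ge> 0} + measure Q {\<omega>\<in>space M. Y \<omega> \<le> 0}"
    by (rule measure_Un_le) measurable
  finally have half: "measure Q {\<omega>\<in>space M. Y \<omega> \<ge> 0} \<ge> 1/2" unfolding sym by simp
  let ?S = "{\<omega>\<in>space M. Y \<omega> \<ge> 0}"
  have "measure Q ?S = (\<integral>\<omega>. indicator ?S \<omega> \<partial>Q)" by (simp add: Q_def Int_absorb1)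
  also have "\<dots> = expectation (\<lambda>\<omega>. w \<omega> *\<^sub>R indicator ?S \<omega>)"
    unfolding Q_def by (rule integral_density) (use w0 in auto)
  also have "\<dots> \<le> expectation (\<lambda>\<omega>. (\<rho> \<omega> * indicator {\<omega>. \<rho> \<omega> \<ge> exp (3/2 * \<tau>)} \<omega>) / exp \<tau>)"
  proof (rule integral_mono')
    have "integrable M (\<lambda>\<omega>. \<rho> \<omega> * indicator {\<omega>. \<rho> \<omega> \<ge> exp (3/2 * \<tau>)} \<omega>)"
      by (rule integrable_dominated[OF \<rho>i(1)]) (auto simp: indicator_def)
    then show "integrable M (\<lambda>\<omega>. (\<rho> \<omega> * indicator {\<omega>. \<rho> \<omega> \<ge> exp (3/2 * \<tau>)} \<omega>) / exp \<tau>)" by simp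
    fix \<omega>
    show "w \<omega> *\<^sub>R indicator ?S \<omega> \<le> (\<rho> \<omega> * indicator {\<omega>. \<rho> \<omega> \<ge> exp (3/2 * \<tau>)} \<omega>) / exp \<tau>"
    proof (cases "\<rho> \<omega> > 0 \<and> Y \<omega> \<ge> 0")
      case True
      then have "3/2 * \<tau> \<le> ln (\<rho> \<omega>)" by (simp add: Y_def)
      with True have "\<rho> \<omega> \<ge> exp (3/2 * \<tau>)" using ln_ge_iff by blast
      then show ?thesis using \<rho>0[of \<omega>] by (simp add: w_def indicator_def)
    next
      case False
      then have "\<rho> \<omega> = 0 \<or> \<omega> \<notin> ?S" using \<rho>0[of \<omega>] by (auto simp: less_le)
      then show ?thesis using \<rho>0[of \<omega>] by (auto simp: w_def indicator_def)
    qed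
  qed (use \<rho>0 in auto)
  also have "\<dots> = expectation (\<lambda>\<omega>. \<rho> \<omega> * indicator {\<omega>. \<rho> \<omega> \<ge> exp (3/2 * \<tau>)} \<omega>) / exp \<tau>"
    by simp
  finally have "1/2 \<le> expectation (\<lambda>\<omega>. \<rho> \<omega> * indicator {\<omega>. \<rho> \<omega> \<ge> exp (3/2 * \<tau>)} \<omega>) / exp \<tau>"
    by (rule order_trans[OF half])
  then show ?thesis unfolding \<rho>_def by (simp add: pos_le_divide_eq mult.commute)
qed

end

theorem lemma4:
  fixes M :: "'a measure" and FF :: "real \<Rightarrow> 'a measure"
    and B F :: "real \<Rightarrow> 'a \<Rightarrow> real^2^2" and \<tau> :: real
  assumes "geometric_brownian_motion_SL2 M FF B F"
    and "\<tau> \<ge> 0"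
  shows "(\<integral>\<omega>. frobenius_sq (F \<tau> \<omega>) *
              indicat_real {\<omega>. frobenius_sq (F \<tau> \<omega>) \<ge>
                1 / (2 * sqrt 2) * (\<integral>\<omega>'. frobenius_sq (F \<tau> \<omega>') \<partial>M) powr (3/2)} \<omega> \<partial>M)
         \<ge> 1/4 * (\<integral>\<omega>. frobenius_sq (F \<tau> \<omega>) \<partial>M)"
proof -
  interpret geometric_brownian_motion_SL2 M FF B F by fact
  have [measurable]: "F \<tau> \<in> borel_measurable M" using assms(2) by auto
  note F2 = F_norm_moment[OF assms(2)]
  \<comment> \<open>The factor \<open>2 * sqrt 2\<close> is \<open>2 powr (3/2)\<close> and cancels
    the 2 in the second moment \<open>2 * exp \<tau>\<close>; the threshold becomes the one of
    \<open>row_tail\<close>.\<close>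
  have "(2 * exp \<tau>) powr (3/2) = (2 * sqrt 2) * exp (3/2 * \<tau>)"
  proof -
    have "(2 * exp \<tau>) powr (3/2) = 2 powr (1 + 1/2) * exp \<tau> powr (3/2)" by (simp add: powr_mult)
    also have "2 powr (1 + 1/2 :: real) = 2 * sqrt 2" by (subst powr_add) (simp add: powr_half_sqrt)
    also have "exp \<tau> powr (3/2) = exp (3/2 * \<tau>)" by (simp add: powr_def)
    finally show ?thesis .
  qed
  then have thr: "1 / (2 * sqrt 2) * (2 * exp \<tau>) powr (3/2) = exp (3/2 * \<tau>)" by simp
  have le: "(norm (F \<tau> \<omega> $ 1))\<^sup>2 \<le> (norm (F \<tau> \<omega>))\<^sup>2" for \<omega>
    by (intro power_mono Finite_Cartesian_Product.norm_nth_le) auto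
  \<comment> \<open>One half is lost by keeping a single row and one half by symmetry. Passing from
    the row to the whole matrix enlarges both the integrand and the event.\<close>
  have "1/4 * (2 * exp \<tau>) = exp \<tau> / 2" by simp
  also have "\<dots> \<le> expectation (\<lambda>\<omega>. (norm (F \<tau> \<omega> $ 1))\<^sup>2 * indicator {\<omega>. (norm (F \<tau> \<omega> $ 1))\<^sup>2 \<ge> exp (3/2 * \<tau>)} \<omega>)"
    by (rule row_tail[OF assms(2)])
  also have "\<dots> \<le> expectation (\<lambda>\<omega>. (norm (F \<tau> \<omega>))\<^sup>2 * indicator {\<omega>. (norm (F \<tau> \<omega>))\<^sup>2 \<ge> exp (3/2 * \<tau>)} \<omega>)"
  proof (rule integral_mono')
    show "integrable M (\<lambda>\<omega>. (norm (F \<tau> \<omega>))\<^sup>2 * indicator {\<omega>. (norm (F \<tau> \<omega>))\<^sup>2 \<ge> exp (3/2 * \<tau>)} \<omega>)"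
      by (rule integrable_dominated[OF F2(1)]) (auto simp: indicator_def)
    show "(norm (F \<tau> \<omega> $ 1))\<^sup>2 * indicator {\<omega>. (norm (F \<tau> \<omega> $ 1))\<^sup>2 \<ge> exp (3/2 * \<tau>)} \<omega>
        \<le> (norm (F \<tau> \<omega>))\<^sup>2 * indicator {\<omega>. (norm (F \<tau> \<omega>))\<^sup>2 \<ge> exp (3/2 * \<tau>)} \<omega>" for \<omega>
    proof (cases "(norm (F \<tau> \<omega> $ 1))\<^sup>2 \<ge> exp (3/2 * \<tau>)")
      case True
      from order_trans[OF this le] True show ?thesis using le[of \<omega>] by (simp add: indicator_def)
    next
      case False
      then show ?thesis by (simp add: indicator_def)
    qed
  qed (auto simp: indicator_def)
  finally show ?thesis unfolding frobenius_sq_eq_norm F2(2) thr .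
qed

end
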